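(* For a finite graph $G$ the following are equivalent: (i) $G$ is a mirror graph; (ii) $G$ is (isomorphic to) the Cayley graph of a finite Coxeter group with respect to its Coxeter generating set; (iii) $G$ is the tope graph of a reflection arrangement.
   Context: A mirror graph is a finite connected simple graph $G$ admitting a partition $\{E_1,\dots,E_k\}$ of its edges such that for every $i$ there is an automorphism $\alpha_i$ of $G$ with (a) $\alpha_i(u)=v$, $\alpha_i(v)=u$ for every edge $uv\in E_i$, and (b) $G-E_i$ has exactly two connected components $G_i^1,G_i^2$ and $\alpha_i$ maps $G_i^1$ isomorphically onto $G_i^2$. A Coxeter group is a group with presentation $\langle \alpha_1,\dots,\alpha_m\mid (\alpha_i\alpha_j)^{k_{ij}}=1\ \text{for all } i,j\rangle$ with $k_{ii}=1$ and $k_{ij}\ge 2$ (possibly $\infty$, meaning no relation) for $i\ne j$; its Cayley graph $\mathrm{Cay}(A,S)$ with $S=\{\alpha_1,\dots,\alpha_m\}$ has vertex set $A$, with $\beta_1,\beta_2$ adjacent iff $\beta_1=\alpha_i\beta_2$ for some $i$. A reflection arrangement is a finite set of pairwise distinct linear hyperplanes $H_1,\dots,H_m$ in $\mathbb R^n$ (all through the origin) such that for each $i$ the orthogonal reflection $\sigma_{H_i}(x)=x-2\frac{x\cdot v_i}{v_i\cdot v_i}v_i$ ($v_i$ a normal vector of $H_i$) permutes $\{H_1,\dots,H_m\}$. Its tope graph has as vertices the chambers (connected components of $\mathbb R^n\setminus\bigcup H_i$), two chambers being adjacent iff they are separated by exactly one hyperplane. *)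

theory Defs
  imports "HOL-Analysis.Analysis" "HOL-Library.Extended_Nat"
begin

definition simple_graph :: "'a set \<Rightarrow> 'a set set \<Rightarrow> bool" where
  "simple_graph V E \<longleftrightarrow> (\<forall>e\<in>E. \<exists>u v. e = {u, v} \<and> u \<noteq> v \<and> u \<in> V \<and> v \<in> V)"

definition adj :: "'a set \<Rightarrow> 'a set set \<Rightarrow> 'a \<Rightarrow> 'a \<Rightarrow> bool" where
  "adj V E u v \<longleftrightarrow> u \<in> V \<and> v \<in> V \<and> {u, v} \<in> E"

definition reach :: "'a set \<Rightarrow> 'a set set \<Rightarrow> 'a \<Rightarrow> 'a \<Rightarrow> bool" where
  "reach V E = (adj V E)\<^sup>*\<^sup>*"

definition graph_connected :: "'a set \<Rightarrow> 'a set set \<Rightarrow> bool" where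
  "graph_connected V E \<longleftrightarrow> V \<noteq> {} \<and> (\<forall>u\<in>V. \<forall>v\<in>V. reach V E u v)"

definition components :: "'a set \<Rightarrow> 'a set set \<Rightarrow> 'a set set" where
  "components V E = {{v \<in> V. reach V E u v} | u. u \<in> V}"

definition induced_edges :: "'a set set \<Rightarrow> 'a set \<Rightarrow> 'a set set" where
  "induced_edges E C = {e \<in> E. e \<subseteq> C}"

definition graph_iso_map :: "('a \<Rightarrow> 'b) \<Rightarrow> 'a set \<Rightarrow> 'a set set \<Rightarrow> 'b set \<Rightarrow> 'b set set \<Rightarrow> bool" where
  "graph_iso_map f V E V' E' \<longleftrightarrow> bij_betw f V V' \<and>
     (\<forall>u\<in>V. \<forall>v\<in>V. {u, v} \<in> E \<longleftrightarrow> {f u, f v} \<in> E')"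

definition graph_iso :: "'a set \<Rightarrow> 'a set set \<Rightarrow> 'b set \<Rightarrow> 'b set set \<Rightarrow> bool" where
  "graph_iso V E V' E' \<longleftrightarrow> (\<exists>f. graph_iso_map f V E V' E')"

definition graph_aut :: "('a \<Rightarrow> 'a) \<Rightarrow> 'a set \<Rightarrow> 'a set set \<Rightarrow> bool" where
  "graph_aut f V E \<longleftrightarrow> graph_iso_map f V E V E"

definition edge_partition :: "'a set set \<Rightarrow> 'a set set set \<Rightarrow> bool" where
  "edge_partition E P \<longleftrightarrow> (\<forall>X\<in>P. X \<noteq> {}) \<and> (\<forall>X\<in>P. \<forall>Y\<in>P. X \<noteq> Y \<longrightarrow> X \<inter> Y = {}) \<and> \<Union>P = E"

definition mirror_graph :: "'a set \<Rightarrow> 'a set set \<Rightarrow> bool" where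
  "mirror_graph V E \<longleftrightarrow> finite V \<and> simple_graph V E \<and> graph_connected V E \<and>
    (\<exists>P. edge_partition E P \<and>
      (\<forall>X\<in>P. \<exists>\<alpha>. graph_aut \<alpha> V E \<and>
         (\<forall>u v. {u, v} \<in> X \<longrightarrow> \<alpha> u = v \<and> \<alpha> v = u) \<and>
         (\<exists>C1 C2. C1 \<noteq> C2 \<and> components V (E - X) = {C1, C2} \<and>
            graph_iso_map \<alpha> C1 (induced_edges (E - X) C1) C2 (induced_edges (E - X) C2))))"

text \<open>Generators are indexed by 0..<m; a word is a list of generator indices, read as the
  product of the generators from left to right. The Coxeter matrix k has entries in enat,
  \<infinity> meaning no relation.\<close>

definition coxeter_matrix :: "nat \<Rightarrow> (nat \<Rightarrow> nat \<Rightarrow> enat) \<Rightarrow> bool" where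
  "coxeter_matrix m k \<longleftrightarrow> (\<forall>i<m. k i i = 1) \<and>
     (\<forall>i<m. \<forall>j<m. i \<noteq> j \<longrightarrow> k i j \<ge> 2 \<and> k i j = k j i)"

definition cox_relator :: "nat \<Rightarrow> (nat \<Rightarrow> nat \<Rightarrow> enat) \<Rightarrow> nat list \<Rightarrow> bool" where
  "cox_relator m k r \<longleftrightarrow> (\<exists>i j n. i < m \<and> j < m \<and> k i j = enat n \<and> r = concat (replicate n [i, j]))"

text \<open>the congruence on words generated by the relators (since every generator is an involution,
  the presented group is the quotient of the word monoid by this congruence)\<close>
inductive cox_equiv :: "nat \<Rightarrow> (nat \<Rightarrow> nat \<Rightarrow> enat) \<Rightarrow> nat list \<Rightarrow> nat list \<Rightarrow> bool"
  for m k where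
  refl: "cox_equiv m k w w"
| sym: "cox_equiv m k w w' \<Longrightarrow> cox_equiv m k w' w"
| trans: "cox_equiv m k w w' \<Longrightarrow> cox_equiv m k w' w'' \<Longrightarrow> cox_equiv m k w w''"
| rel: "cox_relator m k r \<Longrightarrow> cox_equiv m k (u @ r @ v) (u @ v)"

definition cox_class :: "nat \<Rightarrow> (nat \<Rightarrow> nat \<Rightarrow> enat) \<Rightarrow> nat list \<Rightarrow> nat list set" where
  "cox_class m k w = {w' \<in> lists {..<m}. cox_equiv m k w w'}"

definition cox_elems :: "nat \<Rightarrow> (nat \<Rightarrow> nat \<Rightarrow> enat) \<Rightarrow> nat list set set" where
  "cox_elems m k = cox_class m k ` lists {..<m}"

definition cox_cayley_edges :: "nat \<Rightarrow> (nat \<Rightarrow> nat \<Rightarrow> enat) \<Rightarrow> nat list set set set" where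
  "cox_cayley_edges m k = {{cox_class m k (i # w), cox_class m k w} | i w. i < m \<and> w \<in> lists {..<m}}"

definition Rn :: "nat \<Rightarrow> (nat \<Rightarrow> real) set" where
  "Rn n = {x. \<forall>i\<ge>n. x i = 0}"

definition dotn :: "nat \<Rightarrow> (nat \<Rightarrow> real) \<Rightarrow> (nat \<Rightarrow> real) \<Rightarrow> real" where
  "dotn n x y = (\<Sum>i<n. x i * y i)"

definition hyp :: "nat \<Rightarrow> (nat \<Rightarrow> real) \<Rightarrow> (nat \<Rightarrow> real) set" where
  "hyp n v = {x \<in> Rn n. dotn n x v = 0}"

definition reflect :: "nat \<Rightarrow> (nat \<Rightarrow> real) \<Rightarrow> (nat \<Rightarrow> real) \<Rightarrow> (nat \<Rightarrow> real)" where
  "reflect n v x = (\<lambda>i. x i - 2 * (dotn n x v / dotn n v v) * v i)"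

definition reflection_arrangement :: "nat \<Rightarrow> (nat \<Rightarrow> real) set set \<Rightarrow> bool" where
  "reflection_arrangement n \<H> \<longleftrightarrow> finite \<H> \<and>
     (\<forall>H\<in>\<H>. \<exists>v\<in>Rn n. v \<noteq> (\<lambda>_. 0) \<and> H = hyp n v \<and> (\<forall>H'\<in>\<H>. reflect n v ` H' \<in> \<H>))"

text \<open>chambers: connected components of R^n minus the union of the hyperplanes
  (topology: subspace of the product topology on nat => real, i.e. the Euclidean topology of R^n)\<close>
definition chambers :: "nat \<Rightarrow> (nat \<Rightarrow> real) set set \<Rightarrow> (nat \<Rightarrow> real) set set" where
  "chambers n \<H> = {connected_component_set (Rn n - \<Union>\<H>) x | x. x \<in> Rn n - \<Union>\<H>}"

definition separates :: "nat \<Rightarrow> (nat \<Rightarrow> real) set \<Rightarrow> (nat \<Rightarrow> real) set \<Rightarrow> (nat \<Rightarrow> real) set \<Rightarrow> bool" where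
  "separates n H C D \<longleftrightarrow> (\<exists>v\<in>Rn n. v \<noteq> (\<lambda>_. 0) \<and> H = hyp n v \<and>
      (\<forall>x\<in>C. dotn n x v > 0) \<and> (\<forall>y\<in>D. dotn n y v < 0))"

definition tope_edges :: "nat \<Rightarrow> (nat \<Rightarrow> real) set set \<Rightarrow> (nat \<Rightarrow> real) set set set" where
  "tope_edges n \<H> = {{C, D} | C D. C \<in> chambers n \<H> \<and> D \<in> chambers n \<H> \<and>
      card {H \<in> \<H>. separates n H C D \<or> separates n H D C} = 1}"

end

theory Submission
  imports Defs "HOL-Combinatorics.Permutations"
begin

text \<open>In a mirror graph a geodesic crosses each class at most once, since folding the part between two
  crossings along the mirror automorphism would shorten it. Hence the distance of two vertices is the
  number of classes separating them, and the mirrors act like reflections. Two mirrors at a vertex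
  generate a cycle that is convex enough to show that an automorphism fixing all edges of a class is
  trivial; so the mirror automorphism of a class is unique and conjugation permutes the mirrors. The
  mirrors at a base vertex then satisfy the exchange condition, and Matsumoto's argument yields a Coxeter
  presentation of a group acting simply transitively on the vertices.

  Given a finite Coxeter group, Tits' positivity theorem for the geometric representation describes the
  signs of roots by word length, so that the sign vectors of the chambers cut out by the root hyperplanes
  correspond to the group elements. Finally, in a reflection arrangement the edges crossing one
  hyperplane form a class whose mirror automorphism is induced by the orthogonal reflection.\<close>

section \<open>Words in Coxeter generators\<close>

text \<open>The definition of a mirror graph does not say that the automorphism of a class is
  unique, that it is an involution, or that it permutes the classes. The last point is settled
  metrically: whether two edges share a class can be read off from the distances between their ends,
  so every automorphism respects it. Uniqueness is the real obstacle. Without it, a conjugate of a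
  mirror is merely some automorphism reversing the right class, whereas the exchange argument needs
  it to be the mirror itself. It is obtained from local to global: dihedral cycles at one vertex
  control the neighbours of that vertex, and this spreads from vertex to vertex. In the geometric
  part the bilinear form is never shown to be positive definite. Averaging over the finite group
  supplies an invariant inner product, and only the numbers \<open>form x i\<close> are compared
  with it. The root hyperplanes live in the space of all coordinates of all images under the group,
  which may be larger than the span of the roots; sign vectors of chambers do not notice
  this.\<close>

lemma cox_equiv_context: "cox_equiv m k w w' \<Longrightarrow> cox_equiv m k (a @ w @ b) (a @ w' @ b)"
proof (induction rule: cox_equiv.induct)
  case (rel r u v)
  have "cox_equiv m k ((a @ u) @ r @ (v @ b)) ((a @ u) @ (v @ b))" by (rule cox_equiv.rel[OF rel])
  then show ?case by simp
qed (auto intro: cox_equiv.refl cox_equiv.sym cox_equiv.trans)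

lemma cox_equiv_append:
  assumes "cox_equiv m k w w'" "cox_equiv m k v v'" shows "cox_equiv m k (w @ v) (w' @ v')"
  using cox_equiv_context[OF assms(1), of "[]" v] cox_equiv_context[OF assms(2), of w' "[]"] cox_equiv.trans
  by fastforce

lemma cox_equiv_Cons: "cox_equiv m k w w' \<Longrightarrow> cox_equiv m k (i # w) (i # w')"
  using cox_equiv_append[OF cox_equiv.refl, of m k w w' "[i]"] by simp

lemma cox_relator_lists: "cox_relator m k r \<Longrightarrow> r \<in> lists {..<m}"
proof -
  have "concat (replicate n [i, j]) \<in> lists {..<m}" if "i < m" "j < m" for n i j
    using that by (induction n) auto
  then show "cox_relator m k r \<Longrightarrow> r \<in> lists {..<m}" by (auto simp: cox_relator_def)
qed

lemma cox_equiv_lists: "cox_equiv m k w w' \<Longrightarrow> w \<in> lists {..<m} \<longleftrightarrow> w' \<in> lists {..<m}"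
proof (induction rule: cox_equiv.induct)
  case (rel r u v)
  then show ?case using cox_relator_lists[OF rel] by simp
qed auto

text \<open>Relators have even length, so parity is an invariant of the group element. This later
  excludes that appending a generator leaves the length unchanged.\<close>

lemma cox_equiv_even: "cox_equiv m k w w' \<Longrightarrow> even (length w) \<longleftrightarrow> even (length w')"
proof (induction rule: cox_equiv.induct)
  case (rel r u v)
  then have "even (length r)" by (auto simp: cox_relator_def length_concat sum_list_replicate)
  then show ?case by simp
qed auto

lemma cox_class_eq_iff:
  assumes "w \<in> lists {..<m}" "w' \<in> lists {..<m}"
  shows "cox_class m k w = cox_class m k w' \<longleftrightarrow> cox_equiv m k w w'"
proof
  assume "cox_class m k w = cox_class m k w'"
  moreover have "w' \<in> cox_class m k w'" using assms by (simp add: cox_class_def cox_equiv.refl)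
  ultimately show "cox_equiv m k w w'" by (auto simp: cox_class_def)
next
  assume "cox_equiv m k w w'"
  then show "cox_class m k w = cox_class m k w'"
    by (auto simp: cox_class_def intro: cox_equiv.trans cox_equiv.sym)
qed

lemma cox_square: assumes "coxeter_matrix m k" "i < m" shows "cox_equiv m k [i, i] []"
proof -
  have "cox_relator m k [i, i]"
    unfolding cox_relator_def
    by (rule exI[of _ i], rule exI[of _ i], rule exI[of _ 1])
       (use assms in \<open>auto simp: coxeter_matrix_def one_enat_def\<close>)
  from cox_equiv.rel[OF this, of "[]" "[]"] show ?thesis by simp
qed

lemma rev_in_lists [simp]: "rev w \<in> lists A \<longleftrightarrow> w \<in> lists A"
  by (simp add: in_lists_conv_set)

lemma cox_rev_left: assumes "coxeter_matrix m k" "w \<in> lists {..<m}" shows "cox_equiv m k (rev w @ w) []"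
  using assms(2)
proof (induction w)
  case (Cons i w)
  have "cox_equiv m k (rev w @ [i, i] @ w) (rev w @ [] @ w)"
    by (rule cox_equiv_context[OF cox_square[OF assms(1)]]) (use Cons in auto)
  then show ?case using Cons cox_equiv.trans by fastforce
qed (simp add: cox_equiv.refl)

lemma cox_rev_right: assumes "coxeter_matrix m k" "w \<in> lists {..<m}" shows "cox_equiv m k (w @ rev w) []"
  using cox_rev_left[OF assms(1), of "rev w"] assms(2) by simp

primrec alt :: "nat \<Rightarrow> 'a \<Rightarrow> 'a \<Rightarrow> 'a list" where
  "alt 0 i j = []"
| "alt (Suc n) i j = i # alt n j i"

lemma length_alt [simp]: "length (alt n i j) = n"
  by (induction n arbitrary: i j) auto

lemma alt_lists: "i \<in> A \<Longrightarrow> j \<in> A \<Longrightarrow> alt n i j \<in> lists A"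
  by (induction n arbitrary: i j) auto

lemma concat_replicate_alt: "concat (replicate n [i, j]) = alt (2 * n) i j"
  by (induction n) auto

lemma alt_add_even: "alt (n + k) i j = alt n i j @ (if even n then alt k i j else alt k j i)"
  by (induction n arbitrary: i j) auto

lemma alt_Suc_right: "alt (Suc n) i j = alt n i j @ [if even n then i else j]"
  using alt_add_even[of n 1 i j] by simp

lemma rev_alt: "rev (alt n i j) = (if even n then alt n j i else alt n i j)"
proof (induction n arbitrary: i j)
  case (Suc n)
  have "rev (alt (Suc n) i j) = (if even n then i else j) # rev (alt n i j)"
    unfolding alt_Suc_right[of n] by simp
  then show ?case using Suc by simp
qed simp

lemma alt_double: "alt (2 * n) i j = alt n i j @ rev (alt n j i)"
  unfolding mult_2 alt_add_even rev_alt by simp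

text \<open>The relator is \<open>alt n i j\<close> followed by the reverse, hence the inverse, of
  \<open>alt n j i\<close>. Cancelling that inverse gives the braid form of the relation, the one
  used in the arguments of Matsumoto and Tits.\<close>

lemma cox_braid:
  assumes M: "coxeter_matrix m k" and ij: "i < m" "j < m" "k i j = enat n"
  shows "cox_equiv m k (alt n i j) (alt n j i)"
proof -
  have W: "alt n j i \<in> lists {..<m}" by (rule alt_lists) (use ij in auto)
  have "cox_relator m k (alt (2 * n) i j)"
    using ij unfolding cox_relator_def concat_replicate_alt[symmetric] by blast
  from cox_equiv.rel[OF this, of "[]" "alt n j i"]
  have 1: "cox_equiv m k (alt n i j @ (rev (alt n j i) @ alt n j i)) (alt n j i)" by (simp add: alt_double)
  have "cox_equiv m k (alt n i j @ (rev (alt n j i) @ alt n j i)) (alt n i j @ [])"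
    by (rule cox_equiv_append[OF cox_equiv.refl cox_rev_left[OF M W]])
  then have "cox_equiv m k (alt n i j @ (rev (alt n j i) @ alt n j i)) (alt n i j)" by simp
  from cox_equiv.trans[OF cox_equiv.sym[OF this] 1] show ?thesis .
qed

section \<open>Mirror systems\<close>

definition sep :: "'c set \<Rightarrow> ('c \<Rightarrow> 'a \<Rightarrow> bool) \<Rightarrow> 'a \<Rightarrow> 'a \<Rightarrow> 'c set" where
  "sep P side u v = {X \<in> P. side X u \<noteq> side X v}"

lemma sep_commute: "sep P side u v = sep P side v u"
  by (auto simp: sep_def)

lemma sep_self [simp]: "sep P side u u = {}"
  by (auto simp: sep_def)

lemma mem_sep_cases: "X \<in> P \<Longrightarrow> X \<in> sep P side u w \<longleftrightarrow> (X \<in> sep P side u v) \<noteq> (X \<in> sep P side v w)"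
  by (auto simp: sep_def)

text \<open>\<open>P\<close> indexes the classes, \<open>side X\<close> is one of the two halves of the class \<open>X\<close>, and edges are the pairs
  separated by exactly one class. Both mirror graphs and tope graphs give rise to such systems.\<close>

locale mirror_system =
  fixes V :: "'a set" and P :: "'c set" and side :: "'c \<Rightarrow> 'a \<Rightarrow> bool" and r :: "'c \<Rightarrow> 'a \<Rightarrow> 'a"
  assumes finite_V: "finite V" and V_nonempty: "V \<noteq> {}" and finite_P: "finite P"
    and step: "u \<in> V \<Longrightarrow> v \<in> V \<Longrightarrow> u \<noteq> v \<Longrightarrow> \<exists>z\<in>V. \<exists>X\<in>sep P side u v. sep P side z v = {X}"
    and r_permutes: "X \<in> P \<Longrightarrow> r X permutes V"
    and r_r: "X \<in> P \<Longrightarrow> r X (r X v) = v"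
    and r_flip: "X \<in> P \<Longrightarrow> v \<in> V \<Longrightarrow> side X (r X v) \<noteq> side X v"
    and r_swap: "u \<in> V \<Longrightarrow> v \<in> V \<Longrightarrow> sep P side u v = {X} \<Longrightarrow> r X u = v"
    and r_edge: "X \<in> P \<Longrightarrow> u \<in> V \<Longrightarrow> v \<in> V \<Longrightarrow> card (sep P side u v) = 1 \<Longrightarrow>
                   card (sep P side (r X u) (r X v)) = 1"
begin

abbreviation S where "S \<equiv> sep P side"
abbreviation D where "D u v \<equiv> card (S u v)"

lemma S_sub: "S u v \<subseteq> P" by (auto simp: sep_def)
lemma finite_S [simp]: "finite (S u v)" using S_sub finite_P finite_subset by blast
lemma D_sym: "D u v = D v u" by (simp add: sep_commute)
lemma S_singleton_P: "S u v = {X} \<Longrightarrow> X \<in> P" using S_sub by blast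

lemma S_tri: "S u w \<subseteq> S u v \<union> S v w" by (auto simp: sep_def)
lemma D_tri: "D u w \<le> D u v + D v w"
  by (rule order.trans[OF card_mono[OF _ S_tri[of u w v]]]) (auto intro: card_Un_le)

lemma D_disjoint: assumes "S u v \<inter> S v w = {}" shows "D u w = D u v + D v w"
proof -
  have "S u w = S u v \<union> S v w" using assms by (auto simp: sep_def)
  then show ?thesis using assms by (simp add: card_Un_disjoint)
qed

text \<open>Across an edge only its own class changes status. Hence the distances from its ends to
  any w differ by exactly one, and the nearer end tells on which side of X the vertex w
  lies.\<close>

lemma edge_D: assumes "S a b = {X}"
  shows "(X \<in> S b w \<and> X \<notin> S a w \<and> S b w = insert X (S a w) \<and> D b w = D a w + 1) \<or>
         (X \<notin> S b w \<and> X \<in> S a w \<and> S a w = insert X (S b w) \<and> D a w = D b w + 1)"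
proof -
  have XP: "X \<in> P" using assms S_singleton_P by blast
  have e: "Y \<in> P \<Longrightarrow> side Y a \<noteq> side Y b \<longleftrightarrow> Y = X" for Y
    using assms by (auto simp: sep_def)
  show ?thesis
  proof (cases "side X w = side X a")
    case True
    have "S b w = insert X (S a w)" "X \<notin> S a w" using True e XP by (auto simp: sep_def)
    then show ?thesis by simp
  next
    case False
    have "S a w = insert X (S b w)" "X \<notin> S b w" using False e XP by (auto simp: sep_def)
    then show ?thesis by simp
  qed
qed

lemma S_empty: assumes "u \<in> V" "v \<in> V" "S u v = {}" shows "u = v"
  using step[OF assms(1,2)] assms(3) by auto

text \<open>The tool for induction along geodesics: z is the last vertex before v on a geodesic from
  u, and X is the class of the final edge.\<close>

lemma stepE: assumes "u \<in> V" "v \<in> V" "u \<noteq> v"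
  obtains z X where "z \<in> V" "S z v = {X}" "X \<in> S u v" "X \<notin> S u z" "D u v = D u z + 1" "S u v = insert X (S u z)"
proof -
  obtain z X where z: "z \<in> V" "X \<in> S u v" "S z v = {X}" using step[OF assms] by blast
  have "X \<in> S v u" using z by (simp add: sep_commute)
  with edge_D[OF z(3), of u] have "X \<notin> S z u" "D v u = D z u + 1" "S v u = insert X (S z u)" by auto
  then show ?thesis using that[OF z(1,3,2)] by (simp add: sep_commute D_sym)
qed

lemma adj_class: assumes "D u v = 1" obtains X where "S u v = {X}" "X \<in> P"
  using assms S_singleton_P by (metis card_1_singletonE)

lemma r_in [simp]: "X \<in> P \<Longrightarrow> r X v \<in> V \<longleftrightarrow> v \<in> V"
  by (rule permutes_in_image[OF r_permutes])

text \<open>Follow a geodesic from u to v and reflect the part behind its crossing of X: the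
  crossing edge collapses, the other edges are kept, and the reflected walk ends in
  \<open>r X v\<close>.\<close>

lemma fold: assumes "X \<in> P" "u \<in> V" "v \<in> V" "X \<in> S u v" shows "D u (r X v) < D u v"
  using assms(3,4)
proof (induction "D u v" arbitrary: v rule: less_induct)
  case less
  have "u \<noteq> v" using less.prems by auto
  from stepE[OF assms(2) less.prems(1) this] obtain z Z where z: "z \<in> V" "S z v = {Z}" "Z \<in> S u v" "Z \<notin> S u z"
    "D u v = D u z + 1" "S u v = insert Z (S u z)" by metis
  show ?case
  proof (cases "Z = X")
    case True
    have "r X z = v" using r_swap[OF z(1) less.prems(1)] z True by simp
    then have "r X v = z" using r_r[OF assms(1)] by metis
    then show ?thesis using z by simp
  next
    case False
    then have "X \<in> S u z" using z less.prems by auto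
    with less.hyps[of z] z have "D u (r X z) < D u z" by simp
    moreover have "D (r X z) (r X v) = 1" using r_edge[OF assms(1) z(1) less.prems(1)] z(2) by simp
    ultimately show ?thesis using D_tri[of u "r X v" "r X z"] z(5) by linarith
  qed
qed

section \<open>Automorphisms and their action on edge classes\<close>

definition aut :: "('a \<Rightarrow> 'a) \<Rightarrow> bool" where
  "aut f \<longleftrightarrow> f permutes V \<and> (\<forall>u\<in>V. \<forall>v\<in>V. D (f u) (f v) = 1 \<longleftrightarrow> D u v = 1)"

lemma aut_permutes: "aut f \<Longrightarrow> f permutes V" by (simp add: aut_def)
lemma aut_in [simp]: "aut f \<Longrightarrow> f v \<in> V \<longleftrightarrow> v \<in> V"
  by (rule permutes_in_image) (simp add: aut_def)
lemma aut_adj: "aut f \<Longrightarrow> u \<in> V \<Longrightarrow> v \<in> V \<Longrightarrow> D (f u) (f v) = 1 \<longleftrightarrow> D u v = 1"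
  by (simp add: aut_def)

lemma aut_id: "aut id" by (simp add: aut_def permutes_id)
lemma aut_comp: "aut f \<Longrightarrow> aut g \<Longrightarrow> aut (f \<circ> g)"
  by (simp add: aut_def permutes_compose permutes_in_image)
lemma aut_inv: assumes "aut f" shows "aut (inv f)"
proof -
  have p: "f permutes V" using assms aut_permutes by blast
  have q: "inv f permutes V" using permutes_inv[OF p] .
  have "D (inv f u) (inv f v) = 1 \<longleftrightarrow> D u v = 1" if "u \<in> V" "v \<in> V" for u v
    using aut_adj[OF assms, of "inv f u" "inv f v"] that permutes_in_image[OF q] permutes_inverses(1)[OF p] by simp
  then show ?thesis using q by (simp add: aut_def)
qed
lemma aut_f_inv: "aut f \<Longrightarrow> f (inv f x) = x" by (rule permutes_inverses(1)[OF aut_permutes])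
lemma aut_inv_f: "aut f \<Longrightarrow> inv f (f x) = x" by (rule permutes_inverses(2)[OF aut_permutes])
lemma aut_inj: "aut f \<Longrightarrow> f x = f y \<longleftrightarrow> x = y" by (metis aut_inv_f)

text \<open>Automorphisms fix everything outside \<open>V\<close>, so identities between mirrors can
  be stated as equalities of functions.\<close>

lemma aut_eqI: assumes "aut f" "aut g" "\<And>v. v \<in> V \<Longrightarrow> f v = g v" shows "f = g"
proof
  fix x show "f x = g x"
    using assms by (cases "x \<in> V") (auto simp: aut_def permutes_def)
qed

lemma r_aut: assumes "X \<in> P" shows "aut (r X)"
proof -
  have "D (r X u) (r X v) = 1 \<longleftrightarrow> D u v = 1" if "u \<in> V" "v \<in> V" for u v
    using r_edge[OF assms that] r_edge[OF assms, of "r X u" "r X v"] that assms r_r by auto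
  then show ?thesis using r_permutes[OF assms] by (simp add: aut_def)
qed

text \<open>Only pairs at distance one are preserved by definition, but every distance is realised
  by a path of such pairs. The inverse automorphism then gives equality.\<close>

lemma aut_D_le: assumes "aut f" "u \<in> V" "v \<in> V" shows "D (f u) (f v) \<le> D u v"
  using assms(3)
proof (induction "D u v" arbitrary: v rule: less_induct)
  case less
  show ?case
  proof (cases "u = v")
    case False
    from stepE[OF assms(2) less.prems(1) this] obtain z Z where z: "z \<in> V" "S z v = {Z}" "D u v = D u z + 1" by metis
    have "D (f u) (f z) \<le> D u z" using less.hyps[of z] z by simp
    moreover have "D (f z) (f v) = 1" using aut_adj[OF assms(1) z(1) less.prems] z(2) by simp
    ultimately show ?thesis using D_tri[of "f u" "f v" "f z"] z(3) by linarith
  qed simp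
qed

lemma aut_D: assumes "aut f" "u \<in> V" "v \<in> V" shows "D (f u) (f v) = D u v"
proof (rule antisym)
  show "D (f u) (f v) \<le> D u v" using aut_D_le[OF assms] .
  have "D (inv f (f u)) (inv f (f v)) \<le> D (f u) (f v)"
    by (rule aut_D_le) (use assms aut_inv in auto)
  then show "D u v \<le> D (f u) (f v)" using aut_inv_f[OF assms(1)] by simp
qed

text \<open>The distance decides whether two edges lie in the same class, so automorphisms permute the classes.\<close>

lemma same_class: assumes "S a b = {X}" "D c d = 1"
  shows "S c d = {X} \<longleftrightarrow> (D c a < D c b) \<noteq> (D d a < D d b)"
proof -
  have XP: "X \<in> P" using assms S_singleton_P by blast
  have cl: "D w a < D w b \<longleftrightarrow> X \<in> S b w" for w
    using edge_D[OF assms(1), of w] by (auto simp: D_sym[of w])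
  obtain Y where Y: "S c d = {Y}" using adj_class[OF assms(2)] by blast
  have "X \<in> S c d \<longleftrightarrow> (X \<in> S b c) \<noteq> (X \<in> S b d)" using XP by (auto simp: sep_def)
  then show ?thesis unfolding cl using Y by auto
qed

lemma aut_class: assumes "aut f" "a \<in> V" "b \<in> V" "c \<in> V" "d \<in> V" "S a b = {X}" "S c d = {X}"
  shows "S (f c) (f d) = S (f a) (f b)"
proof -
  have "D (f a) (f b) = 1" using aut_adj[OF assms(1-3)] assms(6) by simp
  then obtain Y where Y: "S (f a) (f b) = {Y}" using adj_class by blast
  have cd: "D c d = 1" using assms(7) by simp
  have "D (f c) (f d) = 1" using aut_adj[OF assms(1,4,5)] cd by simp
  from same_class[OF Y this] aut_D[OF assms(1)] assms same_class[OF assms(6) cd]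
  have "S (f c) (f d) = {Y}" by simp
  then show ?thesis using Y by simp
qed

text \<open>Reversing all edges of a class, possibly by another automorphism than \<open>r X\<close>:
  uniqueness comes only later.\<close>

definition reverses :: "('a \<Rightarrow> 'a) \<Rightarrow> 'c \<Rightarrow> bool" where
  "reverses t X \<longleftrightarrow> (\<forall>c\<in>V. \<forall>d\<in>V. S c d = {X} \<longrightarrow> t c = d)"

lemma r_reverses: "reverses (r X) X" by (simp add: reverses_def r_swap)

lemma reverses_conj:
  assumes "aut g" "aut t" "reverses t X" "a \<in> V" "b \<in> V" "S a b = {X}" "S (g a) (g b) = {Z}"
  shows "reverses (g \<circ> t \<circ> inv g) Z"
  unfolding reverses_def
proof (intro ballI impI)
  fix c d assume cd: "c \<in> V" "d \<in> V" "S c d = {Z}"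
  have i: "aut (inv g)" using aut_inv assms by blast
  have "S (inv g c) (inv g d) = S (inv g (g a)) (inv g (g b))"
    by (rule aut_class[OF i _ _ _ _ assms(7) cd(3)]) (use assms cd in auto)
  then have "S (inv g c) (inv g d) = {X}" using aut_inv_f assms by simp
  then have "t (inv g c) = inv g d" using assms(3) cd i by (simp add: reverses_def)
  then show "(g \<circ> t \<circ> inv g) c = d" using aut_f_inv[OF assms(1)] by simp
qed

section \<open>Dihedral cycles and uniqueness of mirrors\<close>

primrec dih :: "nat \<Rightarrow> ('a \<Rightarrow> 'a) \<Rightarrow> ('a \<Rightarrow> 'a) \<Rightarrow> 'a \<Rightarrow> 'a" where
  "dih 0 f g = id"
| "dih (Suc n) f g = f \<circ> dih n g f"

text \<open>The defining recursion on the left reflects the whole alternating path; this one on the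
  right prolongs the path by an edge. The interplay of the two readings drives the analysis of the
  cycle.\<close>

lemma dih_Suc_right: "dih (Suc n) f g = dih n f g \<circ> (if even n then f else g)"
proof (induction n arbitrary: f g)
  case 0 show ?case by simp
next
  case (Suc n)
  have "dih (Suc (Suc n)) f g = f \<circ> dih (Suc n) g f" by (rule dih.simps(2))
  also have "\<dots> = (f \<circ> dih n g f) \<circ> (if even n then g else f)"
    unfolding Suc.IH[of g f] by (rule comp_assoc[symmetric])
  also have "\<dots> = dih (Suc n) f g \<circ> (if even (Suc n) then f else g)" by simp
  finally show ?case .
qed

lemma dih_aut: "aut f \<Longrightarrow> aut g \<Longrightarrow> aut (dih n f g)"
  by (induction n arbitrary: f g) (auto simp: aut_id aut_comp)

context
  fixes u X Y
  assumes u: "u \<in> V" and X: "X \<in> P" "S u (r X u) = {X}" and Y: "Y \<in> P" "S u (r Y u) = {Y}"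
begin

lemma dih_in: "dih n (r X) (r Y) u \<in> V"
  using dih_aut[OF r_aut[OF X(1)] r_aut[OF Y(1)]] u by simp

lemma dih_edge: "D (dih n (r X) (r Y) u) (dih (Suc n) (r X) (r Y) u) = 1"
proof -
  let ?g = "dih n (r X) (r Y)" and ?x = "if even n then r X else r Y"
  have "D (?g u) (?g (?x u)) = D u (?x u)"
    using aut_D[OF dih_aut[OF r_aut[OF X(1)] r_aut[OF Y(1)]] u] u X Y by simp
  moreover have "D u (?x u) = 1" using X(2) Y(2) by simp
  ultimately show ?thesis unfolding dih_Suc_right comp_apply by (simp only:)
qed

text \<open>Both alternating paths from u are geodesic for k steps, and the first one fails at the
  next step. Failure means that this step crosses X a second time. Since \<open>r X\<close>
  exchanges the ends of the crossing edge, and also maps \<open>?q k\<close> to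
  \<open>?p (Suc k)\<close>, the paths meet after k steps and close up to a cycle of length 2
  k.\<close>

lemma dih_half:
  assumes k: "k \<ge> 1" and p: "\<And>n. n \<le> k \<Longrightarrow> D u (dih n (r X) (r Y) u) = n"
    and q: "\<And>n. n \<le> k \<Longrightarrow> D u (dih n (r Y) (r X) u) = n"
    and ng: "D u (dih (Suc k) (r X) (r Y) u) \<noteq> Suc k"
    and dih_in': "\<And>n. dih n (r Y) (r X) u \<in> V"
  shows "dih k (r X) (r Y) u = dih k (r Y) (r X) u"
    "dih (Suc k) (r X) (r Y) u = dih (k - 1) (r Y) (r X) u"
    "dih (Suc k) (r Y) (r X) u = dih (k - 1) (r X) (r Y) u"
    "S (dih (k - 1) (r X) (r Y) u) (dih k (r X) (r Y) u) = {Y}"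
    "S (dih (k - 1) (r Y) (r X) u) (dih k (r Y) (r X) u) = {X}"
proof -
  let ?p = "\<lambda>n. dih n (r X) (r Y) u" and ?q = "\<lambda>n. dih n (r Y) (r X) u"
  have pS: "?p (Suc n) = r X (?q n)" and qS: "?q (Suc n) = r Y (?p n)" for n by simp_all
  obtain l where l: "k = Suc l" using k by (cases k) auto
  have D1: "D (?p 1) (?p (Suc n)) = D u (?q n)" for n
    using aut_D[OF r_aut[OF X(1)] u dih_in'[of n]] by simp
  have S1: "S u (?p 1) = {X}" using X by simp
  have n1: "X \<notin> S (?p 1) (?p k)"
    using edge_D[OF S1, of "?p k"] D1[of l] p[of k] q[of l] l by auto
  have "X \<in> S (?p 1) (?p (Suc k))"
    using edge_D[OF S1, of "?p (Suc k)"] D1[of k] q[of k] ng by auto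
  with n1 have "X \<in> S (?p k) (?p (Suc k))" using mem_sep_cases[OF X(1)] by metis
  moreover obtain Z where "S (?p k) (?p (Suc k)) = {Z}" using dih_edge[of k] adj_class by metis
  ultimately have SX: "S (?p k) (?p (Suc k)) = {X}" by auto
  from r_swap[OF dih_in dih_in this] have rp: "r X (?p k) = ?p (Suc k)" .
  then show pq: "?p k = ?q k" using pS[of k] r_r[OF X(1)] by metis
  have "?p k = r X (?q l)" using l pS by simp
  then have "r X (?p k) = ?q l" using r_r[OF X(1)] by simp
  then have psk: "?p (Suc k) = ?q l" using rp by simp
  then show "?p (Suc k) = ?q (k - 1)" using l by simp
  show "S (?q (k - 1)) (?q k) = {X}" using SX psk pq l by (simp add: sep_commute)
  have S1q: "S u (?q 1) = {Y}" using Y by simp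
  have "D (?q 1) (?q k) = D u (?p l)"
    using aut_D[OF r_aut[OF Y(1)] u dih_in[of l]] l by simp
  then have "D (?q 1) (?p k) = l" using p[of l] l pq by simp
  then have "Y \<notin> S (?q 1) (?p k)" "Y \<in> S u (?p k)"
    using edge_D[OF S1q, of "?p k"] p[of k] l by auto
  \<comment> \<open>Otherwise folding at Y would bring \<open>?q k\<close>, the mirror image of
    \<open>?p l\<close>, nearer to u than l, although it is at distance k.\<close>
  moreover have "Y \<notin> S u (?p l)"
  proof
    assume "Y \<in> S u (?p l)"
    from fold[OF Y(1) u dih_in this] have "D u (?q k) < D u (?p l)" using l by simp
    then show False using p[of l] q[of k] l by simp
  qed
  ultimately have "Y \<in> S (?p l) (?p k)" using mem_sep_cases[OF Y(1)] by metis
  moreover obtain Z where "S (?p l) (?p k) = {Z}" using dih_edge[of l] adj_class l by metis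
  ultimately have SY: "S (?p l) (?p k) = {Y}" by auto
  then show "S (?p (k - 1)) (?p k) = {Y}" using l by simp
  from r_swap[OF dih_in dih_in SY] have "r Y (?p l) = ?p k" .
  then have "r Y (?p k) = ?p l" using r_r[OF Y(1)] by metis
  then show "?q (Suc k) = ?p (k - 1)" using l by simp
qed

end

text \<open>Half the length of the cycle spanned by X and Y at u, which becomes an entry of the
  Coxeter matrix. Asking for failure of either path makes it symmetric; a failure exists because
  distances are bounded by \<open>card P\<close>.\<close>

definition cox_num :: "'a \<Rightarrow> 'c \<Rightarrow> 'c \<Rightarrow> nat" where
  "cox_num u X Y = (LEAST n. D u (dih (Suc n) (r X) (r Y) u) \<noteq> Suc n \<or> D u (dih (Suc n) (r Y) (r X) u) \<noteq> Suc n)"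

lemma cox_num_sym: "cox_num u X Y = cox_num u Y X"
  unfolding cox_num_def by (simp add: disj_commute)

lemma dihedral:
  assumes u: "u \<in> V" and X: "X \<in> P" "S u (r X u) = {X}" and Y: "Y \<in> P" "S u (r Y u) = {Y}" and XY: "X \<noteq> Y"
  defines "k \<equiv> cox_num u X Y"
  shows "k \<ge> 2" "\<And>n. n \<le> k \<Longrightarrow> D u (dih n (r X) (r Y) u) = n"
    "dih k (r X) (r Y) u = dih k (r Y) (r X) u"
    "dih (Suc k) (r X) (r Y) u = dih (k - 1) (r Y) (r X) u"
    "S (dih (k - 1) (r X) (r Y) u) (dih k (r X) (r Y) u) = {Y}"
proof -
  let ?p = "\<lambda>n. dih n (r X) (r Y) u" and ?q = "\<lambda>n. dih n (r Y) (r X) u"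
  let ?B = "\<lambda>n. D u (?p (Suc n)) \<noteq> Suc n \<or> D u (?q (Suc n)) \<noteq> Suc n"
  have "D u (?p (Suc (card P))) \<le> card P" by (rule card_mono[OF finite_P S_sub])
  then have "?B (card P)" by linarith
  then have B: "?B k" unfolding k_def cox_num_def by (rule LeastI[where P = ?B])
  have nB: "\<not> ?B n" if "n < k" for n using that not_less_Least unfolding k_def cox_num_def by blast
  show p: "D u (?p n) = n" if "n \<le> k" for n using nB[of "n - 1"] that by (cases n) auto
  have q: "D u (?q n) = n" if "n \<le> k" for n using nB[of "n - 1"] that by (cases n) auto
  \<comment> \<open>Both paths are geodesic for one and for two steps, so the least failing index is
    at least 2.\<close>
  have "D u (r X (r Y u)) = 2"
  proof -
    have "D (r X u) (r X (r X (r Y u))) = D u (r X (r Y u))"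
      using aut_D[OF r_aut[OF X(1)] u] u X Y by simp
    then have "D u (r X (r Y u)) = D (r X u) (r Y u)" using r_r X by simp
    also have "S (r X u) (r Y u) = {X, Y}"
    proof -
      have "S (r X u) u = {X}" using X(2) by (simp add: sep_commute)
      then show ?thesis using edge_D[of "r X u" u X "r Y u"] X Y XY by auto
    qed
    finally show ?thesis using XY by simp
  qed
  moreover have "D u (r Y (r X u)) = 2"
  proof -
    have "D (r Y u) (r Y (r Y (r X u))) = D u (r Y (r X u))"
      using aut_D[OF r_aut[OF Y(1)] u] u X Y by simp
    then have "D u (r Y (r X u)) = D (r Y u) (r X u)" using r_r Y by simp
    also have "S (r Y u) (r X u) = {X, Y}"
    proof -
      have "S (r Y u) u = {Y}" using Y(2) by (simp add: sep_commute)
      then show ?thesis using edge_D[of "r Y u" u Y "r X u"] X Y XY by auto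
    qed
    finally show ?thesis using XY by simp
  qed
  moreover have "D u (r X u) = 1" "D u (r Y u) = 1" using X Y by simp_all
  ultimately have "\<not> ?B 0" "\<not> ?B 1" by simp_all
  then show k2: "k \<ge> 2" using B by (metis One_nat_def less_2_cases not_le)
  then have k1: "1 \<le> k" by simp
  note inX = dih_in[OF u X Y] and inY = dih_in[OF u Y X]
  consider "D u (?p (Suc k)) \<noteq> Suc k" | "D u (?q (Suc k)) \<noteq> Suc k" using B by blast
  then have "?p k = ?q k \<and> ?p (Suc k) = ?q (k - 1) \<and> S (?p (k - 1)) (?p k) = {Y}"
  proof cases
    case 1
    from dih_half[OF u X Y k1 p q 1 inY] show ?thesis by simp
  next
    case 2
    from dih_half[OF u Y X k1 q p 2 inX] show ?thesis by simp
  qed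
  then show "?p k = ?q k" "?p (Suc k) = ?q (k - 1)" "S (?p (k - 1)) (?p k) = {Y}" by blast+
qed

definition cyc :: "'a \<Rightarrow> 'c \<Rightarrow> 'c \<Rightarrow> 'a set" where
  "cyc u X Y = (\<lambda>n. dih n (r X) (r Y) u) ` {..cox_num u X Y} \<union> (\<lambda>n. dih n (r Y) (r X) u) ` {..cox_num u X Y}"

lemma cyc_sym: "cyc u X Y = cyc u Y X" by (auto simp: cyc_def cox_num_sym)

context
  fixes u X Y
  assumes u: "u \<in> V" and X: "X \<in> P" "S u (r X u) = {X}" and Y: "Y \<in> P" "S u (r Y u) = {Y}" and XY: "X \<noteq> Y"
begin

lemma cyc_sub: "cyc u X Y \<subseteq> V"
  using dih_in[OF u X Y] dih_in[OF u Y X] by (auto simp: cyc_def)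

text \<open>The mirror trades a vertex of one path for a vertex of the other with the index shifted
  by one. Only at the far end of the second path is an argument needed: there the closing of the
  cycle is used.\<close>

lemma cyc_r: "r X ` cyc u X Y \<subseteq> cyc u X Y"
proof -
  let ?k = "cox_num u X Y"
  let ?p = "\<lambda>n. dih n (r X) (r Y) u" and ?q = "\<lambda>n. dih n (r Y) (r X) u"
  note d = dihedral[OF u X Y XY]
  have 1: "r X (?p n) \<in> cyc u X Y" if "n \<le> ?k" for n
  proof (cases n)
    case 0 
    have "r X (?p n) = ?p 1" using 0 by simp
    then show ?thesis using d(1) by (auto simp: cyc_def intro!: image_eqI[where x=1])
  next
    case (Suc l)
    then have "r X (?p n) = ?q l" using r_r[OF X(1)] by simp
    then show ?thesis using Suc that by (auto simp: cyc_def)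
  qed
  have 2: "r X (?q n) \<in> cyc u X Y" if "n \<le> ?k" for n
  proof (cases "n = ?k")
    case True
    then have "r X (?q n) = ?q (?k - 1)" using d(4) by simp
    then show ?thesis by (auto simp: cyc_def)
  next
    case False
    then have "Suc n \<le> ?k" "r X (?q n) = ?p (Suc n)" using that by simp_all
    then show ?thesis unfolding cyc_def by blast
  qed
  show ?thesis using 1 2 by (subst (1) cyc_def) auto
qed

end

lemma perm_sub_inv: assumes "aut f" "C \<subseteq> V" "f ` C \<subseteq> C" shows "inv f ` C \<subseteq> C"
proof -
  have "finite C" using assms(2) finite_V finite_subset by blast
  moreover have "inj_on f C" using aut_inj[OF assms(1)] by (auto simp: inj_on_def)
  ultimately have "f ` C = C" using endo_inj_surj[of C f] assms(3) by blast
  then have "inv f ` C = (inv f \<circ> f) ` C" by (metis image_comp)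
  then show ?thesis using aut_inv_f[OF assms(1)] by simp
qed

lemma dih_image: assumes "f ` C \<subseteq> C" "g ` C \<subseteq> C" shows "dih n f g ` C \<subseteq> C"
  using assms
proof (induction n arbitrary: f g)
  case (Suc n)
  have "dih n g f ` C \<subseteq> C" using Suc by blast
  then show ?case using Suc.prems by auto
qed simp

context
  fixes u X Y
  assumes u: "u \<in> V" and X: "X \<in> P" "S u (r X u) = {X}" and Y: "Y \<in> P" "S u (r Y u) = {Y}" and XY: "X \<noteq> Y"
begin

lemma dih_path_sep: assumes "Z \<in> S u (dih n (r X) (r Y) u)"
  shows "\<exists>j<n. S (dih j (r X) (r Y) u) (dih (Suc j) (r X) (r Y) u) = {Z}"
  using assms
proof (induction n)
  case (Suc n)
  let ?p = "\<lambda>n. dih n (r X) (r Y) u"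
  have "Z \<in> S u (?p n) \<or> Z \<in> S (?p n) (?p (Suc n))" using Suc.prems S_tri by blast
  then show ?case
  proof
    assume "Z \<in> S u (?p n)" then show ?thesis using Suc.IH less_SucI by blast
  next
    assume "Z \<in> S (?p n) (?p (Suc n))"
    moreover obtain W where "S (?p n) (?p (Suc n)) = {W}" using dih_edge[OF u X Y, of n] adj_class by metis
    ultimately show ?thesis by auto
  qed
qed simp

lemma cyc_reflect_aux:
  assumes "Z \<in> S u (dih n (r X) (r Y) u)"
  shows "\<exists>t. aut t \<and> t ` cyc u X Y \<subseteq> cyc u X Y \<and> reverses t Z"
proof -
  obtain j where j: "S (dih j (r X) (r Y) u) (dih (Suc j) (r X) (r Y) u) = {Z}"
    using dih_path_sep[OF assms] by blast
  let ?g = "dih j (r X) (r Y)" and ?W = "if even j then X else Y"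
  have W: "?W \<in> P" "S u (r ?W u) = {?W}" using X Y by auto
  have eq: "dih (Suc j) (r X) (r Y) u = ?g (r ?W u)" unfolding dih_Suc_right by simp
  have ag: "aut ?g" using dih_aut[OF r_aut[OF X(1)] r_aut[OF Y(1)]] .
  let ?t = "?g \<circ> r ?W \<circ> inv ?g"
  have "reverses ?t Z"
    by (rule reverses_conj[OF ag r_aut[OF W(1)] r_reverses u _ W(2)]) (use j eq W u in auto)
  moreover have "aut ?t" by (intro aut_comp aut_inv ag r_aut W)
  moreover have "?t ` cyc u X Y \<subseteq> cyc u X Y"
  proof -
    let ?C = "cyc u X Y"
    have rX: "r X ` ?C \<subseteq> ?C" using cyc_r[OF u X Y XY] .
    have rY: "r Y ` ?C \<subseteq> ?C" using cyc_r[OF u Y X XY[symmetric]] by (simp add: cyc_sym)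
    have 1: "?g ` ?C \<subseteq> ?C" using dih_image[OF rX rY] .
    have 2: "inv ?g ` ?C \<subseteq> ?C" using perm_sub_inv[OF ag cyc_sub[OF u X Y XY] 1] .
    have 3: "r ?W ` ?C \<subseteq> ?C" using rX rY by auto
    show ?thesis using 1 2 3 by (auto simp: image_subset_iff)
  qed
  ultimately show ?thesis by blast
qed

end

context
  fixes u X Y
  assumes u: "u \<in> V" and X: "X \<in> P" "S u (r X u) = {X}" and Y: "Y \<in> P" "S u (r Y u) = {Y}" and XY: "X \<noteq> Y"
begin

lemma cyc_reflect:
  assumes "a \<in> cyc u X Y" "b \<in> cyc u X Y" "Z \<in> S a b"
  shows "\<exists>t. aut t \<and> t ` cyc u X Y \<subseteq> cyc u X Y \<and> reverses t Z"
proof -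
  have 1: "?thesis" if "c \<in> cyc u X Y" "Z \<in> S u c" for c
  proof -
    from that(1) obtain n where "c = dih n (r X) (r Y) u \<or> c = dih n (r Y) (r X) u"
      unfolding cyc_def by blast
    then show ?thesis
      using that(2) cyc_reflect_aux[OF u X Y XY, of Z n]
        cyc_reflect_aux[OF u Y X XY[symmetric], of Z n, unfolded cyc_sym[of u Y X]] by blast
  qed
  have "Z \<in> S u a \<or> Z \<in> S u b" using assms(3) S_tri[of a b u] by (auto simp: sep_commute)
  then show ?thesis using 1 assms by blast
qed

text \<open>The cycle is convex enough: only two edges at \<open>u\<close> lead towards its antipode.\<close>

lemma cyc_interval:
  assumes z: "z \<in> V" "S u z = {Z}" "Z \<in> S u (dih (cox_num u X Y) (r X) (r Y) u)"
  shows "z = r X u \<or> z = r Y u"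
proof -
  let ?k = "cox_num u X Y"
  let ?p = "\<lambda>n. dih n (r X) (r Y) u" and ?q = "\<lambda>n. dih n (r Y) (r X) u"
  obtain t where t: "aut t" "t ` cyc u X Y \<subseteq> cyc u X Y" "reverses t Z" using cyc_reflect_aux[OF u X Y XY z(3)] by blast
  have "u \<in> cyc u X Y" unfolding cyc_def by (rule UnI1, rule image_eqI[where x=0]) auto
  moreover have "t u = z" using t(3) z u by (simp add: reverses_def)
  ultimately have "z \<in> cyc u X Y" using t by auto
  then obtain n where n: "n \<le> ?k" "z = ?p n \<or> z = ?q n" by (auto simp: cyc_def)
  have "D u z = n" using dihedral(2)[OF u X Y XY n(1)] dihedral(2)[OF u Y X XY[symmetric], of n] n cox_num_sym[of u X Y] by auto
  then have "n = 1" using z by simp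
  then show ?thesis using n by simp
qed

text \<open>The antipode of u on the cycle is an end of an X-edge and therefore fixed. So
  \<open>f\<close> sends \<open>r Y u\<close> to a neighbour of u leading towards the antipode. By
  \<open>cyc_interval\<close> there are only two of these, and the other one, \<open>r X u\<close>,
  is already fixed.\<close>

lemma fix_edges_fix_nbr:
  assumes f: "aut f" and fix_X: "\<And>c d. c \<in> V \<Longrightarrow> d \<in> V \<Longrightarrow> S c d = {X} \<Longrightarrow> f c = c"
  shows "f (r Y u) = r Y u"
proof -
  let ?k = "cox_num u X Y"
  let ?p = "\<lambda>n. dih n (r X) (r Y) u" and ?q = "\<lambda>n. dih n (r Y) (r X) u"
  let ?w = "r Y u"
  have k: "?k \<ge> 2" using dihedral[OF u X Y XY] by simp
  have inV: "?p n \<in> V" "?q n \<in> V" for n using dih_in[OF u X Y] dih_in[OF u Y X] by auto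
  have "S (?q (?k - 1)) (?q ?k) = {X}"
    using dihedral(5)[OF u Y X XY[symmetric]] cox_num_sym[of u X Y] by simp
  then have fq: "f (?q ?k) = ?q ?k" using fix_X[of "?q ?k" "?q (?k-1)"] inV by (simp add: sep_commute)
  have pq: "?p ?k = ?q ?k" using dihedral(3)[OF u X Y XY] .
  have fu: "f u = u" and fv: "f (r X u) = r X u" using fix_X[of u "r X u"] fix_X[of "r X u" u] X u by (auto simp: sep_commute)
  have wV: "?w \<in> V" using Y u by simp
  obtain l where l: "?k = Suc l" using k by (cases ?k) auto
  have "D ?w (?q ?k) = D u (?p l)" using aut_D[OF r_aut[OF Y(1)] u inV(1)[of l]] l by simp
  then have Dw: "D ?w (?q ?k) = l" using dihedral(2)[OF u X Y XY, of l] l by simp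
  have "D (f ?w) (f (?q ?k)) = l" using aut_D[OF f wV inV(2)] Dw by simp
  then have Dfw: "D (f ?w) (?q ?k) = l" using fq by simp
  have "D (f u) (f ?w) = 1" using aut_D[OF f u wV] Y by simp
  then obtain Z where Z: "S u (f ?w) = {Z}" using adj_class fu by metis
  have "D u (?q ?k) = Suc l" using dihedral(2)[OF u X Y XY, of ?k] l pq by simp
  with edge_D[OF Z, of "?q ?k"] Dfw have "Z \<in> S u (?q ?k)" by auto
  then have "f ?w = r X u \<or> f ?w = ?w" using cyc_interval[OF _ Z] wV f pq by simp
  moreover have "f ?w \<noteq> r X u"
  proof
    assume "f ?w = r X u"
    then have "f ?w = f (r X u)" using fv by simp
    then have "?w = r X u" using aut_inj[OF f] by simp
    then have "{X} = {Y}" using X Y by simp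
    then show False using XY by simp
  qed
  ultimately show ?thesis by blast
qed

end

section \<open>Rigidity of automorphisms and uniqueness of mirrors\<close>

lemma edge_r: assumes "u \<in> V" "v \<in> V" "S u v = {X}" shows "X \<in> P" "S u (r X u) = {X}" "v = r X u" "S v (r X v) = {X}"
proof -
  show "X \<in> P" "v = r X u" using assms S_singleton_P r_swap by auto
  then show "S u (r X u) = {X}" "S v (r X v) = {X}" using assms r_r by (auto simp: sep_commute)
qed

lemma fix_edges_fix_nbrs:
  assumes f: "aut f" and fix_X: "\<And>c d. c \<in> V \<Longrightarrow> d \<in> V \<Longrightarrow> S c d = {X} \<Longrightarrow> f c = c"
    and uv: "u \<in> V" "v \<in> V" "S u v = {X}" and w: "w \<in> V" "D u w = 1"
  shows "f w = w"
proof -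
  obtain Y where Y: "S u w = {Y}" using adj_class w by metis
  note eX = edge_r[OF uv] and eY = edge_r[OF uv(1) w(1) Y]
  show ?thesis
  proof (cases "X = Y")
    case True
    then have "w = v" using eX eY by simp
    then show ?thesis using fix_X[of v u] uv by (simp add: sep_commute)
  next
    case False
    then show ?thesis using fix_edges_fix_nbr[OF uv(1) eX(1,2) eY(1,2) False f fix_X] eY by simp
  qed
qed

text \<open>The property of fixing a vertex with all its neighbours is passed along an edge from z
  to v. What is missing is control over the neighbours of v; these are the images under
  \<open>r Y\<close> of neighbours of z, so it suffices that \<open>f\<close> commutes with
  \<open>r Y\<close> there.\<close>

lemma rigid:
  assumes f: "aut f" and u: "u \<in> V" "f u = u" and nb: "\<And>w. w \<in> V \<Longrightarrow> D u w = 1 \<Longrightarrow> f w = w"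
  shows "f = id"
proof -
  have "f v = v \<and> (\<forall>w\<in>V. D v w = 1 \<longrightarrow> f w = w)" if "v \<in> V" for v
    using that
  proof (induction "D u v" arbitrary: v rule: less_induct)
    case less
    show ?case
    proof (cases "u = v")
      case True then show ?thesis using u nb by auto
    next
      case False
      from stepE[OF u(1) less.prems this] obtain z Y where z: "z \<in> V" "S z v = {Y}" "D u v = D u z + 1" by metis
      have IH: "f z = z" "\<And>w. w \<in> V \<Longrightarrow> D z w = 1 \<Longrightarrow> f w = w" using less.hyps[of z] z by auto
      have fv: "f v = v" using IH(2)[of v] z less.prems by simp
      note e = edge_r[OF z(1) less.prems z(2)]
      have af: "aut (inv f)" using aut_inv f by blast
      have fz': "inv f z = z" "inv f v = v" using IH(1) fv aut_inv_f[OF f] by metis+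
      \<comment> \<open>The commutator of \<open>r Y\<close> and \<open>f\<close>. Both
        \<open>r Y\<close> and its conjugate reverse the class Y, so the commutator fixes all
        Y-edges pointwise and hence all neighbours of z.\<close>
      let ?e = "r Y \<circ> (f \<circ> r Y \<circ> inv f)"
      have rev: "reverses (f \<circ> r Y \<circ> inv f) Y"
        by (rule reverses_conj[OF f r_aut[OF e(1)] r_reverses z(1) less.prems z(2)]) (use IH fv z in simp)
      have ae: "aut ?e" by (intro aut_comp r_aut f af e)
      have fe: "?e c = c" if "c \<in> V" "d \<in> V" "S c d = {Y}" for c d
      proof -
        have "(f \<circ> r Y \<circ> inv f) c = d" using rev that by (simp add: reverses_def)
        moreover have "r Y d = c" using r_swap[of d c Y] that by (simp add: sep_commute)
        ultimately show ?thesis by simp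
      qed
      have "f w = w" if w: "w \<in> V" "D v w = 1" for w
      proof -
        let ?x = "r Y w"
        have x: "?x \<in> V" using w e by simp
        have "D (r Y v) (r Y w) = 1" using aut_D[OF r_aut[OF e(1)] less.prems w(1)] w by simp
        moreover have "r Y v = z" using e(1,3) r_r by simp
        ultimately have Dx: "D z ?x = 1" by simp
        have fx: "f ?x = ?x" using IH(2)[OF x Dx] .
        then have "inv f ?x = ?x" using aut_inv_f[OF f] by metis
        moreover have "?e ?x = ?x" using fix_edges_fix_nbrs[OF ae fe z(1) less.prems z(2) x Dx] .
        ultimately have "r Y (f w) = ?x" using r_r[OF e(1)] by simp
        then show ?thesis using r_r[OF e(1)] by metis
      qed
      then show ?thesis using fv by blast
    qed
  qed
  then show ?thesis using aut_eqI[OF f aut_id] by simp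
qed

text \<open>The composite of the two reversing maps fixes every edge of X pointwise, hence all
  neighbours of u, hence everything.\<close>

lemma reverses_unique:
  assumes t: "aut t" "reverses t X" and uv: "u \<in> V" "v \<in> V" "S u v = {X}"
  shows "t = r X"
proof -
  note e = edge_r[OF uv]
  let ?f = "r X \<circ> t"
  have a: "aut ?f" by (intro aut_comp r_aut t e)
  have fx: "?f c = c" if "c \<in> V" "d \<in> V" "S c d = {X}" for c d
    using that t(2) r_swap[of d c X] by (simp add: reverses_def sep_commute)
  have "?f = id"
    by (rule rigid[OF a uv(1) fx[OF uv]]) (rule fix_edges_fix_nbrs[OF a fx uv])
  then have "r X (t x) = x" for x by (metis comp_apply id_apply)
  then show ?thesis using r_r[OF e(1)] by (metis ext)
qed

lemma conj_r:
  assumes g: "aut g" and uv: "u \<in> V" "v \<in> V" "S u v = {X}" "S (g u) (g v) = {Z}"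
  shows "g \<circ> r X \<circ> inv g = r Z"
proof (rule reverses_unique)
  note e = edge_r[OF uv(1-3)]
  show "aut (g \<circ> r X \<circ> inv g)" by (intro aut_comp r_aut aut_inv g e)
  show "reverses (g \<circ> r X \<circ> inv g) Z" by (rule reverses_conj[OF g r_aut[OF e(1)] r_reverses uv])
  show "g u \<in> V" "g v \<in> V" using uv g by auto
qed (fact uv(4))

end

section \<open>Gates of dihedral cycles\<close>

context mirror_system
begin

lemma class_edge: assumes "u \<in> V" "v \<in> V" "Z \<in> S u v" shows "\<exists>a\<in>V. \<exists>b\<in>V. S a b = {Z}"
  using assms(2,3)
proof (induction "D u v" arbitrary: v rule: less_induct)
  case less
  have "u \<noteq> v" using less.prems by auto
  from stepE[OF assms(1) less.prems(1) this] obtain z X where z: "z \<in> V" "S z v = {X}" "D u v = D u z + 1"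
    "S u v = insert X (S u z)" by metis
  show ?case
  proof (cases "Z = X")
    case True then show ?thesis using z less.prems by blast
  next
    case False then show ?thesis using less.hyps[of z] z less.prems by auto
  qed
qed

text \<open>Let y be a cycle vertex nearest to v. A class separating y both from v and from another
  cycle vertex has a mirror that keeps the cycle, by \<open>cyc_reflect\<close> together with
  uniqueness, so folding y would give a nearer cycle vertex. Hence distances from v into the cycle
  add up through y. As both cycle neighbours of u are nearer to v than u is, y must be the antipode
  of u.\<close>

lemma cyc_gate:
  assumes u: "u \<in> V" and X: "X \<in> P" "S u (r X u) = {X}" and Y: "Y \<in> P" "S u (r Y u) = {Y}" and XY: "X \<noteq> Y"
    and v: "v \<in> V" "D v (r X u) + 1 = D v u" "D v (r Y u) + 1 = D v u"
  shows "D v u = D v (dih (cox_num u X Y) (r X) (r Y) u) + cox_num u X Y"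
proof -
  let ?k = "cox_num u X Y" and ?C = "cyc u X Y"
  let ?p = "\<lambda>n. dih n (r X) (r Y) u" and ?q = "\<lambda>n. dih n (r Y) (r X) u"
  note dX = dihedral[OF u X Y XY] and dY = dihedral[OF u Y X XY[symmetric], folded cox_num_sym[of u X Y]]
  have CV: "?C \<subseteq> V" using cyc_sub[OF u X Y XY] .
  have uC: "u \<in> ?C" unfolding cyc_def by (rule UnI1, rule image_eqI[where x=0]) auto
  have "r X ` ?C \<subseteq> ?C" "r Y ` ?C \<subseteq> ?C"
    using cyc_r[OF u X Y XY] cyc_r[OF u Y X XY[symmetric]] by (simp_all add: cyc_sym)
  then have rC: "r X u \<in> ?C" "r Y u \<in> ?C" using uC by auto
  have "finite ?C" using CV finite_V finite_subset by blast
  then obtain y where y: "y \<in> ?C" "\<And>z. z \<in> ?C \<Longrightarrow> D v y \<le> D v z"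
    using ex_min_if_finite[of "D v ` ?C"] uC by (metis (no_types, lifting) arg_min_if_finite(1) arg_min_least empty_iff)
  have yV: "y \<in> V" using y CV by auto
  have sum: "D v z = D v y + D y z" if zC: "z \<in> ?C" for z
  proof (rule D_disjoint, rule ccontr)
    assume "S v y \<inter> S y z \<noteq> {}"
    then obtain Z where Z: "Z \<in> S v y" "Z \<in> S y z" by blast
    then have ZP: "Z \<in> P" using S_sub by blast
    obtain t where t: "aut t" "t ` ?C \<subseteq> ?C" "reverses t Z"
      using cyc_reflect[OF u X Y XY y(1) zC Z(2)] by blast
    obtain a b where "a \<in> V" "b \<in> V" "S a b = {Z}" using class_edge[OF v(1) yV Z(1)] by blast
    from reverses_unique[OF t(1,3) this] have "r Z y \<in> ?C" using t y by auto
    then show False using fold[OF ZP v(1) yV Z(1)] y(2) by fastforce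
  qed
  have yu: "D v u = D v y + D y u" and yX: "D y (r X u) + 1 = D y u" and yY: "D y (r Y u) + 1 = D y u"
    using sum[OF uC] sum[OF rC(1)] sum[OF rC(2)] v by auto
  obtain n where n: "n \<le> ?k" "y = ?p n \<or> y = ?q n" using y(1) by (auto simp: cyc_def)
  have Dn: "D y u = n" using dX(2)[OF n(1)] dY(2)[OF n(1)] n(2) D_sym by metis
  \<comment> \<open>Before the antipode, one of the two cycle neighbours of u would be at distance n
    + 1 from y, since a mirror turns that distance into the length of the other geodesic
    path.\<close>
  have "n = ?k"
  proof (rule ccontr)
    assume "n \<noteq> ?k"
    then have n': "Suc n \<le> ?k" using n by simp
    from n(2) show False
    proof
      assume p: "y = ?p n"
      have "D (r Y y) (r Y (r Y u)) = D y (r Y u)" using aut_D[OF r_aut[OF Y(1)] yV] Y u by simp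
      then have "D (?q (Suc n)) u = D y (r Y u)" using r_r[OF Y(1)] p by simp
      then show False using dY(2)[OF n'] yY Dn D_sym[of u "?q (Suc n)"] by linarith
    next
      assume q: "y = ?q n"
      have "D (r X y) (r X (r X u)) = D y (r X u)" using aut_D[OF r_aut[OF X(1)] yV] X u by simp
      then have "D (?p (Suc n)) u = D y (r X u)" using r_r[OF X(1)] q by simp
      then show False using dX(2)[OF n'] yX Dn D_sym[of u "?p (Suc n)"] by linarith
    qed
  qed
  then have "y = ?p ?k" using n(2) dX(3) by auto
  then show ?thesis using yu Dn \<open>n = ?k\<close> by simp
qed

end

section \<open>The Coxeter group of a mirror system\<close>

locale pointed_mirror_system = mirror_system V P side r
  for V :: "'a set" and P :: "'c set" and side :: "'c \<Rightarrow> 'a \<Rightarrow> bool" and r :: "'c \<Rightarrow> 'a \<Rightarrow> 'a" +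
  fixes u0 :: 'a and m :: nat and nb :: "nat \<Rightarrow> 'a"
  assumes u0: "u0 \<in> V" and nb: "bij_betw nb {..<m} {v \<in> V. card (sep P side u0 v) = 1}"
begin

definition c :: "nat \<Rightarrow> 'c" where "c i = (THE X. S u0 (nb i) = {X})"

abbreviation s :: "nat \<Rightarrow> 'a \<Rightarrow> 'a" where "s i \<equiv> r (c i)"

lemma nb_V: "i < m \<Longrightarrow> nb i \<in> V" and nb_D: "i < m \<Longrightarrow> D u0 (nb i) = 1"
  using bij_betwE[OF nb] by auto

lemma nb_S: assumes "i < m" shows "S u0 (nb i) = {c i}"
proof -
  obtain X where "S u0 (nb i) = {X}" using adj_class[OF nb_D[OF assms]] by blast
  then show ?thesis unfolding c_def by simp
qed

lemma c_P: "i < m \<Longrightarrow> c i \<in> P" using nb_S S_singleton_P by blast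
lemma s_u0: "i < m \<Longrightarrow> s i u0 = nb i" using nb_S u0 nb_V r_swap by blast
lemma S_s: "i < m \<Longrightarrow> S u0 (s i u0) = {c i}" using nb_S s_u0 by simp
lemma s_s: "i < m \<Longrightarrow> s i (s i x) = x" using r_r c_P by blast
lemma s_aut: "i < m \<Longrightarrow> aut (s i)" using r_aut c_P by blast

lemma c_inj: assumes "i < m" "j < m" "c i = c j" shows "i = j"
proof -
  have "nb i = nb j" using s_u0 assms by metis
  then show ?thesis using nb assms by (auto simp: bij_betw_def inj_on_def)
qed

text \<open>Words act from the right: \<open>i # w\<close> and \<open>w\<close> are adjacent in the Cayley graph, and \<open>rho (i # w) u0\<close> is the
  image under \<open>rho w\<close> of the neighbour \<open>nb i\<close> of \<open>u0\<close>.\<close>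

primrec rho :: "nat list \<Rightarrow> 'a \<Rightarrow> 'a" where
  "rho [] = id"
| "rho (i # w) = rho w \<circ> s i"

abbreviation W :: "nat list set" where "W \<equiv> lists {..<m}"
abbreviation phi :: "nat list \<Rightarrow> 'a" where "phi w \<equiv> rho w u0"

lemma rho_append: "rho (a @ b) = rho b \<circ> rho a"
  by (induction a) (auto simp: comp_assoc)

lemma rho_aut: "w \<in> W \<Longrightarrow> aut (rho w)"
  by (induction w) (auto simp: aut_id aut_comp s_aut)

lemma rho_rev_left: "w \<in> W \<Longrightarrow> rho (rev w) (rho w x) = x"
  by (induction w arbitrary: x) (auto simp: rho_append s_s)

lemma rho_rev_right: "w \<in> W \<Longrightarrow> rho w (rho (rev w) x) = x"
  using rho_rev_left[of "rev w"] by simp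

lemma phi_V: "w \<in> W \<Longrightarrow> phi w \<in> V" using rho_aut u0 by simp

lemma phi_edge: assumes "w \<in> W" "i < m" shows "D (phi w) (phi (i # w)) = 1"
  using aut_D[OF rho_aut[OF assms(1)] u0, of "nb i"] nb_V nb_D s_u0 assms by simp

lemma phi_path: assumes "w \<in> W" "Z \<in> S u0 (phi w)"
  shows "\<exists>b j d. w = b @ j # d \<and> S (phi d) (phi (j # d)) = {Z}"
  using assms
proof (induction w)
  case (Cons i w)
  have "Z \<in> S u0 (phi w) \<or> Z \<in> S (phi w) (phi (i # w))" using Cons.prems S_tri by blast
  then show ?case
  proof
    assume "Z \<in> S u0 (phi w)"
    then obtain b j d where "w = b @ j # d" "S (phi d) (phi (j # d)) = {Z}" using Cons by auto
    then have "i # w = (i # b) @ j # d \<and> S (phi d) (phi (j # d)) = {Z}" by simp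
    then show ?thesis by blast
  next
    assume Z: "Z \<in> S (phi w) (phi (i # w))"
    have "w \<in> W" "i < m" using Cons by auto
    from phi_edge[OF this] Z have "S (phi w) (phi (i # w)) = {Z}" by (metis card_1_singletonE singletonD)
    then show ?thesis by blast
  qed
qed simp

text \<open>Transporting the generator by \<open>rho w\<close> gives an automorphism reversing the
  class of the edge from \<open>phi w\<close> to \<open>phi (i # w)\<close>; uniqueness identifies
  it with the mirror of that class.\<close>

lemma edge_reflection:
  assumes "w \<in> W" "i < m" "S (phi w) (phi (i # w)) = {Z}" shows "rho w (s i x) = r Z (rho w x)"
proof -
  have "rho w \<circ> s i \<circ> inv (rho w) = r Z"
    by (rule conj_r[OF rho_aut[OF assms(1)] u0 nb_V[OF assms(2)] nb_S[OF assms(2)]])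
       (use assms s_u0 in auto)
  then have "(rho w \<circ> s i \<circ> inv (rho w)) (rho w x) = r Z (rho w x)" by simp
  then show ?thesis using aut_inv_f[OF rho_aut[OF assms(1)]] by simp
qed

text \<open>If the new edge does not lead away from \<open>u0\<close>, its class Z was already
  crossed at some letter j of w. Prepending i and deleting j both amount to applying the mirror
  \<open>r Z\<close>, so they give the same automorphism.\<close>

lemma exchange:
  assumes w: "w \<in> W" "D u0 (phi w) = length w" and i: "i < m" and ng: "D u0 (phi (i # w)) \<noteq> Suc (length w)"
  shows "\<exists>w'\<in>W. rho w' = rho (i # w) \<and> Suc (length w') = length w \<and> D u0 (phi (i # w)) = length w'"
proof -
  obtain Z where Z: "S (phi w) (phi (i # w)) = {Z}" using adj_class[OF phi_edge[OF w(1) i]] by blast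
  have 1: "Z \<in> S u0 (phi w)" "D u0 (phi w) = D u0 (phi (i # w)) + 1"
    using edge_D[OF Z, of u0] ng w(2) by (auto simp: D_sym sep_commute)
  obtain b j d where b: "w = b @ j # d" "S (phi d) (phi (j # d)) = {Z}" using phi_path[OF w(1) 1(1)] by blast
  have d: "d \<in> W" "j < m" "b \<in> W" using w b by auto
  have "rho (i # w) x = rho (b @ d) x" for x
  proof -
    have "rho (i # w) x = r Z (rho w x)" using edge_reflection[OF w(1) i Z] by simp
    also have "rho w x = rho d (s j (rho b x))" using b by (simp add: rho_append)
    also have "r Z \<dots> = rho d (s j (s j (rho b x)))" using edge_reflection[OF d(1,2) b(2)] by simp
    finally show ?thesis using s_s d by (simp add: rho_append)
  qed
  then have "rho (b @ d) = rho (i # w)" by auto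
  moreover have "b @ d \<in> W" using d by simp
  ultimately show ?thesis using 1(2) w b by (intro bexI[of _ "b @ d"]) auto
qed

section \<open>Geodesic words and simple transitivity\<close>

definition geodesic :: "nat list \<Rightarrow> bool" where
  "geodesic w \<longleftrightarrow> w \<in> W \<and> D u0 (phi w) = length w"

lemma ex_geodesic: "w \<in> W \<Longrightarrow> \<exists>w'. geodesic w' \<and> rho w' = rho w"
proof (induction w)
  case Nil
  show ?case by (rule exI[of _ "[]"]) (simp add: geodesic_def)
next
  case (Cons i w)
  then obtain w1 where w1: "geodesic w1" "rho w1 = rho w" by auto
  have i: "i < m" using Cons by simp
  show ?case
  proof (cases "D u0 (phi (i # w1)) = Suc (length w1)")
    case True
    then show ?thesis using w1 i by (intro exI[of _ "i # w1"]) (auto simp: geodesic_def)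
  next
    case False
    from exchange[OF _ _ i this] w1 obtain w' where w': "w' \<in> W" "rho w' = rho (i # w1)"
      "D u0 (phi (i # w1)) = length w'" by (auto simp: geodesic_def)
    then show ?thesis using w1 by (intro exI[of _ w']) (auto simp: geodesic_def)
  qed
qed

lemma geodesic_tl: assumes "geodesic (i # w)" shows "geodesic w"
proof -
  have w: "i < m" "w \<in> W" using assms by (auto simp: geodesic_def)
  have "D u0 (phi w') \<le> length w'" if "w' \<in> W" for w'
    using that
  proof (induction w')
    case (Cons j w')
    then show ?case using D_tri[of u0 "phi (j # w')" "phi w'"] phi_edge[of w' j] by force
  qed simp
  from this[OF w(2)] have "D u0 (phi w) \<le> length w" .
  moreover have "D u0 (phi (i # w)) \<le> D u0 (phi w) + 1" using D_tri[of u0 "phi (i # w)" "phi w"] phi_edge[OF w(2,1)] by simp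
  ultimately show ?thesis using assms w by (auto simp: geodesic_def)
qed

text \<open>A word fixing \<open>u0\<close> acts like a geodesic word whose length is
  \<open>D u0 u0 = 0\<close>, hence like the identity.\<close>

lemma simply_transitive: assumes "w \<in> W" "w' \<in> W" "phi w = phi w'" shows "rho w = rho w'"
proof -
  have ww: "w' @ rev w \<in> W" using assms by simp
  obtain v where v: "geodesic v" "rho v = rho (w' @ rev w)" using ex_geodesic[OF ww] by blast
  have "phi v = u0" using v assms by (simp add: rho_append rho_rev_left flip: assms(3))
  then have "v = []" using v by (simp add: geodesic_def)
  then have "rho (rev w) (rho w' x) = x" for x using v by (metis rho.simps(1) rho_append comp_apply id_apply)
  then have "rho w' x = rho w x" for x using rho_rev_right[OF assms(1)] by metis
  then show ?thesis by auto
qed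

section \<open>The Coxeter matrix, its relations, and Matsumoto's theorem\<close>

definition k :: "nat \<Rightarrow> nat \<Rightarrow> enat" where
  "k i j = (if i = j then 1 else enat (cox_num u0 (c i) (c j)))"

lemma cox_num_ge_2: "i < m \<Longrightarrow> j < m \<Longrightarrow> i \<noteq> j \<Longrightarrow> cox_num u0 (c i) (c j) \<ge> 2"
  using dihedral(1)[OF u0 c_P S_s c_P S_s] c_inj by blast

lemma coxeter_matrix_k: "coxeter_matrix m k"
proof -
  have "(2::enat) \<le> enat n" if "2 \<le> n" for n :: nat
    using that by (simp add: numeral_eq_enat)
  then show ?thesis
    using cox_num_ge_2 cox_num_sym by (auto simp: coxeter_matrix_def k_def)
qed

lemma rho_rev_alt: "rho (rev (alt n i j)) = dih n (s i) (s j)"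
  by (induction n arbitrary: i j) (auto simp: rho_append)

text \<open>The closing of the dihedral cycle says that both sides agree at \<open>u0\<close>;
  simple transitivity does the rest.\<close>

lemma rho_braid: assumes "i < m" "j < m" "i \<noteq> j"
  shows "dih (cox_num u0 (c i) (c j)) (s i) (s j) = dih (cox_num u0 (c i) (c j)) (s j) (s i)"
proof -
  let ?n = "cox_num u0 (c i) (c j)"
  have "c i \<noteq> c j" using assms c_inj by blast
  from dihedral(3)[OF u0 c_P[OF assms(1)] S_s[OF assms(1)] c_P[OF assms(2)] S_s[OF assms(2)] this]
  have "phi (rev (alt ?n i j)) = phi (rev (alt ?n j i))" by (simp add: rho_rev_alt)
  moreover have "rev (alt ?n i j) \<in> W" "rev (alt ?n j i) \<in> W"
    using alt_lists[of _ "{..<m}"] assms by simp_all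
  ultimately show ?thesis using simply_transitive by (metis rho_rev_alt)
qed

lemma rho_relator: assumes "cox_relator m k r'" shows "rho r' = id"
proof -
  obtain i j n where r': "i < m" "j < m" "k i j = enat n" "r' = alt (2 * n) i j"
    using assms unfolding cox_relator_def concat_replicate_alt by blast
  show ?thesis
  proof (cases "i = j")
    case True
    then have "n = 1" using r' by (simp add: k_def one_enat_def)
    then show ?thesis using r' True s_s by (auto simp: numeral_2_eq_2)
  next
    case False
    then have n: "n = cox_num u0 (c i) (c j)" using r' by (simp add: k_def)
    have W: "alt n i j \<in> W" using alt_lists[of _ "{..<m}"] r' by simp
    have "rho r' = rho (rev (alt n j i)) \<circ> rho (alt n i j)" unfolding r'(4) alt_double rho_append ..
    also have "rho (rev (alt n j i)) = rho (rev (alt n i j))"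
      unfolding rho_rev_alt n using rho_braid[OF r'(1,2) False] by simp
    finally show ?thesis using rho_rev_left[OF W] by auto
  qed
qed

lemma cox_equiv_rho: "cox_equiv m k w w' \<Longrightarrow> rho w = rho w'"
  by (induction rule: cox_equiv.induct) (auto simp: rho_append rho_relator)

text \<open>Matsumoto's theorem: the two first letters of two geodesic words for the same element span
  a dihedral cycle, and both words can be routed through the gate of that cycle.\<close>

lemma matsumoto: "geodesic w \<Longrightarrow> geodesic w' \<Longrightarrow> rho w = rho w' \<Longrightarrow> cox_equiv m k w w'"
proof (induction "length w" arbitrary: w w')
  case 0
  then have "phi w' = u0" by (metis length_0_conv rho.simps(1) id_apply)
  then have "length w' = 0" using 0 by (simp add: geodesic_def)
  then show ?case using 0 by (simp add: cox_equiv.refl)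
next
  case (Suc l)
  have len: "length w' = Suc l" using Suc.prems Suc.hyps(2) by (simp add: geodesic_def)
  obtain i w1 where w: "w = i # w1" using Suc.hyps(2) by (cases w) auto
  obtain j w1' where w': "w' = j # w1'" using len by (cases w') auto
  have W: "i < m" "j < m" "w1 \<in> W" "w1' \<in> W" "w \<in> W" "w' \<in> W"
    using Suc.prems w w' by (auto simp: geodesic_def)
  have g1: "geodesic w1" "geodesic w1'" using geodesic_tl Suc.prems w w' by blast+
  have l1: "length w1 = l" "length w1' = l" using w w' len Suc.hyps(2) by auto
  have r1: "rho w1 x = rho w (s i x)" for x unfolding w using s_s[OF W(1)] by simp
  have r2: "rho w1' x = rho w (s j x)" for x unfolding Suc.prems(3) w' using s_s[OF W(2)] by simp
  show ?case
  proof (cases "i = j")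
    case True
    then have "rho w1 = rho w1'" using r1 r2 by auto
    from Suc.hyps(1)[OF _ g1 this] l1 have "cox_equiv m k w1 w1'" by simp
    then show ?thesis using w w' True cox_equiv_Cons by simp
  next
    case False
    \<comment> \<open>\<open>?v\<close> is the preimage of \<open>u0\<close> under
      \<open>rho w\<close>. Seen from it, deleting the first letter of w or of w' means moving from
      \<open>u0\<close> to \<open>s i u0\<close> or \<open>s j u0\<close>. Both moves come nearer to
      \<open>?v\<close>, which is the hypothesis of \<open>cyc_gate\<close>.\<close>
    let ?n = "cox_num u0 (c i) (c j)" and ?v = "rho (rev w) u0"
    let ?h = "dih ?n (s i) (s j)"
    have cc: "c i \<noteq> c j" using False W c_inj by blast
    have n2: "?n \<ge> 2" using cox_num_ge_2[OF W(1,2) False] .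
    have vV: "?v \<in> V" using phi_V W by simp
    have Dv: "D ?v y = D u0 (rho w y)" if "y \<in> V" for y
      using aut_D[OF rho_aut[OF W(5)] vV that] rho_rev_right[OF W(5)] by simp
    have Dvu: "D ?v u0 = Suc l" using Dv[OF u0] Suc.prems(1) Suc.hyps(2) by (simp add: geodesic_def)
    have Di: "D ?v (s i u0) = l" using Dv[of "s i u0"] r1[of u0] g1(1) l1 u0 c_P W by (simp add: geodesic_def)
    have Dj: "D ?v (s j u0) = l" using Dv[of "s j u0"] r2[of u0] g1(2) l1 u0 c_P W by (simp add: geodesic_def)
    have gate: "Suc l = D ?v (?h u0) + ?n"
      using cyc_gate[OF u0 c_P[OF W(1)] S_s[OF W(1)] c_P[OF W(2)] S_s[OF W(2)] cc vV] Dvu Di Dj by simp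
    let ?a = "alt ?n i j" and ?b = "alt ?n j i"
    have ab: "?a \<in> W" "?b \<in> W" using alt_lists[of _ "{..<m}"] W by simp_all
    have ra: "rho (rev ?a) = ?h" "rho (rev ?b) = ?h" using rho_rev_alt rho_braid[OF W(1,2) False] by metis+
    have "rev ?a @ w \<in> W" using ab W by simp
    \<comment> \<open>A geodesic word for the part beyond the gate. By the distance formula its
      length is \<open>Suc l - ?n\<close>, so prefixing either alternating word gives a geodesic
      word for the same element.\<close>
    from ex_geodesic[OF this] obtain w0 where w0: "geodesic w0" "rho w0 = rho w \<circ> ?h"
      using ra by (auto simp: rho_append)
    have hV: "?h u0 \<in> V" using phi_V[of "rev ?a"] ab ra by simp
    have lw0: "length w0 + ?n = Suc l" using w0 gate Dv[OF hV] by (simp add: geodesic_def)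
    have ra0: "rho (?a @ w0) = rho w" "rho (?b @ w0) = rho w"
      using rho_rev_left[of ?a] rho_rev_left[of ?b] ab ra w0
      by (auto simp: rho_append fun_eq_iff)
    \<comment> \<open>The routed word has the same first letter as the given one; the remainders are
      shorter geodesic words for one element, so the induction hypothesis compares them.\<close>
    have key: "cox_equiv m k (i' # v1) (alt ?n i' j' @ w0)"
      if v1: "geodesic v1" "\<And>x. rho v1 x = rho w (s i' x)" "length v1 = l" and i': "i' < m" "j' < m"
        and e: "rho (alt ?n i' j' @ w0) = rho w" for i' j' v1
    proof -
      obtain n' where n': "?n = Suc n'" using n2 by (cases ?n) auto
      let ?v = "alt n' j' i' @ w0"
      have ve: "alt ?n i' j' @ w0 = i' # ?v" using n' by simp
      have vW: "?v \<in> W" using alt_lists[of j' "{..<m}" i' n'] i' w0 by (simp add: geodesic_def)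
      have "rho ?v x = rho v1 x" for x
      proof -
        have "rho ?v x = rho (i' # ?v) (s i' x)" using s_s i' by simp
        also have "\<dots> = rho w (s i' x)" using e ve by simp
        finally show ?thesis using v1 by simp
      qed
      then have re: "rho v1 = rho ?v" by auto
      moreover have "length ?v = l" using lw0 n' by simp
      ultimately have "geodesic ?v" using v1 vW by (simp add: geodesic_def)
      from Suc.hyps(1)[OF _ v1(1) this re] v1 have "cox_equiv m k v1 ?v" by simp
      then show ?thesis unfolding ve by (rule cox_equiv_Cons)
    qed
    have 1: "cox_equiv m k w (?a @ w0)" unfolding w by (rule key[OF g1(1) r1 l1(1) W(1,2) ra0(1)])
    have 2: "cox_equiv m k w' (?b @ w0)" unfolding w' by (rule key[OF g1(2) r2 l1(2) W(2,1) ra0(2)])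
    have "k i j = enat ?n" using False by (simp add: k_def)
    from cox_braid[OF coxeter_matrix_k W(1,2) this]
    have "cox_equiv m k (?a @ w0) (?b @ w0)" using cox_equiv_append cox_equiv.refl by blast
    then show ?thesis using 1 2 cox_equiv.trans cox_equiv.sym by blast
  qed
qed

text \<open>When prepending i shortens, exchange gives a second geodesic word \<open>i # v\<close>
  for the same element as \<open>w1\<close>. Matsumoto's theorem makes the two equivalent, and then
  the doubled letter i cancels inside the presentation.\<close>

lemma cox_equiv_geodesic: "w \<in> W \<Longrightarrow> \<exists>w'. geodesic w' \<and> cox_equiv m k w w'"
proof (induction w)
  case Nil
  show ?case by (rule exI[of _ "[]"]) (simp add: geodesic_def cox_equiv.refl)
next
  case (Cons i w)
  then obtain w1 where w1: "geodesic w1" "cox_equiv m k w w1" by auto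
  have i: "i < m" using Cons by simp
  have e1: "cox_equiv m k (i # w) (i # w1)" using cox_equiv_Cons w1 by blast
  have w1W: "w1 \<in> W" using w1 by (simp add: geodesic_def)
  show ?case
  proof (cases "D u0 (phi (i # w1)) = Suc (length w1)")
    case True
    then have "geodesic (i # w1)" using w1 i by (auto simp: geodesic_def)
    then show ?thesis using e1 by blast
  next
    case False
    from exchange[OF _ _ i this] w1 obtain v where v: "v \<in> W" "rho v = rho (i # w1)"
      "D u0 (phi (i # w1)) = length v" "Suc (length v) = length w1" by (auto simp: geodesic_def)
    have gv: "geodesic v" using v by (simp add: geodesic_def)
    have re: "rho (i # v) = rho w1" using v(2) s_s[OF i] by (auto simp: fun_eq_iff)
    then have "geodesic (i # v)" using v i w1 by (simp add: geodesic_def)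
    from matsumoto[OF w1(1) this re[symmetric]] have "cox_equiv m k (i # w1) (i # i # v)" by (rule cox_equiv_Cons)
    moreover have "cox_equiv m k (i # i # v) v"
      using cox_equiv_append[OF cox_square[OF coxeter_matrix_k i] cox_equiv.refl] by fastforce
    ultimately show ?thesis using e1 gv cox_equiv.trans by blast
  qed
qed

lemma cox_equiv_iff_phi: assumes "w \<in> W" "w' \<in> W" shows "cox_equiv m k w w' \<longleftrightarrow> phi w = phi w'"
proof
  assume "phi w = phi w'"
  then have e: "rho w = rho w'" using simply_transitive assms by blast
  obtain v v' where v: "geodesic v" "cox_equiv m k w v" "geodesic v'" "cox_equiv m k w' v'"
    using cox_equiv_geodesic assms by meson
  then have "rho v = rho v'" using e cox_equiv_rho by metis
  then have "cox_equiv m k v v'" using matsumoto v by blast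
  then show "cox_equiv m k w w'" using v cox_equiv.trans cox_equiv.sym by blast
qed (simp add: cox_equiv_rho)

section \<open>The isomorphism with the Cayley graph\<close>

lemma phi_nbr: assumes "w \<in> W" "v \<in> V" "D (phi w) v = 1" shows "\<exists>i<m. v = phi (i # w)"
proof -
  let ?x = "rho (rev w) v"
  have a: "aut (rho (rev w))" using rho_aut assms by simp
  have xV: "?x \<in> V" using a assms by simp
  have "D (rho (rev w) (phi w)) ?x = 1" using aut_D[OF a phi_V[OF assms(1)] assms(2)] assms by simp
  then have "D u0 ?x = 1" using rho_rev_left assms by simp
  then have "?x \<in> nb ` {..<m}" using xV nb by (simp add: bij_betw_def)
  then obtain i where i: "i < m" "?x = nb i" by auto
  then have "phi (i # w) = v" using s_u0 rho_rev_right[OF assms(1)] by (metis comp_apply rho.simps(2))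
  then show ?thesis using i by blast
qed

lemma phi_surj: "v \<in> V \<Longrightarrow> \<exists>w\<in>W. phi w = v"
proof (induction "D u0 v" arbitrary: v rule: less_induct)
  case less
  show ?case
  proof (cases "u0 = v")
    case True
    then have "phi [] = v" unfolding rho.simps id_apply .
    then show ?thesis by blast
  next
    case False
    from stepE[OF u0 less.prems this] obtain z X where z: "z \<in> V" "S z v = {X}" "D u0 v = D u0 z + 1" by metis
    from less.hyps[of z] z obtain w where w: "w \<in> W" "phi w = z" by auto
    then have "D (phi w) v = 1" using z by simp
    from phi_nbr[OF w(1) less.prems this] w show ?thesis by (metis lessThan_iff listsp.Cons lists_def Cons_in_lists_iff)
  qed
qed

lemma cayley_iso:
  assumes E: "\<And>u v. u \<in> V \<Longrightarrow> v \<in> V \<Longrightarrow> {u, v} \<in> E \<longleftrightarrow> D u v = 1"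
  shows "finite (cox_elems m k)" "graph_iso V E (cox_elems m k) (cox_cayley_edges m k)"
proof -
  define wd where "wd v = (SOME w. w \<in> W \<and> phi w = v)" for v
  have wd: "wd v \<in> W \<and> phi (wd v) = v" if "v \<in> V" for v
    using someI_ex[of "\<lambda>w. w \<in> W \<and> phi w = v"] phi_surj[OF that] unfolding wd_def by blast
  define f where "f v = cox_class m k (wd v)" for v
  have f_phi: "f (phi w) = cox_class m k w" if "w \<in> W" for w
    unfolding f_def using wd[OF phi_V[OF that]] cox_class_eq_iff cox_equiv_iff_phi that by metis
  have inj: "u = v" if "u \<in> V" "v \<in> V" "f u = f v" for u v
    using that wd cox_class_eq_iff cox_equiv_iff_phi unfolding f_def by metis
  have img: "f ` V = cox_elems m k"
  proof
    show "f ` V \<subseteq> cox_elems m k" using wd by (auto simp: f_def cox_elems_def)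
    show "cox_elems m k \<subseteq> f ` V"
    proof
      fix C assume "C \<in> cox_elems m k"
      then obtain w where "w \<in> W" "C = cox_class m k w" by (auto simp: cox_elems_def)
      then show "C \<in> f ` V" using f_phi phi_V by (metis image_eqI)
    qed
  qed
  have bij: "bij_betw f V (cox_elems m k)" using inj img by (auto simp: bij_betw_def inj_on_def)
  show "finite (cox_elems m k)" using img finite_V by (metis finite_imageI)
  have "{u, v} \<in> E \<longleftrightarrow> {f u, f v} \<in> cox_cayley_edges m k" if uv: "u \<in> V" "v \<in> V" for u v
  proof
    assume "{u, v} \<in> E"
    then have D1: "D u v = 1" using E uv by blast
    obtain w where w: "w \<in> W" "phi w = u" using phi_surj[OF uv(1)] by blast
    obtain i where i: "i < m" "v = phi (i # w)" using phi_nbr[OF w(1) uv(2)] D1 w by blast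
    have "f u = cox_class m k w" using f_phi[OF w(1)] w by simp
    moreover have "f v = cox_class m k (i # w)" using f_phi[of "i # w"] i w by simp
    ultimately have "{f u, f v} = {cox_class m k (i # w), cox_class m k w}" by auto
    then show "{f u, f v} \<in> cox_cayley_edges m k" using i w unfolding cox_cayley_edges_def by blast
  next
    assume "{f u, f v} \<in> cox_cayley_edges m k"
    then obtain i w where w: "{f u, f v} = {cox_class m k (i # w), cox_class m k w}" "i < m" "w \<in> W"
      unfolding cox_cayley_edges_def by blast
    have iw: "i # w \<in> W" using w by simp
    have "{f u, f v} = {f (phi (i # w)), f (phi w)}" using f_phi[OF w(3)] f_phi[OF iw] w(1) by simp
    then have "(u = phi (i # w) \<and> v = phi w) \<or> (u = phi w \<and> v = phi (i # w))"
      using inj uv phi_V[OF w(3)] phi_V[OF iw] by (metis doubleton_eq_iff)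
    then have "D u v = 1" using phi_edge[OF w(3,2)] D_sym by metis
    then show "{u, v} \<in> E" using E uv by blast
  qed
  then show "graph_iso V E (cox_elems m k) (cox_cayley_edges m k)"
    unfolding graph_iso_def graph_iso_map_def using bij by blast
qed

end

lemma (in mirror_system) coxeter:
  assumes E: "\<And>u v. u \<in> V \<Longrightarrow> v \<in> V \<Longrightarrow> {u, v} \<in> E \<longleftrightarrow> D u v = 1"
  shows "\<exists>m k. coxeter_matrix m k \<and> finite (cox_elems m k) \<and> graph_iso V E (cox_elems m k) (cox_cayley_edges m k)"
proof -
  obtain u0 where u0: "u0 \<in> V" using V_nonempty by blast
  let ?N = "{v \<in> V. D u0 v = 1}"
  have "finite ?N" using finite_V by simp
  then obtain nb where nb: "bij_betw nb {..<card ?N} ?N"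
    using ex_bij_betw_nat_finite[of ?N] by (auto simp: atLeast0LessThan)
  interpret pointed_mirror_system V P side r u0 "card ?N" nb
    by unfold_locales (use u0 nb in auto)
  show ?thesis using coxeter_matrix_k cayley_iso[OF E] by blast
qed

section \<open>Mirror graphs and mirror systems\<close>

lemma adj_sym: "adj V E u v \<longleftrightarrow> adj V E v u"
  by (auto simp: adj_def insert_commute)

lemma reach_refl: "reach V E u u"
  by (simp add: reach_def)

lemma reach_sym: assumes "reach V E u v" shows "reach V E v u"
proof -
  have "symp (adj V E)" using adj_sym by (metis sympI)
  from symp_rtranclp[OF this] show ?thesis using assms unfolding reach_def by (rule sympD)
qed

lemma reach_trans: "reach V E u v \<Longrightarrow> reach V E v w \<Longrightarrow> reach V E u w"
  unfolding reach_def by (rule rtranclp_trans)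

lemma adj_reach: "adj V E u v \<Longrightarrow> reach V E u v"
  by (simp add: reach_def)

lemma components_two:
  assumes "components V F = {C1, C2}" "C1 \<noteq> C2"
  shows "C1 \<union> C2 = V" "C1 \<inter> C2 = {}" "\<And>u v. adj V F u v \<Longrightarrow> u \<in> C1 \<longleftrightarrow> v \<in> C1" "C1 \<noteq> {}" "C2 \<noteq> {}"
proof -
  let ?c = "\<lambda>u. {v \<in> V. reach V F u v}"
  have comp: "components V F = ?c ` V" by (auto simp: components_def)
  have C: "C1 \<in> ?c ` V" "C2 \<in> ?c ` V" using assms comp by auto
  have eq: "?c u = ?c v" if "reach V F u v" for u v
    using that reach_sym reach_trans by (metis (no_types, lifting))
  have "\<Union> (components V F) = V" using comp reach_refl by fastforce
  then show "C1 \<union> C2 = V" using assms by simp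
  obtain a b where ab: "C1 = ?c a" "C2 = ?c b" "a \<in> V" "b \<in> V" using C by auto
  show "C1 \<inter> C2 = {}"
  proof (rule ccontr)
    assume "C1 \<inter> C2 \<noteq> {}"
    then obtain x where "reach V F a x" "reach V F b x" using ab by blast
    then have "reach V F a b" using reach_sym reach_trans by metis
    then show False using eq ab assms(2) by blast
  qed
  have "a \<in> C1" "b \<in> C2" using ab reach_refl by simp_all
  then show "C1 \<noteq> {}" "C2 \<noteq> {}" by auto
  fix u v assume "adj V F u v"
  then have "reach V F u v" "u \<in> V" "v \<in> V" using adj_reach[of V F u v] by (simp_all add: adj_def)
  then show "u \<in> C1 \<longleftrightarrow> v \<in> C1" using ab reach_sym reach_trans by (metis (mono_tags, lifting) mem_Collect_eq)
qed

text \<open>Gluing \<open>\<alpha>\<close> on one half with its inverse on the other half turns it into an involution.\<close>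

lemma mirror_class:
  assumes simple: "simple_graph V E" and XE: "X \<subseteq> E" and aut: "graph_aut \<alpha> V E"
    and swap: "\<forall>u v. {u, v} \<in> X \<longrightarrow> \<alpha> u = v \<and> \<alpha> v = u"
    and C: "C1 \<noteq> C2" "components V (E - X) = {C1, C2}"
    and bij: "bij_betw \<alpha> C1 C2"
  shows "\<exists>\<rho>. \<rho> permutes V \<and> (\<forall>v. \<rho> (\<rho> v) = v) \<and> (\<forall>v\<in>V. (\<rho> v \<in> C1) \<noteq> (v \<in> C1)) \<and>
     (\<forall>u v. {u, v} \<in> X \<longrightarrow> \<rho> u = v) \<and> (\<forall>u\<in>V. \<forall>v\<in>V. {u, v} \<in> E \<longrightarrow> {\<rho> u, \<rho> v} \<in> E) \<and>
     (\<forall>u\<in>V. \<forall>v\<in>V. {u, v} \<in> E \<longrightarrow> ({u, v} \<in> X \<longleftrightarrow> (u \<in> C1) \<noteq> (v \<in> C1)))"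
proof -
  note two = components_two[OF C(2,1)]
  have \<alpha>V: "bij_betw \<alpha> V V" and \<alpha>E: "\<And>u v. u \<in> V \<Longrightarrow> v \<in> V \<Longrightarrow> {u, v} \<in> E \<longleftrightarrow> {\<alpha> u, \<alpha> v} \<in> E"
    using aut by (auto simp: graph_aut_def graph_iso_map_def)
  have inj: "inj_on \<alpha> V" and img: "\<alpha> ` V = V" using \<alpha>V by (auto simp: bij_betw_def)
  have C2V: "v \<in> C2 \<longleftrightarrow> v \<notin> C1" if "v \<in> V" for v using two that by blast
  have C1sub: "C1 \<subseteq> V" "C2 \<subseteq> V" using two by auto
  have a1: "\<alpha> v \<in> C2" if "v \<in> C1" for v using bij that by (auto simp: bij_betw_def)
  have a2: "\<alpha> v \<in> C1" if "v \<in> C2" for v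
  proof (rule ccontr)
    assume "\<alpha> v \<notin> C1"
    moreover have "\<alpha> v \<in> V" using that C1sub img by auto
    ultimately have "\<alpha> v \<in> \<alpha> ` C1" using C2V bij by (simp add: bij_betw_def)
    then obtain w where "w \<in> C1" "\<alpha> w = \<alpha> v" by auto
    then show False using inj that C1sub two(2) by (metis disjoint_iff inj_onD subsetD)
  qed
  have cross: "{u, v} \<in> X \<longleftrightarrow> (u \<in> C1) \<noteq> (v \<in> C1)" if "u \<in> V" "v \<in> V" "{u, v} \<in> E" for u v
  proof
    assume "{u, v} \<in> X"
    then have "\<alpha> u = v" using swap by blast
    then show "(u \<in> C1) \<noteq> (v \<in> C1)" using a1 a2 C2V that by metis
  next
    assume d: "(u \<in> C1) \<noteq> (v \<in> C1)"
    show "{u, v} \<in> X"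
    proof (rule ccontr)
      assume "{u, v} \<notin> X"
      then have "adj V (E - X) u v" using that by (simp add: adj_def)
      then show False using two(3) d by blast
    qed
  qed
  define \<beta> where "\<beta> = inv_into V \<alpha>"
  have \<beta>: "\<alpha> (\<beta> v) = v" "\<beta> v \<in> V" if "v \<in> V" for v
    using that img unfolding \<beta>_def by (auto simp: f_inv_into_f inv_into_into)
  have \<beta>\<alpha>: "\<beta> (\<alpha> v) = v" if "v \<in> V" for v using that inj unfolding \<beta>_def by simp
  define \<rho> where "\<rho> v = (if v \<in> V then if v \<in> C1 then \<alpha> v else \<beta> v else v)" for v
  have \<beta>1: "\<beta> v \<in> C1" if "v \<in> V" "v \<notin> C1" for v
    using a1 \<beta>[OF that(1)] C2V that a2 by metis
  have \<rho>V: "\<rho> v \<in> V" if "v \<in> V" for v using that img \<beta> by (auto simp: \<rho>_def)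
  have \<rho>C: "(\<rho> v \<in> C1) \<noteq> (v \<in> C1)" if "v \<in> V" for v
    using a1 \<beta>1 that C2V C1sub by (auto simp: \<rho>_def)
  have \<rho>\<rho>: "\<rho> (\<rho> v) = v" for v
  proof (cases "v \<in> V")
    case True
    then have "\<rho> v \<in> V" "(\<rho> v \<in> C1) \<noteq> (v \<in> C1)" using \<rho>V \<rho>C by auto
    then show ?thesis using \<beta>\<alpha> \<beta> True by (auto simp: \<rho>_def)
  qed (simp add: \<rho>_def)
  have perm: "\<rho> permutes V"
    unfolding permutes_def using \<rho>\<rho> by (metis \<rho>_def)
  have sw: "\<rho> u = v" if "{u, v} \<in> X" for u v
  proof -
    have "{u, v} \<in> E" using that XE by blast
    then have uv: "u \<in> V" "v \<in> V" using simple unfolding simple_graph_def by (metis doubleton_eq_iff)+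
    have "\<alpha> u = v" "\<alpha> v = u" using swap that by blast+
    moreover from this have "\<beta> u = v" using \<beta>\<alpha>[OF uv(2)] by simp
    ultimately show ?thesis using uv by (simp add: \<rho>_def)
  qed
  have ed: "{\<rho> u, \<rho> v} \<in> E" if uv: "u \<in> V" "v \<in> V" "{u, v} \<in> E" for u v
  proof (cases "{u, v} \<in> X")
    case True
    then have "\<rho> u = v" "\<rho> v = u" using sw by (auto simp: insert_commute)
    then show ?thesis using uv by (simp add: insert_commute)
  next
    case False
    then have "u \<in> C1 \<longleftrightarrow> v \<in> C1" using cross uv by blast
    moreover have "{\<alpha> u, \<alpha> v} \<in> E" using \<alpha>E uv by blast
    moreover have "{\<beta> u, \<beta> v} \<in> E" using \<alpha>E[of "\<beta> u" "\<beta> v"] \<beta> uv by simp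
    ultimately show ?thesis using uv by (simp add: \<rho>_def)
  qed
  show ?thesis
    by (rule exI[of _ \<rho>], intro conjI allI ballI impI; (rule perm \<rho>\<rho> \<rho>C sw ed cross; assumption))
qed

text \<open>Only here does the path metric of the given graph appear, as lengths of walks. The last
  edge of a shortest walk supplies the axiom \<open>step\<close>; afterwards counting separating
  classes replaces the metric.\<close>

lemma mirror_graph_imp_system:
  fixes V :: "'a set"
  assumes "mirror_graph V E"
  shows "\<exists>P side r. mirror_system V (P :: 'a set set set) side r \<and>
           (\<forall>u\<in>V. \<forall>v\<in>V. {u, v} \<in> E \<longleftrightarrow> card (sep P side u v) = 1)"
proof -
  note M = assms[unfolded mirror_graph_def]
  have fin: "finite V" and simple: "simple_graph V E" and conn: "graph_connected V E"
    using M[THEN conjunct1] M[THEN conjunct2, THEN conjunct1] M[THEN conjunct2, THEN conjunct2, THEN conjunct1] .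
  obtain P where part: "edge_partition E P" and
    P: "\<forall>X\<in>P. \<exists>\<alpha>. graph_aut \<alpha> V E \<and>
         (\<forall>u v. {u, v} \<in> X \<longrightarrow> \<alpha> u = v \<and> \<alpha> v = u) \<and>
         (\<exists>C1 C2. C1 \<noteq> C2 \<and> components V (E - X) = {C1, C2} \<and>
            graph_iso_map \<alpha> C1 (induced_edges (E - X) C1) C2 (induced_edges (E - X) C2))"
    using M[THEN conjunct2, THEN conjunct2, THEN conjunct2] by (elim exE conjE)
  have XE: "X \<subseteq> E" if "X \<in> P" for X using part that by (auto simp: edge_partition_def)
  let ?Q = "\<lambda>X \<rho> C1. \<rho> permutes V \<and> (\<forall>v. \<rho> (\<rho> v) = v) \<and> (\<forall>v\<in>V. (\<rho> v \<in> C1) \<noteq> (v \<in> C1)) \<and>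
     (\<forall>u v. {u, v} \<in> X \<longrightarrow> \<rho> u = v) \<and> (\<forall>u\<in>V. \<forall>v\<in>V. {u, v} \<in> E \<longrightarrow> {\<rho> u, \<rho> v} \<in> E) \<and>
     (\<forall>u\<in>V. \<forall>v\<in>V. {u, v} \<in> E \<longrightarrow> ({u, v} \<in> X \<longleftrightarrow> (u \<in> C1) \<noteq> (v \<in> C1)))"
  have "\<forall>X\<in>P. \<exists>p. ?Q X (fst p) (snd p)"
  proof
    fix X assume X: "X \<in> P"
    obtain \<alpha> C1 C2 where "graph_aut \<alpha> V E" "\<forall>u v. {u, v} \<in> X \<longrightarrow> \<alpha> u = v \<and> \<alpha> v = u"
      "C1 \<noteq> C2" "components V (E - X) = {C1, C2}" "bij_betw \<alpha> C1 C2"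
      using bspec[OF P X] unfolding graph_iso_map_def by (elim exE conjE) blast
    from mirror_class[OF simple XE[OF X] this] obtain \<rho> where q: "?Q X \<rho> C1" by (elim exE)
    show "\<exists>p. ?Q X (fst p) (snd p)"
      by (rule exI[of _ "(\<rho>, C1)"], unfold fst_conv snd_conv, rule q)
  qed
  from bchoice[OF this] obtain p where Q0: "\<forall>X\<in>P. ?Q X (fst (p X)) (snd (p X))" by (elim exE)
  define r where "r X = fst (p X)" for X
  define C1 where "C1 X = snd (p X)" for X
  have Q: "?Q X (r X) (C1 X)" if "X \<in> P" for X unfolding r_def C1_def by (rule bspec[OF Q0 that])
  define side where "side X v \<longleftrightarrow> v \<in> C1 X" for X v
  let ?S = "sep P side"
  have perm: "r X permutes V" and rr: "r X (r X v) = v" if "X \<in> P" for X v using Q[OF that] by blast+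
  have flip: "side X (r X v) \<noteq> side X v" if "X \<in> P" "v \<in> V" for X v
    using Q[OF that(1)] that(2) by (auto simp: side_def)
  have swap: "r X u = v" if "X \<in> P" "{u, v} \<in> X" for X u v using Q[OF that(1)] that(2) by blast
  have edge: "{r X u, r X v} \<in> E" if "X \<in> P" "u \<in> V" "v \<in> V" "{u, v} \<in> E" for X u v
    using Q[OF that(1)] that by blast
  have cross: "{u, v} \<in> X \<longleftrightarrow> side X u \<noteq> side X v" if "X \<in> P" "u \<in> V" "v \<in> V" "{u, v} \<in> E" for X u v
    using Q[OF that(1)] that unfolding side_def by blast
  have rV: "r X v \<in> V \<longleftrightarrow> v \<in> V" if "X \<in> P" for X v using permutes_in_image[OF perm[OF that]] .
  have S_edge: "\<exists>X\<in>P. {u, v} \<in> X \<and> ?S u v = {X}" if uv: "u \<in> V" "v \<in> V" "{u, v} \<in> E" for u v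
  proof -
    have "{u, v} \<in> \<Union>P" using part uv by (simp add: edge_partition_def)
    then obtain X where X: "X \<in> P" "{u, v} \<in> X" by blast
    have uniq: "Y = X" if "Y \<in> P" "{u, v} \<in> Y" for Y
      using part X that unfolding edge_partition_def by (metis disjoint_iff)
    have "Y \<in> ?S u v \<longleftrightarrow> Y = X" for Y
      using cross[OF _ uv, of Y] uniq[of Y] X by (auto simp: sep_def)
    then have "?S u v = {X}" by blast
    then show ?thesis using X by blast
  qed
  let ?R = "\<lambda>n. (adj V E ^^ n)"
  have RV: "v \<in> V" if "?R n u v" "u \<in> V" for n u v
    using that by (cases n) (auto simp: adj_def)
  have mapR: "?R n (r X u) (r X v)" if "X \<in> P" "?R n u v" for n X u v
    using that(2)
  proof (induction n arbitrary: v)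
    case (Suc n)
    then obtain z where "?R n u z" "adj V E z v" by auto
    moreover from this have "adj V E (r X z) (r X v)" using edge rV that(1) by (simp add: adj_def)
    ultimately show ?case using Suc.IH by auto
  qed simp
  \<comment> \<open>The walk is reflected behind its last crossing of X, which saves the crossing
    edge.\<close>
  have foldR: "\<exists>n'. n = Suc n' \<and> ?R n' u (r X z)" if "X \<in> P" "?R n u z" "side X u \<noteq> side X z" for n X u z
    using that(2,3)
  proof (induction n arbitrary: z)
    case (Suc n)
    then obtain y where y: "?R n u y" "adj V E y z" by auto
    show ?case
    proof (cases "side X u = side X y")
      case True
      then have "{y, z} \<in> X" using cross[OF that(1), of y z] y Suc.prems by (auto simp: adj_def)
      then have "{z, y} \<in> X" by (simp add: insert_commute)
      then have "r X z = y" using swap that by blast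
      then show ?thesis using y by simp
    next
      case False
      from Suc.IH[OF y(1) this] obtain n' where n': "n = Suc n'" "?R n' u (r X y)" by blast
      have "adj V E (r X y) (r X z)"
        using y edge[OF that(1), of y z] rV[OF that(1)] by (simp add: adj_def)
      then have "?R n u (r X z)" using n' by auto
      then show ?thesis by simp
    qed
  qed simp
  have step: "\<exists>z\<in>V. {z, v} \<in> E \<and> (\<exists>X\<in>?S u v. ?S z v = {X})" if uv: "u \<in> V" "v \<in> V" "u \<noteq> v" for u v
  proof -
    have "reach V E u v" using conn uv by (simp add: graph_connected_def)
    then obtain n0 where "?R n0 u v" unfolding reach_def by (metis rtranclp_imp_relpowp)
    then obtain n where n: "?R n u v" "\<And>n'. n' < n \<Longrightarrow> \<not> ?R n' u v" using exists_least_iff[of "\<lambda>n. ?R n u v"] by blast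
    obtain l where l: "n = Suc l" using n(1) uv(3) by (cases n) auto
    obtain z where z: "?R l u z" "adj V E z v" using n(1) l by auto
    have zE: "z \<in> V" "{z, v} \<in> E" using z by (auto simp: adj_def)
    obtain X where X: "X \<in> P" "{z, v} \<in> X" "?S z v = {X}" using S_edge[OF zE(1) uv(2) zE(2)] by blast
    \<comment> \<open>If the class of the last edge did not separate u and v, it would separate u
      and z, and folding the walk to z would reach \<open>r X z = v\<close> two steps earlier than
      the minimal length.\<close>
    have "X \<in> ?S u v"
    proof (rule ccontr)
      assume "X \<notin> ?S u v"
      then have "side X u \<noteq> side X z" using X cross[OF X(1) zE(1) uv(2) zE(2)] by (auto simp: sep_def)
      from foldR[OF X(1) z(1) this] obtain n' where "l = Suc n'" "?R n' u (r X z)" by blast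
      moreover have "r X z = v" using swap X by blast
      ultimately show False using n(2)[of n'] l by simp
    qed
    then show ?thesis using zE X by blast
  qed
  have E: "{u, v} \<in> E \<longleftrightarrow> card (?S u v) = 1" if uv: "u \<in> V" "v \<in> V" for u v
  proof
    assume "{u, v} \<in> E" then show "card (?S u v) = 1" using S_edge[OF uv] by force
  next
    assume "card (?S u v) = 1"
    then obtain X where X: "?S u v = {X}" by (metis card_1_singletonE)
    then have "u \<noteq> v" by auto
    from step[OF uv this] obtain z where z: "z \<in> V" "{z, v} \<in> E" "?S z v = {X}" using X by auto
    \<comment> \<open>The only class separating u from v is undone by the edge from z to v, so
      nothing separates u from z and they coincide.\<close>
    have "?S u z = {}" using X z(3) by (auto simp: sep_def)
    then have "u = z" using step[OF uv(1) z(1)] by blast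
    then show "{u, v} \<in> E" using z by simp
  qed
  have "finite E" 
  proof (rule finite_subset)
    show "E \<subseteq> Pow V" using simple by (auto simp: simple_graph_def)
  qed (use fin in simp)
  moreover have "P \<subseteq> Pow E" using XE by blast
  ultimately have finP: "finite P" by (meson finite_Pow_iff finite_subset)
  have "mirror_system V P side r"
  proof
    show "finite V" "finite P" by fact+
    show "V \<noteq> {}" using conn by (simp add: graph_connected_def)
    fix u v assume uv: "u \<in> V" "v \<in> V"
    show "\<exists>z\<in>V. \<exists>X\<in>?S u v. ?S z v = {X}" if "u \<noteq> v" using step[OF uv that] by blast
    show "r X u = v" if "?S u v = {X}" for X
    proof -
      have "{u, v} \<in> E" using E[OF uv] that by simp
      then show ?thesis using S_edge[OF uv] swap that by fastforce
    qed
    show "card (?S (r X u) (r X v)) = 1" if "X \<in> P" "card (?S u v) = 1" for X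
      using edge[OF that(1) uv] E[OF uv] E[of "r X u" "r X v"] rV[OF that(1)] uv that by blast
  qed (use perm rr flip in auto)
  moreover have "\<forall>u\<in>V. \<forall>v\<in>V. {u, v} \<in> E \<longleftrightarrow> card (?S u v) = 1" by (intro ballI E)
  ultimately show ?thesis by blast
qed

section \<open>From mirror systems to mirror graphs\<close>

context mirror_system
begin

text \<open>A geodesic crosses only classes that separate its ends, so it avoids all deleted edges.
  With F empty this gives connectedness, with F a single class the connectedness of its
  halves.\<close>

lemma same_half_reach:
  assumes E: "\<And>u v. u \<in> V \<Longrightarrow> v \<in> V \<Longrightarrow> {u, v} \<in> E \<longleftrightarrow> D u v = 1" and F: "F \<inter> S u v = {}"
    and uv: "u \<in> V" "v \<in> V"
    and X: "\<And>a b. a \<in> V \<Longrightarrow> b \<in> V \<Longrightarrow> {a, b} \<in> cl \<Longrightarrow> S a b \<subseteq> F"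
  shows "reach V (E - cl) u v"
  using uv(2) F
proof (induction "D u v" arbitrary: v rule: less_induct)
  case less
  show ?case
  proof (cases "u = v")
    case True then show ?thesis by (simp add: reach_refl)
  next
    case False
    from stepE[OF uv(1) less.prems(1) this] obtain z Z where z: "z \<in> V" "S z v = {Z}" "D u v = D u z + 1"
      "S u v = insert Z (S u z)" by metis
    have "reach V (E - cl) u z" using less.hyps[of z] z less.prems by auto
    moreover have "{z, v} \<in> E" using E[OF z(1) less.prems(1)] z(2) by simp
    moreover have "{z, v} \<notin> cl" using X[OF z(1) less.prems(1)] z less.prems(2) by auto
    ultimately have "adj V (E - cl) z v" using z less.prems by (simp add: adj_def)
    from adj_reach[OF this] show ?thesis using \<open>reach V (E - cl) u z\<close> by (rule reach_trans[rotated])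
  qed
qed

lemma mirror_graph:
  assumes simple: "simple_graph V E" and E: "\<And>u v. u \<in> V \<Longrightarrow> v \<in> V \<Longrightarrow> {u, v} \<in> E \<longleftrightarrow> D u v = 1"
  shows "mirror_graph V E"
proof -
  define cl where "cl X = {{u, v} | u v. u \<in> V \<and> v \<in> V \<and> S u v = {X}}" for X
  have clI: "{u, v} \<in> cl X \<longleftrightarrow> S u v = {X}" if "u \<in> V" "v \<in> V" for u v X
  proof
    assume "{u, v} \<in> cl X"
    then obtain a b where ab: "{u, v} = {a, b}" "S a b = {X}" unfolding cl_def by blast
    from ab(1) have "S u v = S a b" by (auto simp: doubleton_eq_iff sep_commute)
    then show "S u v = {X}" using ab by simp
  qed (use that in \<open>unfold cl_def, blast\<close>)
  have clV: "\<exists>u\<in>V. \<exists>v\<in>V. e = {u, v} \<and> S u v = {X}" if "e \<in> cl X" for e X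
    using that unfolding cl_def by blast
  have part: "edge_partition E (cl ` P)"
    unfolding edge_partition_def
  proof (intro conjI ballI impI)
    fix Z assume "Z \<in> cl ` P"
    then obtain X where X: "X \<in> P" "Z = cl X" by blast
    obtain v where v: "v \<in> V" using V_nonempty by blast
    \<comment> \<open>A vertex and its mirror image lie in different halves, so a geodesic between
      them contains an edge of X; this makes every class nonempty.\<close>
    have "X \<in> S v (r X v)" using r_flip[OF X(1) v] X by (auto simp: sep_def)
    moreover have "r X v \<in> V" using v X by simp
    ultimately obtain a b where "a \<in> V" "b \<in> V" "S a b = {X}" using class_edge[OF v] by blast
    then have "{a, b} \<in> cl X" using clI by blast
    then show "Z \<noteq> {}" using X by blast
  next
    fix Y Z assume YZ: "Y \<in> cl ` P" "Z \<in> cl ` P" "Y \<noteq> Z"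
    then obtain A B where AB: "Y = cl A" "Z = cl B" by blast
    show "Y \<inter> Z = {}"
    proof (rule ccontr)
      assume "Y \<inter> Z \<noteq> {}"
      then obtain e where e: "e \<in> cl A" "e \<in> cl B" using AB by blast
      then obtain u v where "u \<in> V" "v \<in> V" "e = {u, v}" using clV by blast
      then have "{A} = {B}" using e clI by metis
      then show False using YZ AB by simp
    qed
  next
    show "\<Union> (cl ` P) = E"
    proof
      show "\<Union> (cl ` P) \<subseteq> E" using E clV by fastforce
      show "E \<subseteq> \<Union> (cl ` P)"
      proof
        fix e assume e: "e \<in> E"
        then obtain u v where uv: "e = {u, v}" "u \<in> V" "v \<in> V" using simple by (auto simp: simple_graph_def)
        then obtain X where "S u v = {X}" "X \<in> P" using E e adj_class by metis
        then show "e \<in> \<Union> (cl ` P)" using clI uv by blast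
      qed
    qed
  qed
  have E_r: "{u, v} \<in> E \<longleftrightarrow> {r X u, r X v} \<in> E" if "X \<in> P" "u \<in> V" "v \<in> V" for X u v
    using E aut_adj[OF r_aut[OF that(1)] that(2,3)] that by simp
  have conn: "graph_connected V E"
    unfolding graph_connected_def
    using V_nonempty same_half_reach[OF E, where F = "{}" and cl = "{}"] by simp
  have "\<exists>\<alpha>. graph_aut \<alpha> V E \<and> (\<forall>u v. {u, v} \<in> Y \<longrightarrow> \<alpha> u = v \<and> \<alpha> v = u) \<and>
         (\<exists>C1 C2. C1 \<noteq> C2 \<and> components V (E - Y) = {C1, C2} \<and>
            graph_iso_map \<alpha> C1 (induced_edges (E - Y) C1) C2 (induced_edges (E - Y) C2))"
    if Ycl: "Y \<in> cl ` P" for Y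
  proof -
    obtain X where X: "X \<in> P" "Y = cl X" using Ycl by blast
    let ?C1 = "{v \<in> V. side X v}" and ?C2 = "{v \<in> V. \<not> side X v}"
    have flip: "side X (r X v) \<noteq> side X v" if "v \<in> V" for v using r_flip[OF X(1) that] .
    obtain v0 where v0: "v0 \<in> V" using V_nonempty by blast
    have ne: "?C1 \<noteq> {}" "?C2 \<noteq> {}"
      using v0 flip[OF v0] r_in[OF X(1), of v0] by (cases "side X v0"; blast)+
    have half: "reach V (E - Y) u v \<longleftrightarrow> side X u = side X v" if "u \<in> V" "v \<in> V" for u v
    proof
      assume "reach V (E - Y) u v"
      then show "side X u = side X v"
        unfolding reach_def
      proof (induction rule: rtranclp_induct)
        case (step y z)
        then have yz: "y \<in> V" "z \<in> V" "{y, z} \<in> E" "{y, z} \<notin> cl X" using X by (auto simp: adj_def)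
        then obtain Z where Z: "S y z = {Z}" using E adj_class by metis
        then have "Z \<noteq> X" using clI yz by blast
        then have "X \<notin> S y z" using Z by simp
        then show ?case using step X by (auto simp: sep_def)
      qed simp
    next
      assume "side X u = side X v"
      then have X0: "{X} \<inter> S u v = {}" by (auto simp: sep_def)
      show "reach V (E - Y) u v"
        by (rule same_half_reach[OF E X0 that]) (use clI X in auto)
    qed
    have comps: "components V (E - Y) = {?C1, ?C2}"
    proof -
      have "{v \<in> V. reach V (E - Y) u v} = (if side X u then ?C1 else ?C2)" if "u \<in> V" for u
        using half[OF that] by auto
      then have "components V (E - Y) = (\<lambda>u. if side X u then ?C1 else ?C2) ` V"
        unfolding components_def Setcompr_eq_image by (intro image_cong) simp_all
      also have "\<dots> = {?C1, ?C2}" using ne by auto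
      finally show ?thesis .
    qed
    have C12: "?C1 \<noteq> ?C2" using ne by blast
    have aut: "graph_aut (r X) V E"
      unfolding graph_aut_def graph_iso_map_def using permutes_imp_bij[OF r_permutes[OF X(1)]] E_r[OF X(1)] by blast
    have swap: "\<forall>u v. {u, v} \<in> Y \<longrightarrow> r X u = v \<and> r X v = u"
    proof (intro allI impI)
      fix u v assume uv: "{u, v} \<in> Y"
      then have V: "u \<in> V" "v \<in> V" using clV[of "{u, v}" X] X by (auto simp: doubleton_eq_iff)
      then have "S u v = {X}" using clI uv X by blast
      then show "r X u = v \<and> r X v = u" using r_swap V by (simp add: sep_commute)
    qed
    have iso: "graph_iso_map (r X) ?C1 (induced_edges (E - Y) ?C1) ?C2 (induced_edges (E - Y) ?C2)"
      unfolding graph_iso_map_def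
    proof (intro conjI ballI)
      show "bij_betw (r X) ?C1 ?C2"
        by (rule bij_betw_byWitness[where f' = "r X"]) (use flip r_r[OF X(1)] X in auto)
      fix u v assume uv: "u \<in> ?C1" "v \<in> ?C1"
      then have V: "u \<in> V" "v \<in> V" "r X u \<in> V" "r X v \<in> V" using X by auto
      have sr: "\<not> side X (r X u)" "\<not> side X (r X v)" using uv flip by auto
      have "{u, v} \<notin> cl X" "{r X u, r X v} \<notin> cl X" using clI V uv sr by (auto simp: sep_def)
      then show "{u, v} \<in> induced_edges (E - Y) ?C1 \<longleftrightarrow> {r X u, r X v} \<in> induced_edges (E - Y) ?C2"
        using E_r[OF X(1) V(1,2)] uv V sr X by (auto simp: induced_edges_def)
    qed
    show ?thesis
      by (rule exI[of _ "r X"], intro conjI, rule aut, rule swap,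
          rule exI[of _ ?C1], rule exI[of _ ?C2], intro conjI, rule C12, rule comps, rule iso)
  qed
  then show ?thesis unfolding mirror_graph_def
    by (intro conjI finite_V simple conn exI[of _ "cl ` P"] part) blast
qed

end

section \<open>Reflection arrangements\<close>

lemma dotn_commute: "dotn n x y = dotn n y x"
  by (simp add: dotn_def mult.commute)

lemma dotn_lin: "dotn n (\<lambda>i. a * x i + b * y i) v = a * dotn n x v + b * dotn n y v"
  by (simp add: dotn_def sum.distrib sum_distrib_left algebra_simps)

lemma dotn_lin_right: "dotn n v (\<lambda>i. a * x i + b * y i) = a * dotn n v x + b * dotn n v y"
  using dotn_lin[of n a x b y v] by (simp add: dotn_commute)

lemma Rn_lin: "x \<in> Rn n \<Longrightarrow> y \<in> Rn n \<Longrightarrow> (\<lambda>i. a * x i + b * y i) \<in> Rn n"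
  by (simp add: Rn_def)

lemma dotn_pos: assumes "v \<in> Rn n" "v \<noteq> (\<lambda>_. 0)" shows "dotn n v v > 0"
proof -
  obtain i where i: "v i \<noteq> 0" using assms(2) by auto
  then have "i < n" using assms(1) by (auto simp: Rn_def not_le[symmetric])
  then show ?thesis unfolding dotn_def using i
    by (intro sum_pos2[of _ i]) (auto simp: zero_less_mult_iff)
qed

lemma reflect_lin: "reflect n v x = (\<lambda>i. 1 * x i + (- 2 * (dotn n x v / dotn n v v)) * v i)"
  by (simp add: reflect_def)

lemma reflect_Rn: "v \<in> Rn n \<Longrightarrow> x \<in> Rn n \<Longrightarrow> reflect n v x \<in> Rn n"
  by (simp add: Rn_def reflect_def)

lemma dotn_reflect: "dotn n (reflect n v x) y = dotn n x y - 2 * (dotn n x v / dotn n v v) * dotn n v y"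
  unfolding reflect_lin dotn_lin by simp

lemma dotn_reflect_swap: "dotn n (reflect n v x) y = dotn n x (reflect n v y)"
  unfolding dotn_commute[of n x "reflect n v y"] dotn_reflect by (simp add: dotn_commute)

lemma reflect_reflect: assumes "dotn n v v \<noteq> 0" shows "reflect n v (reflect n v x) = x"
proof -
  have "dotn n (reflect n v x) v = - dotn n x v" using assms by (simp add: dotn_reflect)
  then show ?thesis unfolding reflect_def[of n v "reflect n v x"] by (simp add: reflect_def)
qed

lemma reflect_hyp: assumes "v \<in> Rn n" "dotn n v v \<noteq> 0"
  shows "reflect n v ` hyp n w = hyp n (reflect n v w)"
proof
  show "reflect n v ` hyp n w \<subseteq> hyp n (reflect n v w)"
    using assms by (auto simp: hyp_def reflect_Rn dotn_reflect_swap reflect_reflect)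
  show "hyp n (reflect n v w) \<subseteq> reflect n v ` hyp n w"
  proof
    fix y assume "y \<in> hyp n (reflect n v w)"
    then have "reflect n v y \<in> hyp n w" using assms by (auto simp: hyp_def reflect_Rn dotn_reflect_swap)
    then show "y \<in> reflect n v ` hyp n w" using reflect_reflect[OF assms(2)] by (metis image_eqI)
  qed
qed

lemma convex_pos: "0 \<le> s \<Longrightarrow> s \<le> 1 \<Longrightarrow> a > 0 \<Longrightarrow> b > 0 \<Longrightarrow> (1 - s) * a + s * b > (0::real)"
  by (cases "s = 0") (auto intro!: add_nonneg_pos)

lemma convex_neg: "0 \<le> s \<Longrightarrow> s \<le> 1 \<Longrightarrow> a < 0 \<Longrightarrow> b < 0 \<Longrightarrow> (1 - s) * a + s * b < (0::real)"
  using convex_pos[of s "- a" "- b"] unfolding mult_minus_right by linarith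

text \<open>The segment from x to y meets the hyperplane at parameter t. There both normals vanish,
  which forces opposite signs of w at the ends. No proportionality of the two normals has to be
  derived.\<close>

lemma hyp_sign:
  assumes "x \<in> Rn n" "y \<in> Rn n" "hyp n v = hyp n w" "dotn n x v > 0" "dotn n y v < 0" "dotn n y w \<noteq> 0"
  shows "dotn n x w * dotn n y w < 0"
proof -
  define t where "t = dotn n x v / (dotn n x v - dotn n y v)"
  have t: "0 < t" "t < 1" using assms by (auto simp: t_def field_simps)
  let ?z = "\<lambda>i. (1 - t) * x i + t * y i"
  have "dotn n ?z v = 0" using assms unfolding dotn_lin t_def by (simp add: field_simps)
  then have "?z \<in> hyp n w" using Rn_lin[OF assms(1,2)] assms(3) by (auto simp: hyp_def)
  then have "(1 - t) * dotn n x w + t * dotn n y w = 0" by (simp add: hyp_def dotn_lin)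
  then have "(1 - t) * dotn n x w = - (t * dotn n y w)" by simp
  then have "(1 - t) * dotn n x w * dotn n y w = - t * (dotn n y w * dotn n y w)" by simp
  also have "\<dots> < 0" using t assms(6) by (simp add: mult_pos_neg zero_less_mult_iff) (metis linorder_neqE)
  finally have "(1 - t) * (dotn n x w * dotn n y w) < 0" by (simp add: mult.assoc)
  then show ?thesis using t by (simp add: mult_less_0_iff)
qed

lemma ex_nonorthogonal:
  assumes "finite F" "\<And>f. f \<in> F \<Longrightarrow> f \<in> Rn n \<and> f \<noteq> (\<lambda>_. 0)"
  shows "\<exists>u\<in>Rn n. \<forall>f\<in>F. dotn n u f \<noteq> 0"
  using assms
proof (induction rule: finite_induct)
  case empty
  have "(\<lambda>_. 0) \<in> Rn n" by (simp add: Rn_def)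
  then show ?case by blast
next
  case (insert w F)
  then obtain u where u: "u \<in> Rn n" "\<And>f. f \<in> F \<Longrightarrow> dotn n u f \<noteq> 0" by auto
  have w: "w \<in> Rn n" "dotn n w w > 0" using insert.prems dotn_pos by auto
  \<comment> \<open>The values of \<epsilon> at which some inner product with the perturbed vector
    vanishes. If w and f are orthogonal, division by zero merely excludes the value 0 as
    well.\<close>
  let ?B = "insert (- dotn n u w / dotn n w w) ((\<lambda>f. - dotn n u f / dotn n w f) ` F)"
  have "finite ?B" using insert by simp
  then obtain \<epsilon> :: real where \<epsilon>: "\<epsilon> \<notin> ?B" using ex_new_if_finite infinite_UNIV_char_0 by blast
  let ?u = "\<lambda>i. 1 * u i + \<epsilon> * w i"
  have "dotn n ?u f \<noteq> 0" if "f \<in> insert w F" for f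
  proof
    assume 0: "dotn n ?u f = 0"
    then have e: "dotn n u f + \<epsilon> * dotn n w f = 0" unfolding dotn_lin by simp
    have "dotn n w f \<noteq> 0" using e that u w by auto
    then have "\<epsilon> = - dotn n u f / dotn n w f" using e by (simp add: field_simps)
    then show False using \<epsilon> that by auto
  qed
  moreover have "?u \<in> Rn n" using Rn_lin[OF u(1) w(1)] .
  ultimately show ?case by blast
qed

text \<open>A small move of b in a direction orthogonal to none of the f keeps all strict signs and
  turns every zero into a nonzero value.\<close>

lemma ex_generic:
  assumes F: "finite F" "\<And>f. f \<in> F \<Longrightarrow> f \<in> Rn n \<and> f \<noteq> (\<lambda>_. 0)" and b: "b \<in> Rn n"
  shows "\<exists>b'\<in>Rn n. \<forall>f\<in>F. dotn n b' f \<noteq> 0 \<and> (dotn n b f > 0 \<longrightarrow> dotn n b' f > 0) \<and> (dotn n b f < 0 \<longrightarrow> dotn n b' f < 0)"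
proof -
  obtain u where u: "u \<in> Rn n" "\<And>f. f \<in> F \<Longrightarrow> dotn n u f \<noteq> 0" using ex_nonorthogonal[OF F] by blast
  define bb where "bb \<epsilon> = (\<lambda>i. 1 * b i + \<epsilon> * u i)" for \<epsilon>
  have db: "dotn n (bb \<epsilon>) f = dotn n b f + \<epsilon> * dotn n u f" for \<epsilon> f unfolding bb_def dotn_lin by simp
  let ?Q = "\<lambda>f \<epsilon>. dotn n (bb \<epsilon>) f \<noteq> 0 \<and> (dotn n b f > 0 \<longrightarrow> dotn n (bb \<epsilon>) f > 0) \<and> (dotn n b f < 0 \<longrightarrow> dotn n (bb \<epsilon>) f < 0)"
  have "\<forall>\<^sub>F \<epsilon> in at_right 0. ?Q f \<epsilon>" if "f \<in> F" for f
  proof -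
    have lim: "((\<lambda>\<epsilon>. dotn n b f + \<epsilon> * dotn n u f) \<longlongrightarrow> dotn n b f + 0 * dotn n u f) (at_right 0)"
      by (intro tendsto_intros)
    have pos: "\<forall>\<^sub>F \<epsilon> in at_right (0::real). \<epsilon> > 0" by (rule eventually_at_right_less)
    consider "dotn n b f > 0" | "dotn n b f < 0" | "dotn n b f = 0" by linarith
    then show ?thesis
    proof cases
      case 1
      then have "\<forall>\<^sub>F \<epsilon> in at_right 0. 0 < dotn n b f + \<epsilon> * dotn n u f"
        using order_tendstoD(1)[OF lim, of 0] by simp
      then show ?thesis by eventually_elim (use 1 in \<open>simp add: db\<close>)
    next
      case 2
      then have "\<forall>\<^sub>F \<epsilon> in at_right 0. dotn n b f + \<epsilon> * dotn n u f < 0"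
        using order_tendstoD(2)[OF lim, of 0] by simp
      then show ?thesis by eventually_elim (use 2 in \<open>simp add: db\<close>)
    next
      case 3
      from pos show ?thesis by eventually_elim (use 3 u(2)[OF that] in \<open>simp add: db\<close>)
    qed
  qed
  then have "\<forall>\<^sub>F \<epsilon> in at_right 0. \<forall>f\<in>F. ?Q f \<epsilon>" by (intro eventually_ball_finite F ballI)
  then obtain \<epsilon> where "\<forall>f\<in>F. ?Q f \<epsilon>" using eventually_happens[of _ "at_right (0::real)"] by fastforce
  moreover have "bb \<epsilon> \<in> Rn n" unfolding bb_def using Rn_lin[OF b u(1)] .
  ultimately show ?thesis by blast
qed

section \<open>Chambers and sign vectors of an arrangement\<close>

locale arrangement =
  fixes n :: nat and \<H> :: "(nat \<Rightarrow> real) set set" and \<nu> :: "(nat \<Rightarrow> real) set \<Rightarrow> nat \<Rightarrow> real"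
  assumes finite_H: "finite \<H>"
    and normal: "H \<in> \<H> \<Longrightarrow> \<nu> H \<in> Rn n" "H \<in> \<H> \<Longrightarrow> \<nu> H \<noteq> (\<lambda>_. 0)" "H \<in> \<H> \<Longrightarrow> hyp n (\<nu> H) = H"
begin

abbreviation reg :: "(nat \<Rightarrow> real) set" where "reg \<equiv> Rn n - \<Union>\<H>"
abbreviation ch :: "(nat \<Rightarrow> real) \<Rightarrow> (nat \<Rightarrow> real) set" where "ch \<equiv> connected_component_set reg"
abbreviation dot where "dot \<equiv> dotn n"

definition side :: "(nat \<Rightarrow> real) set \<Rightarrow> (nat \<Rightarrow> real) \<Rightarrow> bool" where "side H x \<longleftrightarrow> dot x (\<nu> H) > 0"

abbreviation S where "S \<equiv> sep \<H> side"

lemma mem_H_iff: "H \<in> \<H> \<Longrightarrow> x \<in> Rn n \<Longrightarrow> x \<in> H \<longleftrightarrow> dot x (\<nu> H) = 0"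
  using normal(3)[of H] by (auto simp: hyp_def)

lemma reg_iff: "x \<in> reg \<longleftrightarrow> x \<in> Rn n \<and> (\<forall>H\<in>\<H>. dot x (\<nu> H) \<noteq> 0)"
  using mem_H_iff by auto

lemma reg_Rn: "x \<in> reg \<Longrightarrow> x \<in> Rn n" by simp

lemma side_neg: "x \<in> reg \<Longrightarrow> H \<in> \<H> \<Longrightarrow> \<not> side H x \<longleftrightarrow> dot x (\<nu> H) < 0"
  using reg_iff[of x] by (auto simp: side_def not_less less_le)

lemma same_side: assumes "x \<in> reg" "y \<in> reg" "S x y = {}" "H \<in> \<H>" shows "side H x \<longleftrightarrow> side H y"
  using assms by (auto simp: sep_def)

lemma S_trans: "S x y = {} \<Longrightarrow> S x z = S y z" by (auto simp: sep_def)

text \<open>A linear form without zeros on a connected set keeps its sign there, which gives one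
  inclusion. For the other, the segment between two points with equal signs avoids all
  hyperplanes.\<close>

lemma ch_eq: assumes x: "x \<in> reg" shows "ch x = {y \<in> reg. S x y = {}}"
proof (intro equalityI subsetI)
  fix y assume "y \<in> ch x"
  then obtain t where t: "connected t" "t \<subseteq> reg" "x \<in> t" "y \<in> t" by (auto simp: connected_component_def)
  have "side H x = side H y" if H: "H \<in> \<H>" for H
  proof -
    have "continuous_on t (\<lambda>z. dot z (\<nu> H))"
      unfolding dotn_def
      by (intro continuous_intros continuous_on_subset[OF continuous_on_product_coordinates]) auto
    from connected_continuous_image[OF this t(1)] have con: "connected ((\<lambda>z. dot z (\<nu> H)) ` t)" .
    have "dot z (\<nu> H) \<noteq> 0" if "z \<in> t" for z using that t(2) reg_iff[of z] H by blast
    then have "0 \<notin> (\<lambda>z. dot z (\<nu> H)) ` t" by (metis imageE)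
    then have "\<not> (dot a (\<nu> H) \<le> 0 \<and> 0 \<le> dot b (\<nu> H))" if "a \<in> t" "b \<in> t" for a b
      using connectedD_interval[OF con, of "dot a (\<nu> H)" "dot b (\<nu> H)" 0] that by blast
    from this[of x y] this[of y x] show ?thesis using t unfolding side_def by linarith
  qed
  then show "y \<in> {y \<in> reg. S x y = {}}" using t by (auto simp: sep_def)
next
  fix y assume "y \<in> {y \<in> reg. S x y = {}}"
  then have y: "y \<in> reg" "S x y = {}" by auto
  define l where "l s = (\<lambda>i. (1 - s) * x i + s * y i)" for s :: real
  have "connected (l ` {0..1})"
  proof (rule connected_continuous_image)
    show "continuous_on {0..1} l"
      unfolding l_def by (intro continuous_on_coordinatewise_then_product continuous_intros)
  qed simp
  moreover have "l ` {0..1} \<subseteq> reg"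
  proof
    fix z assume "z \<in> l ` {0..1}"
    then obtain s where s: "0 \<le> s" "s \<le> 1" "z = l s" by auto
    have "dot z (\<nu> H) \<noteq> 0" if H: "H \<in> \<H>" for H
    proof -
      have d: "dot z (\<nu> H) = (1 - s) * dot x (\<nu> H) + s * dot y (\<nu> H)" unfolding s l_def dotn_lin ..
      show ?thesis
      proof (cases "side H x")
        case True
        then have "dot x (\<nu> H) > 0" "dot y (\<nu> H) > 0" using same_side[OF x y H] by (auto simp: side_def)
        then have "dot z (\<nu> H) > 0" unfolding d using s convex_pos by blast
        then show ?thesis by simp
      next
        case False
        then have "dot x (\<nu> H) < 0" "dot y (\<nu> H) < 0" using same_side[OF x y H] side_neg H x y by blast+
        then have "dot z (\<nu> H) < 0" unfolding d using s convex_neg by blast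
        then show ?thesis by simp
      qed
    qed
    moreover have "z \<in> Rn n" using Rn_lin x y s by (auto simp: l_def)
    ultimately show "z \<in> reg" using reg_iff by blast
  qed
  moreover have "x = l 0" "y = l 1" by (auto simp: l_def)
  ultimately show "y \<in> ch x" by (auto simp: connected_component_def intro!: exI[of _ "l ` {0..1}"])
qed

lemma ch_eq_iff: assumes "x \<in> reg" "y \<in> reg" shows "ch x = ch y \<longleftrightarrow> S x y = {}"
proof
  assume "ch x = ch y"
  moreover have "y \<in> ch y" using ch_eq[OF assms(2)] assms(2) by simp
  ultimately show "S x y = {}" using ch_eq[OF assms(1)] by auto
next
  assume "S x y = {}"
  then have "S x z = S y z" for z by (rule S_trans)
  then show "ch x = ch y" using ch_eq assms by simp
qed

lemma chambers_eq: "chambers n \<H> = ch ` reg"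
  by (auto simp: chambers_def)

text \<open>Frees separation from the chosen normals. This is needed because the reflection of a
  chosen normal is a normal of the reflected hyperplane, but not necessarily the chosen one.\<close>

lemma side_any:
  assumes K: "K \<in> \<H>" "hyp n w = K" and x: "x \<in> reg" and y: "y \<in> reg"
  shows "K \<in> S x y \<longleftrightarrow> (dot x w > 0) \<noteq> (dot y w > 0)"
proof -
  have w: "dot z w \<noteq> 0" if "z \<in> reg" for z
  proof -
    have "z \<notin> hyp n w" using that K by blast
    then show ?thesis using that by (simp add: hyp_def)
  qed
  have nz: "dot z (\<nu> K) \<noteq> 0" if "z \<in> reg" for z using that reg_iff K by blast
  have hyps: "hyp n w = hyp n (\<nu> K)" using K normal(3) by simp
  have A: "dot a (\<nu> K) * dot b (\<nu> K) < 0" if "a \<in> reg" "b \<in> reg" "dot a w > 0" "dot b w < 0" for a b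
    by (rule hyp_sign[OF _ _ hyps]) (use that nz in auto)
  have B: "dot a w * dot b w < 0" if "a \<in> reg" "b \<in> reg" "dot a (\<nu> K) > 0" "dot b (\<nu> K) < 0" for a b
    by (rule hyp_sign[OF _ _ hyps[symmetric]]) (use that w in auto)
  have "K \<in> S x y \<longleftrightarrow> dot x (\<nu> K) * dot y (\<nu> K) < 0"
    using K nz[OF x] nz[OF y] by (auto simp: sep_def side_def mult_less_0_iff)
  also have "\<dots> \<longleftrightarrow> dot x w * dot y w < 0"
    using A[OF x y] A[OF y x] B[OF x y] B[OF y x] by (auto simp: mult_less_0_iff)
  also have "\<dots> \<longleftrightarrow> (dot x w > 0) \<noteq> (dot y w > 0)"
    using w[OF x] w[OF y] by (auto simp: mult_less_0_iff)
  finally show ?thesis .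
qed

lemma separates_iff: assumes H: "H \<in> \<H>" and x: "x \<in> reg" and y: "y \<in> reg"
  shows "separates n H (ch x) (ch y) \<or> separates n H (ch y) (ch x) \<longleftrightarrow> H \<in> S x y"
proof -
  have fwd: "H \<in> S a b" if ab: "a \<in> reg" "b \<in> reg" "separates n H (ch a) (ch b)" for a b
  proof -
    obtain v where v: "H = hyp n v" "\<forall>z\<in>ch a. dot z v > 0" "\<forall>z\<in>ch b. dot z v < 0"
      using ab(3) by (auto simp: separates_def)
    have "a \<in> ch a" "b \<in> ch b" using ch_eq ab by auto
    then have "dot a v > 0" "dot b v < 0" using v by blast+
    then show ?thesis using side_any[OF H v(1)[symmetric] ab(1,2)] by auto
  qed
  have bwd: "separates n H (ch a) (ch b)" if ab: "a \<in> reg" "b \<in> reg" "side H a" "\<not> side H b" for a b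
  proof -
    have "dot z (\<nu> H) > 0" if "z \<in> ch a" for z
    proof -
      have "z \<in> reg" "S a z = {}" using that unfolding ch_eq[OF ab(1)] by auto
      then show ?thesis using same_side[OF ab(1), of z H] H ab by (auto simp: side_def)
    qed
    moreover have "dot z (\<nu> H) < 0" if "z \<in> ch b" for z
    proof -
      have "z \<in> reg" "S b z = {}" using that unfolding ch_eq[OF ab(2)] by auto
      then show ?thesis using same_side[OF ab(2), of z H] H ab side_neg by blast
    qed
    ultimately show ?thesis unfolding separates_def using normal H by metis
  qed
  show ?thesis
  proof
    assume "separates n H (ch x) (ch y) \<or> separates n H (ch y) (ch x)"
    then show "H \<in> S x y" using fwd x y sep_commute by metis
  next
    assume "H \<in> S x y"
    then have "side H x \<and> \<not> side H y \<or> side H y \<and> \<not> side H x" by (auto simp: sep_def)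
    then show "separates n H (ch x) (ch y) \<or> separates n H (ch y) (ch x)" using bwd x y by blast
  qed
qed

lemma tope_edge_iff: assumes x: "x \<in> reg" and y: "y \<in> reg"
  shows "{ch x, ch y} \<in> tope_edges n \<H> \<longleftrightarrow> card (S x y) = 1"
proof -
  have eq: "{H \<in> \<H>. separates n H (ch a) (ch b) \<or> separates n H (ch b) (ch a)} = S a b"
    if "a \<in> reg" "b \<in> reg" for a b
    using separates_iff that by (auto simp: sep_def)
  show ?thesis
  proof
    assume "{ch x, ch y} \<in> tope_edges n \<H>"
    then obtain C D where CD: "{ch x, ch y} = {C, D}"
      "card {H \<in> \<H>. separates n H C D \<or> separates n H D C} = 1" by (auto simp: tope_edges_def)
    then consider "C = ch x" "D = ch y" | "C = ch y" "D = ch x" by (auto simp: doubleton_eq_iff)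
    then show "card (S x y) = 1" using CD(2) eq[OF x y] eq[OF y x] by cases (auto simp: sep_commute)
  next
    assume "card (S x y) = 1"
    then have "card {H \<in> \<H>. separates n H (ch x) (ch y) \<or> separates n H (ch y) (ch x)} = 1"
      using eq[OF x y] by simp
    moreover have "ch x \<in> chambers n \<H>" "ch y \<in> chambers n \<H>" using chambers_eq x y by auto
    ultimately show "{ch x, ch y} \<in> tope_edges n \<H>" unfolding tope_edges_def by blast
  qed
qed

lemma ex_reg: "\<exists>x. x \<in> reg"
proof -
  have 0: "(\<lambda>_. 0) \<in> Rn n" by (simp add: Rn_def)
  have "\<exists>b'\<in>Rn n. \<forall>f\<in>\<nu> ` \<H>. dot b' f \<noteq> 0 \<and> (dot (\<lambda>_. 0) f > 0 \<longrightarrow> dot b' f > 0) \<and> (dot (\<lambda>_. 0) f < 0 \<longrightarrow> dot b' f < 0)"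
    by (rule ex_generic[OF _ _ 0]) (use finite_H normal in auto)
  then show ?thesis using reg_iff by blast
qed

text \<open>A segment towards a generic point of the target chamber crosses the hyperplanes one at a time.\<close>

lemma chamber_step:
  assumes a: "a \<in> reg" and b: "b \<in> reg" and ne: "S a b \<noteq> {}"
  shows "\<exists>z\<in>reg. \<exists>H\<in>S a b. S a z = {H}"
proof -
  \<comment> \<open>A vector orthogonal to c exactly when \<open>dot a (\<nu> H) * dot c (\<nu> K) =
    dot a (\<nu> K) * dot c (\<nu> H)\<close>, which holds if the segment from a to c meets H and K
    at the same parameter. Genericity of c against these vectors separates the crossings.\<close>
  let ?w = "\<lambda>(H, K) i. dot a (\<nu> H) * \<nu> K i + (- dot a (\<nu> K)) * \<nu> H i"
  let ?F = "\<nu> ` \<H> \<union> ?w ` {(H, K). H \<in> \<H> \<and> K \<in> \<H> \<and> H \<noteq> K}"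
  have anz: "dot a (\<nu> H) \<noteq> 0" if "H \<in> \<H>" for H using a reg_iff that by blast
  have w: "?w (H, K) \<in> Rn n \<and> ?w (H, K) \<noteq> (\<lambda>_. 0)" if "H \<in> \<H>" "K \<in> \<H>" "H \<noteq> K" for H K
  proof (intro conjI notI)
    show "?w (H, K) \<in> Rn n" unfolding prod.case by (rule Rn_lin) (use normal that in auto)
    assume 0: "?w (H, K) = (\<lambda>_. 0)"
    have e: "dot a (\<nu> H) * dot x (\<nu> K) = dot a (\<nu> K) * dot x (\<nu> H)" for x
    proof -
      have "dot x (?w (H, K)) = 0" unfolding 0 by (simp add: dotn_def)
      then show ?thesis unfolding prod.case dotn_lin_right by simp
    qed
    have "dot x (\<nu> K) = 0 \<longleftrightarrow> dot x (\<nu> H) = 0" for x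
      using e[of x] anz[OF that(1)] anz[OF that(2)] by auto
    then have "hyp n (\<nu> H) = hyp n (\<nu> K)" by (simp add: hyp_def)
    then show False using normal(3) that by simp
  qed
  have "finite {(H, K). H \<in> \<H> \<and> K \<in> \<H> \<and> H \<noteq> K}"
    by (rule finite_subset[of _ "\<H> \<times> \<H>"]) (use finite_H in auto)
  then have finF: "finite ?F" using finite_H by simp
  have F: "f \<in> Rn n \<and> f \<noteq> (\<lambda>_. 0)" if "f \<in> ?F" for f
    using that
  proof
    assume "f \<in> \<nu> ` \<H>" then show ?thesis using normal by auto
  next
    assume "f \<in> ?w ` {(H, K). H \<in> \<H> \<and> K \<in> \<H> \<and> H \<noteq> K}"
    then obtain H K where HK: "H \<in> \<H>" "K \<in> \<H>" "H \<noteq> K" and f: "f = ?w (H, K)" by blast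
    show ?thesis unfolding f by (rule w[OF HK])
  qed
  from ex_generic[OF finF F reg_Rn[OF b]] obtain c where c: "c \<in> Rn n"
    and c': "\<forall>f\<in>?F. dot c f \<noteq> 0 \<and> (dot b f > 0 \<longrightarrow> dot c f > 0) \<and> (dot b f < 0 \<longrightarrow> dot c f < 0)"
    by (rule bexE)
  have cH: "dot c (\<nu> H) \<noteq> 0" "dot c (\<nu> H) > 0 \<longleftrightarrow> dot b (\<nu> H) > 0" if "H \<in> \<H>" for H
  proof -
    have "dot b (\<nu> H) \<noteq> 0" using b reg_iff that by blast
    moreover have "\<nu> H \<in> ?F" using that by blast
    ultimately show "dot c (\<nu> H) \<noteq> 0" "dot c (\<nu> H) > 0 \<longleftrightarrow> dot b (\<nu> H) > 0"
      using bspec[OF c', of "\<nu> H"] by linarith+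
  qed
  have Sc: "S a c = S a b" using cH by (auto simp: sep_def side_def)
  \<comment> \<open>The parameter at which the segment from a to c meets H.\<close>
  define T where "T H = dot a (\<nu> H) / (dot a (\<nu> H) - dot c (\<nu> H))" for H
  have opp: "dot a (\<nu> H) > 0 \<and> dot c (\<nu> H) < 0 \<or> dot a (\<nu> H) < 0 \<and> dot c (\<nu> H) > 0" if "H \<in> S a b" for H
  proof -
    have "H \<in> S a c" using that Sc by simp
    then have "H \<in> \<H>" "(dot a (\<nu> H) > 0) \<noteq> (dot c (\<nu> H) > 0)"
      by (simp_all add: sep_def side_def)
    then show ?thesis using anz[of H] cH(1)[of H] by linarith
  qed
  have T01: "0 < T H" "T H < 1" if "H \<in> S a b" for H
    using opp[OF that] by (auto simp: T_def field_simps)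
  have Tinj: "T H \<noteq> T K" if HK: "H \<in> S a b" "K \<in> S a b" "H \<noteq> K" for H K
  proof
    assume "T H = T K"
    moreover have "dot a (\<nu> H) - dot c (\<nu> H) \<noteq> 0" "dot a (\<nu> K) - dot c (\<nu> K) \<noteq> 0" using opp HK by force+
    ultimately have "dot a (\<nu> H) * dot c (\<nu> K) = dot a (\<nu> K) * dot c (\<nu> H)"
      by (simp add: T_def frac_eq_eq algebra_simps)
    then have "dot c (?w (H, K)) = 0" unfolding prod.case dotn_lin_right by simp
    moreover have "H \<in> \<H>" "K \<in> \<H>" using HK by (auto simp: sep_def)
    then have "?w (H, K) \<in> ?F" using HK by blast
    ultimately show False using bspec[OF c', of "?w (H, K)"] by blast
  qed
  have finS: "finite (S a b)" using finite_H by (simp add: sep_def)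
  have "Min (T ` S a b) \<in> T ` S a b" using finS ne by simp
  then obtain H0 where H0: "H0 \<in> S a b" "Min (T ` S a b) = T H0" by (metis imageE)
  have H0min: "T H0 \<le> T K" if "K \<in> S a b" for K using H0(2) finS that Min_le[of "T ` S a b" "T K"] by simp
  \<comment> \<open>Inserting 1 keeps the set nonempty if \<open>H0\<close> is the only crossing,
    and keeps t below 1.\<close>
  let ?M = "insert 1 (T ` (S a b - {H0}))"
  have finM: "finite ?M" using finS by simp
  have "T H0 < T K" if "K \<in> S a b - {H0}" for K
    using H0min[of K] Tinj[OF H0(1), of K] that by force
  then have gt: "T H0 < Min ?M"
    using T01(2)[OF H0(1)] by (subst Min_gr_iff[OF finM]) auto
  define t where "t = (T H0 + Min ?M) / 2"
  have t: "T H0 < t" "t < Min ?M" using gt by (auto simp: t_def)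
  have tK: "t < T K" if "K \<in> S a b" "K \<noteq> H0" for K
    using t(2) Min_le[OF finM, of "T K"] that by simp
  have t01: "0 < t" "t < 1" using t T01(1)[OF H0(1)] Min_le[OF finM, of 1] by auto
  let ?z = "\<lambda>i. (1 - t) * a i + t * c i"
  have dz: "dot ?z (\<nu> H) = (1 - t) * dot a (\<nu> H) + t * dot c (\<nu> H)" for H by (rule dotn_lin)
  have dzS: "dot ?z (\<nu> H) = (dot a (\<nu> H) - dot c (\<nu> H)) * (T H - t)" if "H \<in> S a b" for H
  proof -
    have "dot a (\<nu> H) - dot c (\<nu> H) \<noteq> 0" using opp[OF that] by force
    then have "(dot a (\<nu> H) - dot c (\<nu> H)) * T H = dot a (\<nu> H)" by (simp add: T_def)
    then show ?thesis unfolding dz by (simp add: algebra_simps)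
  qed
  have sgn: "dot ?z (\<nu> H) \<noteq> 0 \<and> ((dot ?z (\<nu> H) > 0 \<longleftrightarrow> dot a (\<nu> H) > 0) \<longleftrightarrow> H \<noteq> H0)" if H: "H \<in> \<H>" for H
  proof (cases "H \<in> S a b")
    case True
    have "T H - t > 0 \<longleftrightarrow> H \<noteq> H0" "T H - t \<noteq> 0" using tK[OF True] t(1) by force+
    then show ?thesis unfolding dzS[OF True] using opp[OF True] by (auto simp: zero_less_mult_iff)
  next
    case False
    then have "H \<notin> S a c" "H \<noteq> H0" using Sc H0 by auto
    then have same: "dot a (\<nu> H) > 0 \<longleftrightarrow> dot c (\<nu> H) > 0" using H by (auto simp: sep_def side_def)
    show ?thesis
    proof (cases "dot a (\<nu> H) > 0")
      case True
      then have "dot ?z (\<nu> H) > 0" unfolding dz using same t01 by (intro convex_pos) auto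
      then show ?thesis using True \<open>H \<noteq> H0\<close> by simp
    next
      case ag: False
      then have "dot a (\<nu> H) < 0" "dot c (\<nu> H) < 0" using same anz[OF H] cH(1)[OF H] by linarith+
      then have "dot ?z (\<nu> H) < 0" unfolding dz using t01 by (intro convex_neg) auto
      then show ?thesis using ag \<open>H \<noteq> H0\<close> by simp
    qed
  qed
  have "?z \<in> reg" unfolding reg_iff using sgn Rn_lin[OF reg_Rn[OF a] c] by blast
  moreover have "S a ?z = {H0}" using sgn H0(1) unfolding sep_def side_def by blast
  ultimately show ?thesis using H0(1) by blast
qed

end

section \<open>Reflections acting on chambers\<close>

locale reflections = arrangement +
  assumes closed: "H \<in> \<H> \<Longrightarrow> K \<in> \<H> \<Longrightarrow> reflect n (\<nu> H) ` K \<in> \<H>"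
begin

abbreviation \<rho> where "\<rho> H \<equiv> reflect n (\<nu> H)"

lemma nu_pos: "H \<in> \<H> \<Longrightarrow> dot (\<nu> H) (\<nu> H) > 0" using dotn_pos normal by blast

lemma rho_rho: "H \<in> \<H> \<Longrightarrow> \<rho> H (\<rho> H x) = x"
  using reflect_reflect nu_pos by (metis less_irrefl)

lemma rho_hyp: assumes "H \<in> \<H>" "K \<in> \<H>" shows "hyp n (\<rho> H (\<nu> K)) = \<rho> H ` K"
  using reflect_hyp[OF normal(1)[OF assms(1)], of "\<nu> K"] nu_pos[OF assms(1)] normal(3)[OF assms(2)] by simp

lemma rho_reg: assumes H: "H \<in> \<H>" and x: "x \<in> reg" shows "\<rho> H x \<in> reg"
proof -
  have "dot (\<rho> H x) (\<nu> K) \<noteq> 0" if K: "K \<in> \<H>" for K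
  proof
    assume "dot (\<rho> H x) (\<nu> K) = 0"
    then have "x \<in> hyp n (\<rho> H (\<nu> K))" using x by (simp add: hyp_def dotn_reflect_swap)
    then show False using rho_hyp[OF H K] closed[OF H K] x by blast
  qed
  then show ?thesis unfolding reg_iff using reflect_Rn normal H x by blast
qed

lemma rho_image2: "H \<in> \<H> \<Longrightarrow> \<rho> H ` \<rho> H ` K = K"
  by (simp add: image_image rho_rho)

lemma S_rho: assumes H: "H \<in> \<H>" and K: "K \<in> \<H>" and x: "x \<in> reg" and y: "y \<in> reg"
  shows "K \<in> S (\<rho> H x) (\<rho> H y) \<longleftrightarrow> \<rho> H ` K \<in> S x y"
  using side_any[OF K normal(3)[OF K] rho_reg[OF H x] rho_reg[OF H y]]
    side_any[OF closed[OF H K] rho_hyp[OF H K] x y] by (simp add: dotn_reflect_swap)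

lemma card_S_rho: assumes H: "H \<in> \<H>" and x: "x \<in> reg" and y: "y \<in> reg"
  shows "card (S (\<rho> H x) (\<rho> H y)) = card (S x y)"
proof -
  have "bij_betw (image (\<rho> H)) (S (\<rho> H x) (\<rho> H y)) (S x y)"
  proof (rule bij_betw_byWitness[where f' = "image (\<rho> H)"])
    have sub: "K \<in> S a b \<Longrightarrow> K \<in> \<H>" for K a b by (simp add: sep_def)
    show "image (\<rho> H) ` S (\<rho> H x) (\<rho> H y) \<subseteq> S x y" using S_rho[OF H _ x y] sub by blast
    show "image (\<rho> H) ` S x y \<subseteq> S (\<rho> H x) (\<rho> H y)"
    proof
      fix L assume "L \<in> image (\<rho> H) ` S x y"
      then obtain K where K: "K \<in> S x y" "L = \<rho> H ` K" by blast
      then have "L \<in> \<H>" using closed[OF H] sub by blast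
      then show "L \<in> S (\<rho> H x) (\<rho> H y)" using S_rho[OF H _ x y] K rho_image2[OF H] by simp
    qed
  qed (use rho_image2[OF H] in auto)
  then show ?thesis by (rule bij_betw_same_card)
qed

lemma finite_S: "finite (S x y)" using finite_H by (simp add: sep_def)

lemma S_rho_empty: assumes "H \<in> \<H>" "x \<in> reg" "y \<in> reg" "S x y = {}" shows "S (\<rho> H x) (\<rho> H y) = {}"
  using card_S_rho[OF assms(1-3)] assms(4) finite_S by (metis card.empty card_0_eq)

lemma rho_flip: assumes "H \<in> \<H>" "x \<in> reg" shows "side H (\<rho> H x) \<noteq> side H x"
proof -
  have "dot (\<rho> H x) (\<nu> H) = - dot x (\<nu> H)" using nu_pos[OF assms(1)] by (simp add: dotn_reflect)
  moreover have "dot x (\<nu> H) \<noteq> 0" using assms reg_iff by blast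
  ultimately show ?thesis by (auto simp: side_def)
qed

text \<open>If \<open>H\<close> is the only separating hyperplane, the point where the segment meets \<open>H\<close> is fixed
  by the reflection and lies strictly on the common side of all other hyperplanes.\<close>

lemma rho_swap: assumes x: "x \<in> reg" and y: "y \<in> reg" and S: "S x y = {H}" shows "S (\<rho> H x) y = {}"
proof -
  have H: "H \<in> \<H>" using S by (auto simp: sep_def)
  have opp: "dot x (\<nu> H) > 0 \<and> dot y (\<nu> H) < 0 \<or> dot x (\<nu> H) < 0 \<and> dot y (\<nu> H) > 0"
  proof -
    have "H \<in> S x y" using S by simp
    moreover have "dot x (\<nu> H) \<noteq> 0" "dot y (\<nu> H) \<noteq> 0" using x y H reg_iff by blast+
    ultimately show ?thesis unfolding sep_def side_def by auto
  qed
  define t where "t = dot x (\<nu> H) / (dot x (\<nu> H) - dot y (\<nu> H))"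
  have t: "0 < t" "t < 1" using opp by (auto simp: t_def field_simps)
  define p where "p = (\<lambda>i. (1 - t) * x i + t * y i)"
  have dp: "dot p w = (1 - t) * dot x w + t * dot y w" for w unfolding p_def by (rule dotn_lin)
  have "dot x (\<nu> H) - dot y (\<nu> H) \<noteq> 0" using opp by force
  then have "dot p (\<nu> H) = 0" unfolding dp t_def by (simp add: field_simps)
  then have fixp: "\<rho> H p = p" by (simp add: reflect_def)
  have conv: "dot p w > 0 \<longleftrightarrow> dot y w > 0" if K: "K \<in> \<H>" "K \<noteq> H" "hyp n w = K" for K w
  proof -
    have "K \<notin> S x y" using S K by simp
    then have s: "dot x w > 0 \<longleftrightarrow> dot y w > 0" using side_any[OF K(1,3) x y] by blast
    have "x \<notin> hyp n w" "y \<notin> hyp n w" using x y K by blast+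
    then have nz: "dot x w \<noteq> 0" "dot y w \<noteq> 0" using x y by (simp_all add: hyp_def)
    show ?thesis
    proof (cases "dot y w > 0")
      case True
      then have "dot p w > 0" unfolding dp using s t by (intro convex_pos) auto
      then show ?thesis using True by simp
    next
      case False
      then have "dot x w < 0" "dot y w < 0" using s nz by linarith+
      then have "dot p w < 0" unfolding dp using t by (intro convex_neg) auto
      then show ?thesis using False by simp
    qed
  qed
  have "side K (\<rho> H x) = side K y" if K: "K \<in> \<H>" for K
  proof (cases "K = H")
    case True
    then show ?thesis using rho_flip[OF H x] S by (auto simp: sep_def)
  next
    case False
    let ?w = "\<rho> H (\<nu> K)"
    have HH: "\<rho> H ` H = H"
    proof -
      have "dot (\<nu> H) (\<nu> H) \<noteq> 0" using nu_pos[OF H] by simp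
      then have "\<rho> H (\<nu> H) = (\<lambda>i. - \<nu> H i)" by (simp add: reflect_def)
      then have "hyp n (\<rho> H (\<nu> H)) = hyp n (\<nu> H)" by (simp add: hyp_def dotn_def sum_negf)
      then show ?thesis unfolding rho_hyp[OF H H] normal(3)[OF H] .
    qed
    have ne: "\<rho> H ` K \<noteq> H"
    proof
      assume "\<rho> H ` K = H"
      then have "\<rho> H ` \<rho> H ` K = \<rho> H ` H" by simp
      then show False using rho_image2[OF H, of K] HH False by simp
    qed
    have K': "\<rho> H ` K \<in> \<H>" "hyp n ?w = \<rho> H ` K" using closed[OF H K] rho_hyp[OF H K] by auto
    have "\<rho> H ` K \<notin> S x y" using S ne by simp
    \<comment> \<open>The sign is carried from x to y and on to p along the reflected hyperplane,
      then from p back to y along K itself; the fixed point p is where the two hyperplanes can be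
      exchanged.\<close>
    then have "dot x ?w > 0 \<longleftrightarrow> dot y ?w > 0" using side_any[OF K' x y] by blast
    also have "\<dots> \<longleftrightarrow> dot p ?w > 0" using conv[OF K'(1) ne K'(2)] by simp
    also have "\<dots> \<longleftrightarrow> dot p (\<nu> K) > 0" unfolding dotn_reflect_swap[symmetric] fixp ..
    also have "\<dots> \<longleftrightarrow> dot y (\<nu> K) > 0" using conv[OF K False normal(3)[OF K]] .
    finally show ?thesis by (simp add: side_def dotn_reflect_swap)
  qed
  then show ?thesis by (auto simp: sep_def)
qed

text \<open>Each vertex is represented by one point of its chamber, and a reflected point is
  replaced by the representative of the chamber it falls into. All statements about representatives
  are thus made up to an empty set of separating hyperplanes.\<close>

lemma tope_mirror_system:
  assumes V: "finite V" and f: "graph_iso_map f V E (chambers n \<H>) (tope_edges n \<H>)"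
  shows "\<exists>sd r. mirror_system V \<H> sd r \<and> (\<forall>u\<in>V. \<forall>v\<in>V. {u, v} \<in> E \<longleftrightarrow> card (sep \<H> sd u v) = 1)"
proof -
  have bij: "bij_betw f V (ch ` reg)" and fE: "\<And>u v. u \<in> V \<Longrightarrow> v \<in> V \<Longrightarrow> {u, v} \<in> E \<longleftrightarrow> {f u, f v} \<in> tope_edges n \<H>"
    using f chambers_eq by (auto simp: graph_iso_map_def)
  define pt where "pt v = (SOME x. x \<in> reg \<and> ch x = f v)" for v
  have pt: "pt v \<in> reg" "ch (pt v) = f v" if "v \<in> V" for v
  proof -
    have "f v \<in> ch ` reg" using bij that by (auto simp: bij_betw_def)
    then have "\<exists>x. x \<in> reg \<and> ch x = f v" by auto
    from someI_ex[OF this] show "pt v \<in> reg" "ch (pt v) = f v" unfolding pt_def by auto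
  qed
  have vtx: "\<exists>v\<in>V. S (pt v) z = {}" if "z \<in> reg" for z
  proof -
    have "ch z \<in> f ` V" using bij that by (auto simp: bij_betw_def)
    then obtain v where v: "v \<in> V" "ch z = f v" by auto
    then have "S (pt v) z = {}" using ch_eq_iff[OF pt(1)[OF v(1)] that] pt(2)[OF v(1)] by simp
    then show ?thesis using v by blast
  qed
  have inj: "u = v" if "u \<in> V" "v \<in> V" "S (pt u) (pt v) = {}" for u v
  proof -
    have "f u = f v" using ch_eq_iff[of "pt u" "pt v"] pt that by simp
    then show ?thesis using bij that by (auto simp: bij_betw_def inj_on_def)
  qed
  define vt where "vt z = (SOME v. v \<in> V \<and> S (pt v) z = {})" for z
  have vt: "vt z \<in> V" "S (pt (vt z)) z = {}" if "z \<in> reg" for z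
  proof -
    have "\<exists>v. v \<in> V \<and> S (pt v) z = {}" using vtx[OF that] by blast
    from someI_ex[OF this] show "vt z \<in> V" "S (pt (vt z)) z = {}" unfolding vt_def by auto
  qed
  define sd where "sd H v = side H (pt v)" for H v
  have sd: "sep \<H> sd u v = S (pt u) (pt v)" for u v by (simp add: sep_def sd_def)
  define r where "r H v = (if v \<in> V then vt (\<rho> H (pt v)) else v)" for H v
  have ptr: "S (pt (r H v)) z = S (\<rho> H (pt v)) z" if "H \<in> \<H>" "v \<in> V" for H v z
    using S_trans[OF vt(2)[OF rho_reg[OF that(1) pt(1)[OF that(2)]]]] that by (simp add: r_def)
  have rV: "r H v \<in> V" if "H \<in> \<H>" "v \<in> V" for H v
    using vt(1)[OF rho_reg[OF that(1) pt(1)[OF that(2)]]] that by (simp add: r_def)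
  have Srr: "card (S (pt (r H u)) (pt (r H v))) = card (S (pt u) (pt v))" if "H \<in> \<H>" "u \<in> V" "v \<in> V" for H u v
  proof -
    have "S (pt (r H u)) (pt (r H v)) = S (\<rho> H (pt u)) (pt (r H v))" using ptr[OF that(1,2)] .
    also have "\<dots> = S (pt (r H v)) (\<rho> H (pt u))" by (rule sep_commute)
    also have "\<dots> = S (\<rho> H (pt v)) (\<rho> H (pt u))" using ptr[OF that(1,3)] .
    finally show ?thesis
      using card_S_rho[OF that(1) pt(1)[OF that(3)] pt(1)[OF that(2)]] sep_commute[of \<H> side "pt v" "pt u"] by simp
  qed
  have rr: "r H (r H v) = v" if "H \<in> \<H>" for H v
  proof (cases "v \<in> V")
    case True
    note R = pt(1)[OF True] pt(1)[OF rV[OF that True]]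
    have "S (\<rho> H (pt v)) (pt (r H v)) = {}"
      using ptr[OF that True, of "pt (r H v)"] by simp
    from S_rho_empty[OF that rho_reg[OF that R(1)] R(2) this]
    have "S (\<rho> H (pt (r H v))) (pt v) = {}" using rho_rho[OF that] by (simp add: sep_commute)
    then have "S (pt (r H (r H v))) (pt v) = {}" using ptr[OF that rV[OF that True]] by simp
    then show ?thesis using inj rV that True by blast
  qed (simp add: r_def)
  have "mirror_system V \<H> sd r"
  proof
    show "finite V" "finite \<H>" using V finite_H by auto
    show "V \<noteq> {}" using ex_reg vtx by blast
    fix u v assume uv: "u \<in> V" "v \<in> V"
    show "\<exists>z\<in>V. \<exists>H\<in>sep \<H> sd u v. sep \<H> sd z v = {H}" if "u \<noteq> v"
    proof -
      have "S (pt v) (pt u) \<noteq> {}" using inj that uv by blast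
      from chamber_step[OF pt(1)[OF uv(2)] pt(1)[OF uv(1)] this]
      obtain z H where z: "z \<in> reg" "H \<in> S (pt v) (pt u)" "S (pt v) z = {H}" by blast
      have "S (pt (vt z)) (pt v) = {H}" using S_trans[OF vt(2)[OF z(1)]] z(3) by (simp add: sep_commute)
      moreover have "H \<in> S (pt u) (pt v)" using z(2) sep_commute by metis
      ultimately show ?thesis using vt(1)[OF z(1)] unfolding sd by blast
    qed
    show "r H u = v" if "sep \<H> sd u v = {H}" for H
    proof -
      have S: "S (pt u) (pt v) = {H}" using that sd by simp
      then have "H \<in> \<H>" by (auto simp: sep_def)
      moreover from rho_swap[OF pt(1)[OF uv(1)] pt(1)[OF uv(2)] S] have "S (\<rho> H (pt u)) (pt v) = {}" .
      ultimately show ?thesis using inj ptr rV uv by metis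
    qed
    show "card (sep \<H> sd (r H u) (r H v)) = 1" if "H \<in> \<H>" "card (sep \<H> sd u v) = 1" for H
      using Srr[OF that(1) uv] that(2) sd by simp
  next
    fix H v assume H: "H \<in> \<H>"
    show "r H (r H v) = v" using rr[OF H] .
    show "r H permutes V" unfolding permutes_def using rr[OF H] by (metis r_def)
    show "sd H (r H v) \<noteq> sd H v" if "v \<in> V"
    proof -
      have "side H (pt (r H v)) = side H (\<rho> H (pt v))"
        using ptr[OF H that, of "\<rho> H (pt v)"] H by (auto simp: sep_def)
      then show ?thesis using rho_flip[OF H pt(1)[OF that]] by (simp add: sd_def)
    qed
  qed
  moreover have "{u, v} \<in> E \<longleftrightarrow> card (sep \<H> sd u v) = 1" if "u \<in> V" "v \<in> V" for u v
    using fE[OF that] tope_edge_iff[OF pt(1)[OF that(1)] pt(1)[OF that(2)]] pt(2) that sd by simp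
  ultimately show ?thesis by blast
qed

end

lemma reflection_arrangement_imp_reflections:
  assumes "reflection_arrangement n \<H>" shows "\<exists>\<nu>. reflections n \<H> \<nu>"
proof -
  have "\<forall>H\<in>\<H>. \<exists>v. v \<in> Rn n \<and> v \<noteq> (\<lambda>_. 0) \<and> H = hyp n v \<and> (\<forall>H'\<in>\<H>. reflect n v ` H' \<in> \<H>)"
    using assms by (auto simp: reflection_arrangement_def)
  from bchoice[OF this] obtain \<nu> where \<nu>: "\<forall>H\<in>\<H>. \<nu> H \<in> Rn n \<and> \<nu> H \<noteq> (\<lambda>_. 0) \<and> H = hyp n (\<nu> H) \<and>
    (\<forall>H'\<in>\<H>. reflect n (\<nu> H) ` H' \<in> \<H>)" by blast
  have "finite \<H>" using assms by (simp add: reflection_arrangement_def)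
  then have "reflections n \<H> \<nu>" by unfold_locales (use \<nu> in auto)
  then show ?thesis by blast
qed

section \<open>Finite Coxeter groups as reflection groups\<close>

definition unit_vec :: "nat \<Rightarrow> nat \<Rightarrow> real" where
  "unit_vec i = (\<lambda>t. if t = i then 1 else 0)"

locale coxeter_system =
  fixes m :: nat and k :: "nat \<Rightarrow> nat \<Rightarrow> enat"
  assumes M: "coxeter_matrix m k"
begin

abbreviation W :: "nat list set" where "W \<equiv> lists {..<m}"
abbreviation eqv :: "nat list \<Rightarrow> nat list \<Rightarrow> bool" (infix \<open>\<doteq>\<close> 50) where "eqv \<equiv> cox_equiv m k"

lemma eqv_refl [simp]: "w \<doteq> w" by (rule cox_equiv.refl)
lemma eqv_sym: "w \<doteq> v \<Longrightarrow> v \<doteq> w" by (rule cox_equiv.sym)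
lemma eqv_trans [trans]: "u \<doteq> v \<Longrightarrow> v \<doteq> w \<Longrightarrow> u \<doteq> w" by (rule cox_equiv.trans)
lemma eqv_append: "u \<doteq> u' \<Longrightarrow> v \<doteq> v' \<Longrightarrow> u @ v \<doteq> u' @ v'" by (rule cox_equiv_append)

lemma eqv_cancel: assumes "i < m" shows "u @ i # i # v \<doteq> u @ v"
  using cox_equiv_context[OF cox_square[OF M assms], of u v] by simp

section \<open>The length function of a Coxeter group\<close>

definition len :: "nat list \<Rightarrow> nat" where "len w = (LEAST n. \<exists>w'. w \<doteq> w' \<and> length w' = n)"

lemma ex_reduced: "\<exists>w'. w \<doteq> w' \<and> length w' = len w"
  unfolding len_def by (rule LeastI_ex) (auto intro: eqv_refl)

lemma len_le: "w \<doteq> w' \<Longrightarrow> len w \<le> length w'"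
  unfolding len_def by (rule Least_le) auto

lemma len_eqv: assumes "w \<doteq> w'" shows "len w = len w'"
proof (rule antisym)
  show "len w \<le> len w'" using ex_reduced[of w'] len_le eqv_trans[OF assms] by metis
  show "len w' \<le> len w" using ex_reduced[of w] len_le eqv_trans[OF eqv_sym[OF assms]] by metis
qed

lemma len_append: "len (u @ v) \<le> len u + length v"
proof -
  obtain u' where u': "u \<doteq> u'" "length u' = len u" using ex_reduced by blast
  have "u @ v \<doteq> u' @ v" using eqv_append[OF u'(1)] by simp
  from len_le[OF this] show ?thesis using u' by simp
qed

lemma len_even: "even (len w) \<longleftrightarrow> even (length w)"
  using ex_reduced[of w] cox_equiv_even by metis

lemma len_snoc_ge: assumes "i < m" shows "len w \<le> len (w @ [i]) + 1"
proof -
  have "len w = len ((w @ [i]) @ [i])" using len_eqv[OF eqv_cancel[OF assms, of w "[]"]] by simp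
  then show ?thesis using len_append[of "w @ [i]" "[i]"] by simp
qed

lemma len_snoc_cases: assumes "i < m"
  shows "len (w @ [i]) = len w + 1 \<or> len (w @ [i]) + 1 = len w"
proof -
  have "len (w @ [i]) \<noteq> len w" using len_even[of "w @ [i]"] len_even[of w] by auto
  moreover have "len (w @ [i]) \<le> len w + 1" using len_append[of w "[i]"] by simp
  ultimately show ?thesis using len_snoc_ge[OF assms, of w] by linarith
qed

lemma len_0: assumes "len w = 0" shows "w \<doteq> []"
  using ex_reduced[of w] assms by auto

lemma ex_reduced_snoc: assumes "w \<in> W" "len w \<noteq> 0"
  obtains v j where "v \<in> W" "j < m" "w \<doteq> v @ [j]" "len w = Suc (length v)"
proof -
  obtain w' where w': "w \<doteq> w'" "length w' = len w" using ex_reduced by blast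
  then have "w' \<noteq> []" using assms by auto
  then obtain v j where v: "w' = v @ [j]" by (metis rev_exhaust)
  have "w' \<in> W" using cox_equiv_lists[OF w'(1)] assms by simp
  then have "v \<in> W" "j < m" using v by auto
  then show ?thesis using that w' v by simp
qed

lemma ex_descent: assumes "w \<in> W" "\<not> w \<doteq> []" shows "\<exists>i<m. len (w @ [i]) < len w"
proof -
  have "len w \<noteq> 0" using len_0 assms by blast
  from ex_reduced_snoc[OF assms(1) this] obtain v j where v: "j < m" "w \<doteq> v @ [j]" "len w = Suc (length v)" by metis
  have "w @ [j] \<doteq> (v @ [j]) @ [j]" using eqv_append[OF v(2)] by simp
  also have "(v @ [j]) @ [j] \<doteq> v" using eqv_cancel[OF v(1), of v "[]"] by simp
  finally have "len (w @ [j]) \<le> length v" by (rule len_le)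
  then show ?thesis using v by auto
qed

text \<open>The geometric representation. A missing relation (\<open>k i j = \<infinity>\<close>) corresponds to the value
  \<open>-1\<close> of the bilinear form.\<close>

definition cosk :: "nat \<Rightarrow> nat \<Rightarrow> real" where
  "cosk i j = (case k i j of enat n \<Rightarrow> cos (pi / real n) | \<infinity> \<Rightarrow> 1)"

definition form :: "(nat \<Rightarrow> real) \<Rightarrow> nat \<Rightarrow> real" where
  "form x i = (\<Sum>j<m. x j * (- cosk j i))"

definition sigma :: "nat \<Rightarrow> (nat \<Rightarrow> real) \<Rightarrow> nat \<Rightarrow> real" where
  "sigma i x = (\<lambda>t. x t - 2 * form x i * unit_vec i t)"

primrec sg :: "nat list \<Rightarrow> (nat \<Rightarrow> real) \<Rightarrow> nat \<Rightarrow> real" where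
  "sg [] = id"
| "sg (i # w) = sigma i \<circ> sg w"

lemma k_diag: "i < m \<Longrightarrow> k i i = 1" and k_sym: "i < m \<Longrightarrow> j < m \<Longrightarrow> k i j = k j i"
  and k_ge_2: "i < m \<Longrightarrow> j < m \<Longrightarrow> i \<noteq> j \<Longrightarrow> k i j \<ge> 2"
  using M unfolding coxeter_matrix_def by metis+

lemma cosk_sym: "i < m \<Longrightarrow> j < m \<Longrightarrow> cosk i j = cosk j i" by (simp add: cosk_def k_sym)
text \<open>The diagonal entry 1 gives cos pi = -1, and the minus sign in \<open>form\<close> then
  makes every simple root a vector of norm 1.\<close>

lemma cosk_diag: "i < m \<Longrightarrow> cosk i i = -1" by (simp add: cosk_def k_diag one_enat_def)

lemma form_lin: "form (\<lambda>t. a * x t + b * y t) i = a * form x i + b * form y i"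
  by (simp add: form_def sum.distrib sum_distrib_left algebra_simps sum_subtractf sum_negf)

lemma form_unit: assumes "j < m" shows "form (unit_vec j) i = - cosk j i"
proof -
  have "form (unit_vec j) i = (\<Sum>t<m. if t = j then - cosk j i else 0)"
    unfolding form_def unit_vec_def by (rule sum.cong) auto
  then show ?thesis using assms by simp
qed

lemma sigma_lin: "sigma i (\<lambda>t. a * x t + b * y t) = (\<lambda>t. a * sigma i x t + b * sigma i y t)"
  unfolding sigma_def form_lin by (simp add: algebra_simps)

lemma sg_lin: "sg w (\<lambda>t. a * x t + b * y t) = (\<lambda>t. a * sg w x t + b * sg w y t)"
  by (induction w) (simp_all add: sigma_lin)

lemma sg_scale: "sg w (\<lambda>t. a * x t) = (\<lambda>t. a * sg w x t)"
  using sg_lin[of w a x 0 x] by simp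

lemma sg_append: "sg (u @ v) = sg u \<circ> sg v"
  by (induction u) (simp_all add: comp_assoc)

lemma sigma_unit: "i < m \<Longrightarrow> sigma i (unit_vec i) = (\<lambda>t. - unit_vec i t)"
  by (simp add: sigma_def form_unit cosk_diag)

lemma form_sigma: assumes "i < m" shows "form (sigma i x) i = - form x i"
  using form_lin[of 1 x "- 2 * form x i" "unit_vec i" i] assms
  by (simp add: sigma_def form_unit cosk_diag)

lemma sigma_sigma: assumes "i < m" shows "sigma i (sigma i x) = x"
  unfolding sigma_def[of i "sigma i x"] form_sigma[OF assms] by (simp add: sigma_def)

lemma form_plane: assumes "i < m" "j < m" "form y l = 0"
  shows "form (\<lambda>t. y t + a * unit_vec i t + b * unit_vec j t) l = - a * cosk i l - b * cosk j l"
proof -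
  have "form (\<lambda>t. 1 * y t + 1 * (a * unit_vec i t + b * unit_vec j t)) l = - a * cosk i l - b * cosk j l"
    unfolding form_lin form_unit[OF assms(1)] form_unit[OF assms(2)] using assms(3) by simp
  then show ?thesis by (simp add: add.assoc)
qed

lemma sigma_plane:
  assumes "i < m" "j < m" "form y i = 0"
  shows "sigma i (\<lambda>t. y t + a * unit_vec i t + b * unit_vec j t) =
           (\<lambda>t. y t + (2 * cosk i j * b - a) * unit_vec i t + b * unit_vec j t)"
proof -
  have "cosk j i = cosk i j" using cosk_sym assms by simp
  then show ?thesis
    unfolding sigma_def form_plane[OF assms] cosk_diag[OF assms(1)] by (simp add: algebra_simps)
qed

lemma sigma_plane':
  assumes "i < m" "j < m" "form y j = 0"
  shows "sigma j (\<lambda>t. y t + a * unit_vec i t + b * unit_vec j t) =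
           (\<lambda>t. y t + a * unit_vec i t + (2 * cosk i j * a - b) * unit_vec j t)"
proof -
  have "cosk j i = cosk i j" using cosk_sym assms by simp
  with sigma_plane[OF assms(2,1,3), of b a] show ?thesis by (simp add: add.assoc add.left_commute add.commute)
qed

lemma plane_decomp:
  assumes "i < m" "j < m" "(cosk i j)\<^sup>2 \<noteq> 1"
  shows "\<exists>y a b. form y i = 0 \<and> form y j = 0 \<and> x = (\<lambda>t. y t + a * unit_vec i t + b * unit_vec j t)"
proof -
  let ?c = "cosk i j" and ?p = "form x i" and ?q = "form x j"
  \<comment> \<open>The Gram determinant of the two simple roots. The coefficients a and b solve, by
    Cramer's rule, the condition that the remainder of x is orthogonal to both.\<close>
  define d where "d = 1 - ?c\<^sup>2"
  have d: "d \<noteq> 0" using assms by (simp add: d_def)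
  define a where "a = (?p + ?c * ?q) / d"
  define b where "b = (?q + ?c * ?p) / d"
  have ab: "a - ?c * b = ?p" "b - ?c * a = ?q"
    using d unfolding a_def b_def by (simp_all add: field_simps) (simp_all add: d_def algebra_simps power2_eq_square)
  let ?y = "\<lambda>t. 1 * x t + (-1) * (a * unit_vec i t + b * unit_vec j t)"
  have s: "cosk j i = ?c" using cosk_sym assms by simp
  have "form ?y i = 0" "form ?y j = 0"
    unfolding form_lin form_unit[OF assms(1)] form_unit[OF assms(2)] cosk_diag[OF assms(1)] cosk_diag[OF assms(2)] s
    using ab by (simp_all add: algebra_simps)
  moreover have "x = (\<lambda>t. ?y t + a * unit_vec i t + b * unit_vec j t)" by (auto simp: algebra_simps)
  ultimately show ?thesis by blast
qed

text \<open>On the plane of \<open>e\<^sub>i\<close> and \<open>e\<^sub>j\<close> the product \<open>\<sigma>\<^sub>i \<sigma>\<^sub>j\<close> shifts the argument of a sinusoid \<open>f\<close>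
  by two steps, where the coordinates are two consecutive values of \<open>f\<close>.\<close>

lemma sg_relator_distinct:
  assumes ij: "i < m" "j < m" "i \<noteq> j" "k i j = enat n"
  shows "sg (concat (replicate n [i, j])) x = x"
proof -
  have n2: "n \<ge> 2" using k_ge_2[OF ij(1-3)] ij(4) by (simp add: numeral_eq_enat)
  define \<theta> where "\<theta> = pi / real n"
  have c: "cosk i j = cos \<theta>" using ij(4) by (simp add: cosk_def \<theta>_def)
  have "0 < \<theta>" "\<theta> < pi" using n2 by (auto simp: \<theta>_def field_simps)
  then have s: "sin \<theta> \<noteq> 0" using sin_gt_zero by fastforce
  then have "(cosk i j)\<^sup>2 \<noteq> 1" unfolding c using sin_cos_squared_add[of \<theta>] zero_less_power2[of "sin \<theta>"] by linarith
  then obtain y a b where y: "form y i = 0" "form y j = 0" and x: "x = (\<lambda>t. y t + a * unit_vec i t + b * unit_vec j t)"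
    using plane_decomp[OF ij(1,2), of x] by blast
  \<comment> \<open>Chosen so that the sinusoid f takes the values a at 0 and b at 1. Its three-term
    recurrence is the coordinate change made by \<open>sigma_plane\<close>, and 2 n shifts by
    \<theta> are a full turn.\<close>
  define B where "B = (b - a * cos \<theta>) / sin \<theta>"
  define f where "f t = a * cos (t * \<theta>) + B * sin (t * \<theta>)" for t :: real
  have rec: "2 * cos \<theta> * f t - f (t + 1) = f (t - 1)" for t
    by (simp add: f_def algebra_simps cos_add cos_diff sin_add sin_diff)
  have f0: "f 0 = a" "f 1 = b" using s by (simp_all add: f_def B_def)
  have state: "sg (concat (replicate l [i, j])) x =
      (\<lambda>t. y t + f (- 2 * real l) * unit_vec i t + f (1 - 2 * real l) * unit_vec j t)" for l
  proof (induction l)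
    case 0
    then show ?case using f0 x by simp
  next
    case (Suc l)
    have r1: "2 * cos \<theta> * f (- 2 * real l) - f (1 - 2 * real l) = f (1 - 2 * real (Suc l))"
    proof -
      have "- 2 * real l + 1 = 1 - 2 * real l" "- 2 * real l - 1 = 1 - 2 * real (Suc l)" by simp_all
      then show ?thesis using rec[of "- 2 * real l"] by (simp only:)
    qed
    have r2: "2 * cos \<theta> * f (1 - 2 * real (Suc l)) - f (- 2 * real l) = f (- 2 * real (Suc l))"
    proof -
      have "1 - 2 * real (Suc l) + 1 = - 2 * real l" "1 - 2 * real (Suc l) - 1 = - 2 * real (Suc l)" by simp_all
      then show ?thesis using rec[of "1 - 2 * real (Suc l)"] by (simp only:)
    qed
    have "sg (concat (replicate (Suc l) [i, j])) x = sigma i (sigma j (sg (concat (replicate l [i, j])) x))" by simp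
    then show ?case unfolding Suc.IH sigma_plane'[OF ij(1,2) y(2)] c r1 sigma_plane[OF ij(1,2) y(1)] r2 .
  qed
  have nt: "real n * \<theta> = pi" using n2 by (simp add: \<theta>_def)
  have e: "(- 2 * real n) * \<theta> = - (2 * pi)" "(1 - 2 * real n) * \<theta> = \<theta> - 2 * pi"
    using nt by (simp_all add: algebra_simps)
  have fn: "f (- 2 * real n) = f 0" "f (1 - 2 * real n) = f 1"
    unfolding f_def e by (simp_all add: cos_diff sin_diff)
  have "sg (concat (replicate n [i, j])) x = (\<lambda>t. y t + a * unit_vec i t + b * unit_vec j t)"
    unfolding state fn f0 ..
  then show ?thesis using x by simp
qed

lemma sg_eqv: "w \<doteq> w' \<Longrightarrow> sg w = sg w'"
proof (induction rule: cox_equiv.induct)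
  case (rel r u v)
  then obtain i j n where r: "i < m" "j < m" "k i j = enat n" "r = concat (replicate n [i, j])"
    unfolding cox_relator_def by blast
  have "sg r x = x" for x
  proof (cases "i = j")
    case True
    then have "n = 1" using r k_diag by (simp add: one_enat_def)
    then show ?thesis using r True sigma_sigma by simp
  next
    case False
    show ?thesis unfolding r(4) by (rule sg_relator_distinct[OF r(1,2) False r(3)])
  qed
  then show ?case by (auto simp: sg_append)
qed auto

lemma sg_rev_left: "w \<in> W \<Longrightarrow> sg (rev w) (sg w x) = x"
  using sg_eqv[OF cox_rev_left[OF M]] by (metis comp_apply id_apply sg.simps(1) sg_append)

lemma sg_rev_right: "w \<in> W \<Longrightarrow> sg w (sg (rev w) x) = x"
  using sg_eqv[OF cox_rev_right[OF M]] by (metis comp_apply id_apply sg.simps(1) sg_append)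

lemma sg_outside: assumes "w \<in> W" "t \<ge> m" shows "sg w x t = x t"
  using assms by (induction w) (auto simp: sigma_def unit_vec_def)

text \<open>The Chebyshev polynomial of the second kind of degree n - 1, that is sin(n \<theta>) /
  sin \<theta> at c = cos \<theta>. The recursion also covers c = 1, the case of a missing relation,
  where this quotient makes no sense.\<close>

fun cheb :: "real \<Rightarrow> nat \<Rightarrow> real" where
  "cheb c 0 = 0"
| "cheb c (Suc 0) = 1"
| "cheb c (Suc (Suc n)) = 2 * c * cheb c (Suc n) - cheb c n"

lemma cheb_sin: "cheb (cos \<theta>) n * sin \<theta> = sin (real n * \<theta>)"
proof (induction n rule: induct_nat_012)
  case (ge2 n)
  have "cheb (cos \<theta>) (Suc (Suc n)) * sin \<theta> =
      2 * cos \<theta> * (cheb (cos \<theta>) (Suc n) * sin \<theta>) - cheb (cos \<theta>) n * sin \<theta>"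
    by (simp add: algebra_simps)
  also have "\<dots> = 2 * cos \<theta> * sin (real (Suc n) * \<theta>) - sin (real n * \<theta>)"
    unfolding ge2 ..
  also have "\<dots> = sin (real (Suc n) * \<theta> + \<theta>)"
  proof -
    have "sin (real n * \<theta>) = sin (real (Suc n) * \<theta> - \<theta>)" by (simp add: algebra_simps)
    then show ?thesis unfolding sin_add sin_diff by simp
  qed
  finally show ?case by (simp add: algebra_simps)
qed simp_all

lemma cheb_1: "cheb 1 n = real n"
  by (induction n rule: induct_nat_012) auto

lemma cheb_nonneg: assumes "i < m" "j < m" "i \<noteq> j" "enat l \<le> k i j" shows "cheb (cosk i j) l \<ge> 0"
proof (cases "k i j")
  case (enat n)
  then have n: "n \<ge> 2" "l \<le> n" using k_ge_2[OF assms(1-3)] assms(4) by (auto simp: numeral_eq_enat)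
  let ?\<theta> = "pi / real n"
  have c: "cosk i j = cos ?\<theta>" using enat by (simp add: cosk_def)
  have "0 < ?\<theta>" "?\<theta> < pi" using n by (auto simp: field_simps)
  then have s: "sin ?\<theta> > 0" using sin_gt_zero by blast
  have "real l * ?\<theta> \<le> pi" using n by (simp add: field_simps)
  then have "sin (real l * ?\<theta>) \<ge> 0" using n by (intro sin_ge_zero) auto
  then have "cheb (cos ?\<theta>) l * sin ?\<theta> \<ge> 0" by (simp add: cheb_sin)
  then show ?thesis unfolding c using s by (simp add: zero_le_mult_iff)
next
  case infinity
  then show ?thesis by (simp add: cosk_def cheb_1)
qed

lemma rev_alt_Suc: "rev (alt (Suc L) j i) = (if even L then j else i) # rev (alt L j i)"
  unfolding alt_Suc_right by simp

text \<open>Each further letter replaces the older of two consecutive Chebyshev values by the next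
  one, in the coordinate of that letter. Positivity of dihedral roots is thus reduced to
  \<open>cheb_nonneg\<close>.\<close>

lemma sg_alt_unit: assumes "i < m" "j < m"
  shows "sg (rev (alt L j i)) (unit_vec i) =
    (\<lambda>t. (if even L then cheb (cosk i j) (Suc L) else cheb (cosk i j) L) * unit_vec i t +
         (if even L then cheb (cosk i j) L else cheb (cosk i j) (Suc L)) * unit_vec j t)"
proof (induction L)
  case (Suc L)
  have 0: "form (\<lambda>_. 0) l = 0" for l by (simp add: form_def)
  show ?case
    unfolding rev_alt_Suc sg.simps comp_apply Suc.IH
    using sigma_plane[OF assms 0, of "cheb (cosk i j) L" "cheb (cosk i j) (Suc L)"]
      sigma_plane'[OF assms 0, of "cheb (cosk i j) (Suc L)" "cheb (cosk i j) L"] by simp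
qed simp

lemma braid_rev: assumes "i < m" "j < m" "k i j = enat n" shows "rev (alt n j i) \<doteq> rev (alt n i j)"
  unfolding rev_alt using cox_braid[OF M assms] eqv_sym by simp

text \<open>Tits' positivity theorem: \<open>\<ell>(w s\<^sub>i) > \<ell>(w)\<close> implies \<open>w e\<^sub>i \<ge> 0\<close>. One splits off from \<open>w\<close> a longest possible
  alternating suffix in \<open>i\<close> and \<open>j\<close>, which reduces the claim to the dihedral case.\<close>

lemma tits:
  assumes "w \<in> W" "i < m" "len w < len (w @ [i])"
  shows "\<forall>t. sg w (unit_vec i) t \<ge> 0"
  using assms
proof (induction "len w" arbitrary: w i rule: less_induct)
  case less
  note wW = less.prems(1) and i = less.prems(2) and asc = less.prems(3)
  show ?case
  proof (cases "len w = 0")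
    case True
    then show ?thesis using sg_eqv[OF len_0] by (simp add: unit_vec_def)
  next
    case False
    from ex_reduced_snoc[OF wW False] obtain v0 j where v0: "v0 \<in> W" "j < m" "w \<doteq> v0 @ [j]" "len w = Suc (length v0)" by metis
    have "i \<noteq> j"
    proof
      assume ij: "i = j"
      have "w @ [j] \<doteq> (v0 @ [j]) @ [j]" using eqv_append[OF v0(3)] by simp
      also have "(v0 @ [j]) @ [j] \<doteq> v0" using eqv_cancel[OF v0(2), of v0 "[]"] by simp
      finally have "len (w @ [j]) \<le> length v0" by (rule len_le)
      then show False using asc ij v0 by simp
    qed
    \<comment> \<open>w splits, with lengths adding up, into v and an alternating suffix of length L
      in i and j whose last letter is j.\<close>
    define Q where "Q L \<longleftrightarrow> (\<exists>v\<in>W. w \<doteq> v @ rev (alt L j i) \<and> len v + L = len w)" for L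
    have "len (v0 @ [j]) \<le> len v0 + 1" "len v0 \<le> length v0"
      using len_append[of v0 "[j]"] len_le[of v0 v0] by simp_all
    then have "len v0 + 1 = len w" using len_eqv[OF v0(3)] v0(4) by simp
    moreover have "rev (alt 1 j i) = [j]" by simp
    ultimately have Q1: "Q 1" unfolding Q_def using v0 by metis
    have "L \<le> len w" if "Q L" for L using that by (auto simp: Q_def)
    then obtain L where L: "Q L" "\<And>L'. Q L' \<Longrightarrow> L' \<le> L" using Q1 ex_has_greatest_nat[of Q 1 "\<lambda>x. x" "Suc (len w)"] by (metis less_Suc_eq_le)
    have L1: "L \<ge> 1" using L Q1 by blast
    obtain v where v: "v \<in> W" "w \<doteq> v @ rev (alt L j i)" "len v + L = len w" using L(1) by (auto simp: Q_def)
    \<comment> \<open>Once L reached a finite \<open>k i j\<close>, the braid relation would let the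
      suffix end in i, and appending i to w would shorten it.\<close>
    have Lk: "enat L < k i j"
    proof (rule ccontr)
      assume "\<not> enat L < k i j"
      then obtain n where n: "k i j = enat n" "n \<le> L" by (cases "k i j") auto
      then have n2: "n \<ge> 2" using k_ge_2[OF i v0(2) \<open>i \<noteq> j\<close>] by (simp add: numeral_eq_enat)
      then obtain n' where n': "n = Suc n'" by (cases n) auto
      define y where "y = rev (if even n then alt (L - n) j i else alt (L - n) i j)"
      have ra: "rev (alt L j i) = y @ rev (alt n j i)"
        using alt_add_even[of n "L - n" j i] n unfolding y_def by simp
      have "rev (alt n j i) \<doteq> rev (alt n i j)" by (rule braid_rev[OF i v0(2) n(1)])
      moreover have "rev (alt n i j) = rev (alt n' j i) @ [i]" unfolding n' by simp
      ultimately have "rev (alt n j i) \<doteq> rev (alt n' j i) @ [i]" by simp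
      then have "v @ y @ rev (alt n j i) \<doteq> v @ y @ rev (alt n' j i) @ [i]" by (intro eqv_append eqv_refl)
      then have "w \<doteq> v @ y @ rev (alt n' j i) @ [i]" using v(2) ra eqv_trans by simp
      then have "w @ [i] \<doteq> (v @ y @ rev (alt n' j i) @ [i]) @ [i]" by (intro eqv_append eqv_refl)
      also have "(v @ y @ rev (alt n' j i) @ [i]) @ [i] \<doteq> v @ y @ rev (alt n' j i)"
        using eqv_cancel[OF i, of "v @ y @ rev (alt n' j i)" "[]"] by simp
      finally have "len (w @ [i]) = len (v @ y @ rev (alt n' j i))" by (rule len_eqv)
      also have "\<dots> \<le> len v + length (y @ rev (alt n' j i))" by (rule len_append)
      also have "length (y @ rev (alt n' j i)) < L" using n n' by (simp add: y_def)
      finally show False using asc v(3) by simp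
    qed
    \<comment> \<open>The letter that would prolong the suffix to the left: if it shortened v, L
      would not be maximal. If \<open>?fs\<close>, the first letter of the suffix, shortened v, then
      w would be too short. One of these letters is i and the other j, so the induction hypothesis
      applies to v with both simple roots.\<close>
    let ?nx = "if even L then j else i"
    have nx: "len v < len (v @ [?nx])"
    proof (rule ccontr)
      assume "\<not> len v < len (v @ [?nx])"
      then have l: "len (v @ [?nx]) + 1 = len v" using len_snoc_cases[of ?nx v] i v0(2) by auto
      have "v @ ?nx # ?nx # rev (alt L j i) \<doteq> v @ rev (alt L j i)" using eqv_cancel i v0(2) by simp
      then have "w \<doteq> v @ ?nx # ?nx # rev (alt L j i)" using v(2) eqv_trans eqv_sym by blast
      then have "w \<doteq> (v @ [?nx]) @ rev (alt (Suc L) j i)" unfolding rev_alt_Suc by simp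
      moreover have "v @ [?nx] \<in> W" "len (v @ [?nx]) + Suc L = len w" using v i v0(2) l by auto
      ultimately have "Q (Suc L)" unfolding Q_def by blast
      then show False using L(2) by fastforce
    qed
    obtain L' where L': "L = Suc L'" using L1 by (cases L) auto
    let ?fs = "if even L' then j else i"
    have fs: "len v < len (v @ [?fs])"
    proof (rule ccontr)
      assume "\<not> len v < len (v @ [?fs])"
      then have l: "len (v @ [?fs]) + 1 = len v" using len_snoc_cases[of ?fs v] i v0(2) by auto
      have "w \<doteq> (v @ [?fs]) @ rev (alt L' j i)" using v(2) unfolding L' rev_alt_Suc by simp
      then have "len w = len ((v @ [?fs]) @ rev (alt L' j i))" by (rule len_eqv)
      also have "\<dots> \<le> len (v @ [?fs]) + L'" using len_append[of "v @ [?fs]" "rev (alt L' j i)"] by simp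
      finally show False using l v(3) L' by simp
    qed
    have "len v < len (v @ [i])" "len v < len (v @ [j])" using nx fs L' by (auto split: if_splits)
    moreover have "len v < len w" using v L1 by simp
    ultimately have p: "sg v (unit_vec i) t \<ge> 0" "sg v (unit_vec j) t \<ge> 0" for t
      using less.hyps[OF _ v(1)] i v0(2) by blast+
    have ch: "cheb (cosk i j) L \<ge> 0" "cheb (cosk i j) (Suc L) \<ge> 0"
      using Lk by (auto intro!: cheb_nonneg i v0(2) \<open>i \<noteq> j\<close> simp: less_imp_le eSuc_enat[symmetric] ileI1)
    have "sg w (unit_vec i) = sg v (sg (rev (alt L j i)) (unit_vec i))" using sg_eqv[OF v(2)] by (simp add: sg_append)
    then show ?thesis unfolding sg_alt_unit[OF i v0(2)] sg_lin using p ch by auto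
  qed
qed

lemma tits_neg:
  assumes "w \<in> W" "i < m" "len (w @ [i]) < len w"
  shows "\<forall>t. sg w (unit_vec i) t \<le> 0"
proof -
  have "len ((w @ [i]) @ [i]) = len w" using len_eqv[OF eqv_cancel[OF assms(2), of w "[]"]] by simp
  then have "\<forall>t. sg (w @ [i]) (unit_vec i) t \<ge> 0" using tits[of "w @ [i]" i] assms by simp
  moreover have "sg (w @ [i]) (unit_vec i) = (\<lambda>t. - sg w (unit_vec i) t)"
    using sg_scale[of w "-1" "unit_vec i"] sigma_unit[OF assms(2)] by (simp add: sg_append)
  ultimately show ?thesis by simp
qed

text \<open>The sum of the coordinates of the root w e_i. As a nonzero root has coordinates of one
  sign, the sign of this single number tells positive roots from negative ones.\<close>

definition height :: "nat list \<Rightarrow> nat \<Rightarrow> real" where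
  "height w i = (\<Sum>t<m. sg w (unit_vec i) t)"

lemma root_nonzero: assumes "w \<in> W" "i < m" shows "\<exists>t<m. sg w (unit_vec i) t \<noteq> 0"
proof (rule ccontr)
  assume "\<not> ?thesis"
  moreover have "sg w (unit_vec i) t = 0" if "t \<ge> m" for t
    using sg_outside[OF assms(1) that, of "unit_vec i"] that assms(2) by (simp add: unit_vec_def)
  ultimately have "sg w (unit_vec i) = (\<lambda>t. 0 * unit_vec i t)" by (metis mult_zero_left not_le)
  then have "sg (rev w) (sg w (unit_vec i)) = (\<lambda>t. 0 * sg (rev w) (unit_vec i) t)" by (simp only: sg_scale)
  then have "unit_vec i = (\<lambda>t. 0)" unfolding sg_rev_left[OF assms(1)] by simp
  then have "unit_vec i i = 0" by simp
  then show False by (simp add: unit_vec_def)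
qed

lemma height_pos: assumes "w \<in> W" "i < m" "len w < len (w @ [i])" shows "height w i > 0"
proof -
  obtain t where "t < m" "sg w (unit_vec i) t \<noteq> 0" using root_nonzero assms by blast
  then show ?thesis unfolding height_def
    using tits[OF assms] by (intro sum_pos2[of _ t]) (auto simp: less_le)
qed

lemma height_neg: assumes "w \<in> W" "i < m" "len (w @ [i]) < len w" shows "height w i < 0"
proof -
  obtain t where t: "t < m" "sg w (unit_vec i) t \<noteq> 0" using root_nonzero assms by blast
  have "(\<Sum>t<m. - sg w (unit_vec i) t) > 0"
    using t tits_neg[OF assms] by (intro sum_pos2[of _ t]) (auto simp: less_le)
  then show ?thesis by (simp add: height_def sum_negf)
qed

lemma height_cases: assumes "w \<in> W" "i < m"
  shows "(height w i > 0 \<and> (\<forall>t. sg w (unit_vec i) t \<ge> 0) \<and> len w < len (w @ [i])) \<or>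
         (height w i < 0 \<and> (\<forall>t. sg w (unit_vec i) t \<le> 0) \<and> len (w @ [i]) < len w)"
proof (cases "len w < len (w @ [i])")
  case True
  then show ?thesis using height_pos[OF assms] tits[OF assms] by blast
next
  case False
  then have "len (w @ [i]) < len w" using len_snoc_cases[OF assms(2), of w] by linarith
  then show ?thesis using height_neg[OF assms] tits_neg[OF assms] by blast
qed

lemma finite_sg: assumes "finite (cox_elems m k)" shows "finite (sg ` W)"
proof -
  have "sg w = sg (SOME v. v \<in> cox_class m k w)" if "w \<in> W" for w
  proof -
    have "w \<in> cox_class m k w" using that by (simp add: cox_class_def)
    then have "(SOME v. v \<in> cox_class m k w) \<in> cox_class m k w" by (rule someI)
    then show ?thesis using sg_eqv by (simp add: cox_class_def)
  qed
  then have "sg ` W \<subseteq> (\<lambda>C. sg (SOME v. v \<in> C)) ` cox_elems m k" by (auto simp: cox_elems_def)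
  then show ?thesis using assms finite_surj by blast
qed

lemma height_simple: "i < m \<Longrightarrow> w \<doteq> [] \<Longrightarrow> height w i = 1"
  using sg_eqv[of w "[]"] by (simp add: height_def unit_vec_def)

end

text \<open>The group \<open>G\<close> of all \<open>\<sigma>\<^sub>w\<close> is finite. Concatenating the vectors \<open>g x\<close> for \<open>g \<in> G\<close> embeds the
  representation space into a Euclidean space whose standard inner product restricts to the
  \<open>G\<close>-average of the inner product; so every \<open>\<sigma>\<^sub>i\<close> becomes an orthogonal reflection.\<close>

locale finite_coxeter_system = coxeter_system +
  fixes h :: "nat \<Rightarrow> ((nat \<Rightarrow> real) \<Rightarrow> nat \<Rightarrow> real) \<times> nat" and N :: nat
  assumes fin: "finite (cox_elems m k)"
    and h: "bij_betw h {..<N} (sg ` W \<times> {..<m})"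
begin

abbreviation G where "G \<equiv> sg ` W"

lemma finite_G: "finite G" by (rule finite_sg[OF fin])

definition emb :: "(nat \<Rightarrow> real) \<Rightarrow> nat \<Rightarrow> real" where
  "emb x = (\<lambda>n. if n < N then fst (h n) x (snd (h n)) else 0)"

text \<open>The vector representing, on embedded vectors, the functional that sums the coordinates
  after applying \<open>sg w\<close>; its signs against the root hyperplanes are the signs of
  heights. It need not lie in the range of \<open>emb\<close>.\<close>

definition pt :: "nat list \<Rightarrow> nat \<Rightarrow> real" where
  "pt w = (\<lambda>n. if n < N \<and> fst (h n) = sg w then 1 else 0)"

definition ip :: "(nat \<Rightarrow> real) \<Rightarrow> (nat \<Rightarrow> real) \<Rightarrow> real" where
  "ip x y = (\<Sum>g\<in>G. \<Sum>t<m. g x t * g y t)"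

lemma emb_Rn: "emb x \<in> Rn N" by (simp add: emb_def Rn_def)
lemma pt_Rn: "pt w \<in> Rn N" by (simp add: pt_def Rn_def)

lemma h_G: "n < N \<Longrightarrow> fst (h n) \<in> G" using bij_betwE[OF h] by (metis lessThan_iff mem_Sigma_iff prod.collapse)

lemma emb_lin: "emb (\<lambda>t. a * x t + b * y t) = (\<lambda>n. a * emb x n + b * emb y n)"
proof
  fix n
  show "emb (\<lambda>t. a * x t + b * y t) n = a * emb x n + b * emb y n"
    using h_G[of n] by (cases "n < N") (auto simp: emb_def sg_lin)
qed

lemma emb_scale: "emb (\<lambda>t. a * x t) = (\<lambda>n. a * emb x n)"
  using emb_lin[of a x 0 x] by simp

lemma sum_h: "(\<Sum>n<N. F (fst (h n)) (snd (h n))) = (\<Sum>g\<in>G. \<Sum>t<m. F g t)" for F :: "_ \<Rightarrow> _ \<Rightarrow> real"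
proof -
  have "(\<Sum>g\<in>G. \<Sum>t<m. F g t) = (\<Sum>p\<in>G \<times> {..<m}. F (fst p) (snd p))"
    by (simp add: sum.cartesian_product case_prod_beta)
  also have "\<dots> = (\<Sum>n<N. F (fst (h n)) (snd (h n)))"
    by (rule sum.reindex_bij_betw[OF h, symmetric])
  finally show ?thesis ..
qed

lemma dotn_emb: "dotn N (emb x) (emb y) = ip x y"
proof -
  have "dotn N (emb x) (emb y) = (\<Sum>n<N. fst (h n) x (snd (h n)) * fst (h n) y (snd (h n)))"
    unfolding dotn_def emb_def by (rule sum.cong) auto
  then show ?thesis unfolding ip_def sum_h[of "\<lambda>g t. g x t * g y t"] .
qed

lemma dotn_pt: assumes "w \<in> W" shows "dotn N (pt w) (emb y) = (\<Sum>t<m. sg w y t)"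
proof -
  have "dotn N (pt w) (emb y) = (\<Sum>n<N. (if fst (h n) = sg w then fst (h n) y (snd (h n)) else 0))"
    unfolding dotn_def emb_def pt_def by (rule sum.cong) auto
  also have "\<dots> = (\<Sum>g\<in>G. \<Sum>t<m. if g = sg w then g y t else 0)"
    by (rule sum_h)
  also have "\<dots> = (\<Sum>g\<in>G. if g = sg w then (\<Sum>t<m. g y t) else 0)"
    by (rule sum.cong) auto
  also have "\<dots> = (\<Sum>t<m. sg w y t)" using finite_G assms by simp
  finally show ?thesis .
qed

lemma ip_sym: "ip x y = ip y x" by (simp add: ip_def mult.commute)

lemma ip_lin: "ip (\<lambda>t. a * x t + b * z t) y = a * ip x y + b * ip z y"
  unfolding dotn_emb[symmetric] emb_lin dotn_lin ..

lemma ip_scale: "ip (\<lambda>t. a * x t) y = a * ip x y"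
  using ip_lin[of a x 0 x y] by simp

lemma ip_sigma: assumes "i < m" shows "ip (sigma i x) (sigma i y) = ip x y"
proof -
  have mem: "g \<circ> sigma i \<in> G" if gG: "g \<in> G" for g
  proof -
    obtain w where w: "w \<in> W" "g = sg w" using gG by blast
    then have "g \<circ> sigma i = sg (w @ [i])" by (simp add: sg_append)
    moreover have "w @ [i] \<in> W" using w assms by simp
    ultimately show ?thesis by blast
  qed
  have ss: "(g \<circ> sigma i) \<circ> sigma i = g" for g :: "(nat \<Rightarrow> real) \<Rightarrow> nat \<Rightarrow> real"
    using sigma_sigma[OF assms] by auto
  show ?thesis unfolding ip_def
    by (rule sum.reindex_bij_witness[of _ "\<lambda>g. g \<circ> sigma i" "\<lambda>g. g \<circ> sigma i"]) (use mem ss in auto)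
qed

lemma ip_sg: "w \<in> W \<Longrightarrow> ip (sg w x) (sg w y) = ip x y"
  by (induction w) (auto simp: ip_sigma)

lemma ip_sg_left: assumes "w \<in> W" shows "ip x (sg w y) = ip (sg (rev w) x) y"
  using ip_sg[OF assms, of "sg (rev w) x" y] sg_rev_right[OF assms] by simp

lemma ip_unit_pos: assumes "i < m" shows "ip (unit_vec i) (unit_vec i) > 0"
proof -
  have id: "id \<in> G" by (rule image_eqI[of _ _ "[]"]) auto
  have "(\<Sum>t<m. id (unit_vec i) t * id (unit_vec i) t) > 0"
    using assms by (intro sum_pos2[of _ i]) (auto simp: unit_vec_def)
  then show ?thesis unfolding ip_def using finite_G id
    by (intro sum_pos2[of _ id]) (auto intro: sum_nonneg)
qed

text \<open>\<open>sigma i\<close> preserves the averaged product and negates e_i. Comparing the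
  product of x and e_i before and after \<open>sigma i\<close> forces the coefficient in
  \<open>sigma\<close> to be that of the orthogonal reflection.\<close>

lemma form_ip: assumes "i < m" shows "form x i * ip (unit_vec i) (unit_vec i) = ip x (unit_vec i)"
proof -
  let ?e = "unit_vec i"
  have "ip (sigma i x) (sigma i ?e) = ip x ?e" by (rule ip_sigma[OF assms])
  moreover have "ip (sigma i x) (sigma i ?e) = - ip (sigma i x) ?e"
    unfolding sigma_unit[OF assms] using ip_scale[of "-1" ?e "sigma i x"] by (simp add: ip_sym)
  moreover have "ip (sigma i x) ?e = ip x ?e - 2 * form x i * ip ?e ?e"
    using ip_lin[of 1 x "- 2 * form x i" ?e ?e] by (simp add: sigma_def)
  ultimately show ?thesis by simp
qed

definition root :: "nat list \<Rightarrow> nat \<Rightarrow> nat \<Rightarrow> real" where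
  "root v i = emb (sg v (unit_vec i))"

lemma root_Rn: "root v i \<in> Rn N" by (simp add: root_def emb_Rn)

lemma dotn_root: assumes "v \<in> W" "i < m" shows "dotn N (root v i) (root v i) = ip (unit_vec i) (unit_vec i)"
  unfolding root_def dotn_emb ip_sg[OF assms(1)] ..

lemma root_ne_0: assumes "v \<in> W" "i < m" shows "root v i \<noteq> (\<lambda>_. 0)"
proof
  assume "root v i = (\<lambda>_. 0)"
  then have "dotn N (root v i) (root v i) = 0" by (simp add: dotn_def)
  then show False using dotn_root[OF assms] ip_unit_pos[OF assms(2)] by simp
qed

text \<open>The reflection in the root v e_i acts on embedded vectors as the conjugate of the
  generator i by v, so the set of roots is closed under reflections.\<close>

lemma reflect_root_emb: assumes "v \<in> W" "i < m"
  shows "reflect N (root v i) (emb y) = emb (sg (v @ i # rev v) y)"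
proof -
  let ?e = "unit_vec i" and ?z = "sg (rev v) y"
  have "dotn N (emb y) (root v i) = ip ?z ?e"
    unfolding root_def dotn_emb by (rule ip_sg_left[OF assms(1)])
  then have q: "dotn N (emb y) (root v i) / dotn N (root v i) (root v i) = form ?z i"
    unfolding dotn_root[OF assms] using form_ip[OF assms(2), of ?z] ip_unit_pos[OF assms(2)] by (simp add: field_simps)
  have "sg (v @ i # rev v) y = sg v (\<lambda>t. 1 * ?z t + (- 2 * form ?z i) * ?e t)"
    by (simp add: sg_append sigma_def)
  also have "\<dots> = (\<lambda>t. 1 * y t + (- 2 * form ?z i) * sg v ?e t)"
    unfolding sg_lin sg_rev_right[OF assms(1)] ..
  finally have "emb (sg (v @ i # rev v) y) = (\<lambda>n. 1 * emb y n + (- 2 * form ?z i) * root v i n)"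
    unfolding root_def by (simp only: emb_lin)
  then show ?thesis unfolding reflect_lin q by simp
qed

section \<open>The arrangement of root hyperplanes\<close>

definition Hs :: "(nat \<Rightarrow> real) set set" where
  "Hs = (\<lambda>(v, i). hyp N (root v i)) ` (W \<times> {..<m})"

lemma HsI: "v \<in> W \<Longrightarrow> i < m \<Longrightarrow> hyp N (root v i) \<in> Hs" by (force simp: Hs_def)

lemma HsE: assumes "H \<in> Hs" obtains v i where "v \<in> W" "i < m" "H = hyp N (root v i)"
  using assms by (auto simp: Hs_def)

lemma finite_Hs: "finite Hs"
proof -
  have "Hs \<subseteq> (\<lambda>(g, i). hyp N (emb (g (unit_vec i)))) ` (G \<times> {..<m})" by (force simp: Hs_def root_def)
  then show ?thesis using finite_G by (meson finite_SigmaI finite_lessThan finite_surj)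
qed

lemma reflect_Hs: assumes "v \<in> W" "i < m" "H \<in> Hs" shows "reflect N (root v i) ` H \<in> Hs"
proof -
  obtain u j where u: "u \<in> W" "j < m" "H = hyp N (root u j)" using HsE[OF assms(3)] by metis
  have nz: "dotn N (root v i) (root v i) \<noteq> 0"
    unfolding dotn_root[OF assms(1,2)] using ip_unit_pos[OF assms(2)] by simp
  have "reflect N (root v i) ` H = hyp N (reflect N (root v i) (root u j))"
    unfolding u by (rule reflect_hyp[OF root_Rn nz])
  also have "reflect N (root v i) (root u j) = root (v @ i # rev v @ u) j"
    unfolding root_def[of u] reflect_root_emb[OF assms(1,2)] by (simp add: root_def sg_append)
  finally show ?thesis using HsI assms u by simp
qed

lemma reflection_arrangement_Hs: "reflection_arrangement N Hs"
  unfolding reflection_arrangement_def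
proof (intro conjI ballI finite_Hs)
  fix H assume "H \<in> Hs"
  then obtain v i where v: "v \<in> W" "i < m" "H = hyp N (root v i)" using HsE by metis
  then show "\<exists>v\<in>Rn N. v \<noteq> (\<lambda>_. 0) \<and> H = hyp N v \<and> (\<forall>H'\<in>Hs. reflect N v ` H' \<in> Hs)"
    using root_Rn root_ne_0 reflect_Hs by (intro bexI[of _ "root v i"]) auto
qed

text \<open>A hyperplane arises from several pairs, at least from a root and its negative; one pair
  is fixed because \<open>reflections\<close> expects one normal per hyperplane.\<close>

definition rep :: "(nat \<Rightarrow> real) set \<Rightarrow> nat list \<times> nat" where
  "rep H = (SOME p. fst p \<in> W \<and> snd p < m \<and> H = hyp N (root (fst p) (snd p)))"

definition nrm :: "(nat \<Rightarrow> real) set \<Rightarrow> nat \<Rightarrow> real" where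
  "nrm H = root (fst (rep H)) (snd (rep H))"

lemma rep: assumes "H \<in> Hs" shows "fst (rep H) \<in> W" "snd (rep H) < m" "hyp N (nrm H) = H"
proof -
  obtain v i where "v \<in> W" "i < m" "H = hyp N (root v i)" using HsE[OF assms] by metis
  then have "\<exists>p. fst p \<in> W \<and> snd p < m \<and> H = hyp N (root (fst p) (snd p))" by (intro exI[of _ "(v, i)"]) simp
  from someI_ex[OF this] show "fst (rep H) \<in> W" "snd (rep H) < m" "hyp N (nrm H) = H"
    unfolding rep_def[symmetric] nrm_def by auto
qed

sublocale reflections N Hs nrm
proof
  show "finite Hs" by (rule finite_Hs)
  fix H assume H: "H \<in> Hs"
  show "nrm H \<in> Rn N" by (simp add: nrm_def root_Rn)
  show "nrm H \<noteq> (\<lambda>_. 0)" unfolding nrm_def using root_ne_0 rep[OF H] by blast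
  show "hyp N (nrm H) = H" using rep[OF H] by blast
  show "reflect N (nrm H) ` K \<in> Hs" if "K \<in> Hs" for K
    unfolding nrm_def using reflect_Hs rep[OF H] that by blast
qed

section \<open>Chambers of the root arrangement and group elements\<close>

lemma dot_pt_root: assumes "w \<in> W" shows "dotn N (pt w) (root v i) = height (w @ v) i"
  unfolding root_def dotn_pt[OF assms] height_def by (simp add: sg_append)

lemma pt_reg: assumes "w \<in> W" shows "pt w \<in> reg"
proof -
  have "dotn N (pt w) (nrm H) \<noteq> 0" if "H \<in> Hs" for H
    using height_cases[of "w @ fst (rep H)" "snd (rep H)"] rep[OF that] assms
    unfolding nrm_def dot_pt_root[OF assms] by auto
  then show ?thesis unfolding reg_iff using pt_Rn by blast
qed

lemma mem_S_pt: assumes "w \<in> W" "w' \<in> W" "v \<in> W" "i < m"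
  shows "hyp N (root v i) \<in> S (pt w) (pt w') \<longleftrightarrow> (height (w @ v) i > 0) \<noteq> (height (w' @ v) i > 0)"
  using side_any[OF HsI[OF assms(3,4)] HOL.refl pt_reg[OF assms(1)] pt_reg[OF assms(2)]]
  unfolding dot_pt_root[OF assms(1)] dot_pt_root[OF assms(2)] .

lemma pt_eqv: "w \<doteq> w' \<Longrightarrow> pt w = pt w'" unfolding pt_def using sg_eqv by metis

lemma eqv_rev_iff: assumes "w \<in> W" "w' \<in> W" shows "w @ rev w' \<doteq> [] \<longleftrightarrow> w \<doteq> w'"
proof
  assume "w @ rev w' \<doteq> []"
  then have "(w @ rev w') @ w' \<doteq> [] @ w'" by (intro eqv_append eqv_refl)
  then have 1: "w @ (rev w' @ w') \<doteq> w'" by simp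
  have "w @ (rev w' @ w') \<doteq> w @ []" by (intro eqv_append eqv_refl cox_rev_left[OF M assms(2)])
  then have "w @ (rev w' @ w') \<doteq> w" by simp
  from eqv_trans[OF eqv_sym[OF this] 1] show "w \<doteq> w'" .
next
  assume "w \<doteq> w'"
  then have "w @ rev w' \<doteq> w' @ rev w'" by (intro eqv_append eqv_refl)
  then show "w @ rev w' \<doteq> []" using cox_rev_right[OF M assms(2)] eqv_trans by blast
qed

text \<open>Test the roots obtained from the simple ones by \<open>rev w'\<close>. Seen from w' they
  are simple, hence positive, so they are positive seen from w too. Thus the quotient
  \<open>w @ rev w'\<close> has no descent and is trivial.\<close>

lemma S_pt_empty: assumes "w \<in> W" "w' \<in> W" shows "S (pt w) (pt w') = {} \<longleftrightarrow> w \<doteq> w'"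
proof
  assume S: "S (pt w) (pt w') = {}"
  let ?q = "w @ rev w'"
  have q: "?q \<in> W" using assms by simp
  have "\<not> len (?q @ [i]) < len ?q" if "i < m" for i
  proof -
    have "height (w' @ rev w') i = 1" using height_simple[OF that cox_rev_right[OF M assms(2)]] .
    then have "height ?q i > 0" using mem_S_pt[OF assms, of "rev w'" i] S assms that by simp
    then show ?thesis using height_neg[OF q that] by fastforce
  qed
  then have "?q \<doteq> []" using ex_descent[OF q] by blast
  then show "w \<doteq> w'" using eqv_rev_iff[OF assms] by blast
qed (use pt_eqv in force)

text \<open>\<open>sigma i\<close> alters only coordinate i. If a root changes sign under it, every
  other coordinate is both nonnegative and nonpositive, hence zero, and the root is a multiple of
  e_i.\<close>

lemma S_pt_Cons: assumes w: "w \<in> W" and i: "i < m"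
  shows "S (pt (i # w)) (pt w) = {hyp N (root (rev w) i)}"
proof -
  have iw: "i # w \<in> W" and rw: "rev w \<in> W" using assms by auto
  have "hyp N (root (rev w) i) \<in> S (pt (i # w)) (pt w)"
  proof -
    have h1: "height (w @ rev w) i = 1" using height_simple[OF i cox_rev_right[OF M w]] .
    have "[i] @ (w @ rev w) \<doteq> [i] @ []" by (intro eqv_append eqv_refl cox_rev_right[OF M w])
    from sg_eqv[OF this] have "sg ((i # w) @ rev w) = sg [i]" by simp
    then have "height ((i # w) @ rev w) i = height [i] i" by (simp add: height_def)
    also have "height [i] i = - 1" using i by (simp add: height_def sigma_unit sum_negf) (simp add: unit_vec_def)
    finally show ?thesis unfolding mem_S_pt[OF iw w rw i] h1 by simp
  qed
  moreover have "K = hyp N (root (rev w) i)" if K: "K \<in> S (pt (i # w)) (pt w)" for K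
  proof -
    have "K \<in> Hs" using K by (simp add: sep_def)
    then obtain v j where v: "v \<in> W" "j < m" "K = hyp N (root v j)" using HsE by metis
    let ?b = "sg (w @ v) (unit_vec j)"
    have wv: "w @ v \<in> W" "i # w @ v \<in> W" using w v i by auto
    have dif: "(height (i # w @ v) j > 0) \<noteq> (height (w @ v) j > 0)"
      using K mem_S_pt[OF iw w v(1,2)] unfolding v(3) by simp
    have same: "sg (i # w @ v) (unit_vec j) t = ?b t" if "t \<noteq> i" for t
      using that by (simp add: sg_append sigma_def unit_vec_def)
    have z: "?b t = 0" if "t \<noteq> i" for t
      using height_cases[OF wv(1) v(2)] height_cases[OF wv(2) v(2)] dif same[OF that]
      by (metis antisym not_less_iff_gr_or_eq)
    define a where "a = ?b i"
    have b: "?b = (\<lambda>t. a * unit_vec i t)" using z by (auto simp: a_def unit_vec_def)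
    have a: "a \<noteq> 0" using root_nonzero[OF wv(1) v(2)] unfolding b by auto
    have "sg v (unit_vec j) = sg (rev w) ?b" using sg_rev_left[OF w] by (simp add: sg_append)
    also have "\<dots> = (\<lambda>t. a * sg (rev w) (unit_vec i) t)" unfolding b by (rule sg_scale)
    finally have "root v j = (\<lambda>n. a * root (rev w) i n)" unfolding root_def by (simp only: emb_scale)
    then have "dotn N x (root v j) = a * dotn N x (root (rev w) i)" for x
      using dotn_lin_right[of N x a "root (rev w) i" 0 "root (rev w) i"] by simp
    then show ?thesis unfolding v(3) hyp_def using a by simp
  qed
  ultimately show ?thesis by blast
qed

text \<open>By self-adjointness, reflecting the point multiplies w on the right by the reflection as
  a group element. The reflected point need not be of the form \<open>pt\<close>, but it has the
  same inner products with all root normals as such a point.\<close>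

lemma rho_pt: assumes w: "w \<in> W" and H: "H \<in> Hs"
  shows "\<exists>w'\<in>W. S (\<rho> H (pt w)) (pt w') = {}"
proof -
  let ?v = "fst (rep H)" and ?i = "snd (rep H)"
  let ?w = "w @ ?v @ ?i # rev ?v"
  have W: "?w \<in> W" using rep[OF H] w by simp
  have "dotn N (\<rho> H (pt w)) (nrm K) = dotn N (pt ?w) (nrm K)" if "K \<in> Hs" for K
  proof -
    have "reflect N (nrm H) (nrm K) = root (?v @ ?i # rev ?v @ fst (rep K)) (snd (rep K))"
      using reflect_root_emb[OF rep(1,2)[OF H]]
      by (simp add: nrm_def root_def[of "fst (rep K)"] root_def sg_append)
    then show ?thesis
      unfolding dotn_reflect_swap using dot_pt_root[OF w] dot_pt_root[OF W] by (simp add: nrm_def)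
  qed
  then have "S (\<rho> H (pt w)) (pt ?w) = {}" by (auto simp: sep_def side_def)
  then show ?thesis using W by blast
qed

text \<open>From a chamber of the orbit step across a wall towards y. The neighbouring chamber is
  the mirror image at that wall, so by \<open>rho_pt\<close> it again belongs to the orbit, with one
  separating hyperplane fewer.\<close>

lemma pt_surj: assumes y: "y \<in> reg" shows "\<exists>w\<in>W. S (pt w) y = {}"
proof -
  have "\<exists>w\<in>W. S (pt w) y = {}" if "w \<in> W" for w
    using that
  proof (induction "card (S (pt w) y)" arbitrary: w rule: less_induct)
    case less
    show ?case
    proof (cases "S (pt w) y = {}")
      case True then show ?thesis using less.prems by blast
    next
      case False
      from chamber_step[OF pt_reg[OF less.prems] y this]
      obtain z H where z: "z \<in> reg" "H \<in> S (pt w) y" "S (pt w) z = {H}" by blast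
      have H: "H \<in> Hs" using z(2) by (simp add: sep_def)
      obtain w' where w': "w' \<in> W" "S (\<rho> H (pt w)) (pt w') = {}" using rho_pt[OF less.prems H] by blast
      have "S (pt w') y = S z y"
        using S_trans[OF w'(2)] S_trans[OF rho_swap[OF pt_reg[OF less.prems] z(1,3)]] by metis
      also have "\<dots> = S (pt w) y - {H}"
      proof -
        have "K \<in> S z y \<longleftrightarrow> K \<in> S (pt w) y - {H}" for K
        proof (cases "K \<in> Hs")
          case True
          have "K \<in> S (pt w) z \<longleftrightarrow> K = H" using z(3) by auto
          then show ?thesis using mem_sep_cases[OF True, of side "pt w" y z] z(2) by auto
        qed (simp add: sep_def)
        then show ?thesis by blast
      qed
      finally have "card (S (pt w') y) < card (S (pt w) y)" using z(2) finite_S by (metis card_Diff1_less)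
      then show ?thesis using less.hyps w'(1) by blast
    qed
  qed
  from this[of "[]"] show ?thesis by simp
qed

lemma cayley_tope_iso: "graph_iso (cox_elems m k) (cox_cayley_edges m k) (chambers N Hs) (tope_edges N Hs)"
proof -
  let ?c = "cox_class m k"
  define f where "f C = ch (pt (SOME w. w \<in> W \<and> C = ?c w))" for C
  have f: "f (?c w) = ch (pt w)" if "w \<in> W" for w
  proof -
    define v where "v = (SOME v. v \<in> W \<and> ?c w = ?c v)"
    have "v \<in> W \<and> ?c w = ?c v" unfolding v_def
      by (rule someI[of "\<lambda>v. v \<in> W \<and> ?c w = ?c v" w]) (use that in simp)
    then have "w \<doteq> v" using cox_class_eq_iff[OF that, of v] by blast
    from pt_eqv[OF this] show ?thesis unfolding f_def v_def by simp
  qed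
  have cc: "ch (pt w) = ch (pt w') \<longleftrightarrow> w \<doteq> w'" if "w \<in> W" "w' \<in> W" for w w'
    using ch_eq_iff[OF pt_reg[OF that(1)] pt_reg[OF that(2)]] S_pt_empty[OF that] by simp
  have "bij_betw f (cox_elems m k) (chambers N Hs)"
    unfolding bij_betw_def
  proof
    show "inj_on f (cox_elems m k)"
      unfolding inj_on_def cox_elems_def using f cc cox_class_eq_iff by auto
    show "f ` cox_elems m k = chambers N Hs"
    proof
      show "f ` cox_elems m k \<subseteq> chambers N Hs"
      proof
        fix C assume "C \<in> f ` cox_elems m k"
        then obtain w where w: "w \<in> W" "C = f (?c w)" unfolding cox_elems_def by blast
        show "C \<in> chambers N Hs" unfolding chambers_eq w(2) f[OF w(1)] by (rule imageI[OF pt_reg[OF w(1)]])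
      qed
      show "chambers N Hs \<subseteq> f ` cox_elems m k"
      proof
        fix C assume "C \<in> chambers N Hs"
        then obtain y where y: "y \<in> reg" "C = ch y" unfolding chambers_eq by blast
        obtain w where w: "w \<in> W" "S (pt w) y = {}" using pt_surj[OF y(1)] by blast
        then have "C = f (?c w)" using ch_eq_iff[OF pt_reg[OF w(1)] y(1)] f y by simp
        then show "C \<in> f ` cox_elems m k" using w(1) unfolding cox_elems_def by blast
      qed
    qed
  qed
  moreover have "{C, D} \<in> cox_cayley_edges m k \<longleftrightarrow> {f C, f D} \<in> tope_edges N Hs"
    if CD: "C \<in> cox_elems m k" "D \<in> cox_elems m k" for C D
  proof -
    obtain w w' where w: "w \<in> W" "C = ?c w" "w' \<in> W" "D = ?c w'" using CD unfolding cox_elems_def by blast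
    have "{C, D} \<in> cox_cayley_edges m k \<longleftrightarrow> card (S (pt w) (pt w')) = 1"
    proof
      assume "{C, D} \<in> cox_cayley_edges m k"
      then obtain i x where x: "{C, D} = {?c (i # x), ?c x}" "i < m" "x \<in> W" unfolding cox_cayley_edges_def by blast
      have ix: "i # x \<in> W" using x by simp
      have "(w \<doteq> i # x \<and> w' \<doteq> x) \<or> (w \<doteq> x \<and> w' \<doteq> i # x)"
        using x(1) cox_class_eq_iff[OF w(1) ix] cox_class_eq_iff[OF w(1) x(3)]
          cox_class_eq_iff[OF w(3) ix] cox_class_eq_iff[OF w(3) x(3)] unfolding w(2,4) doubleton_eq_iff by blast
      then have "S (pt w) (pt w') = S (pt (i # x)) (pt x)"
        using pt_eqv sep_commute by metis
      then show "card (S (pt w) (pt w')) = 1" using S_pt_Cons[OF x(3,2)] by simp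
    next
      assume "card (S (pt w) (pt w')) = 1"
      then obtain H where H: "S (pt w) (pt w') = {H}" by (metis card_1_singletonE)
      let ?q = "w' @ rev w"
      have q: "?q \<in> W" "rev w \<in> W" using w by auto
      have "\<not> w \<doteq> w'" using S_pt_empty[OF w(1,3)] H by simp
      then have "\<not> ?q \<doteq> []" using eqv_rev_iff[OF w(3,1)] eqv_sym by blast
      \<comment> \<open>A descent of \<open>w' @ rev w\<close> exhibits a root hyperplane separating
        the two points, necessarily the only one. It is also the wall between w and
        \<open>i # w\<close>, so w' and \<open>i # w\<close> lie in the same chamber.\<close>
      then obtain i where i: "i < m" "len (?q @ [i]) < len ?q" using ex_descent[OF q(1)] by blast
      have "height (w @ rev w) i = 1" using height_simple[OF i(1) cox_rev_right[OF M w(1)]] .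
      moreover have "height ?q i < 0" using height_neg[OF q(1) i] .
      ultimately have "hyp N (root (rev w) i) \<in> S (pt w) (pt w')"
        unfolding mem_S_pt[OF w(1,3) q(2) i(1)] by simp
      then have eq: "S (pt (i # w)) (pt w) = S (pt w') (pt w)"
        using S_pt_Cons[OF w(1) i(1)] H sep_commute[of Hs side "pt w'" "pt w"] by simp
      have "S (pt w') (pt (i # w)) = {}" using eq unfolding sep_def by blast
      then have "w' \<doteq> i # w" using S_pt_empty[of w' "i # w"] w i by simp
      then have "{C, D} = {?c (i # w), ?c w}" using cox_class_eq_iff[of w' m "i # w"] w i by auto
      then show "{C, D} \<in> cox_cayley_edges m k" using w i unfolding cox_cayley_edges_def by blast
    qed
    then show ?thesis
      using tope_edge_iff[OF pt_reg[OF w(1)] pt_reg[OF w(3)]] f w by simp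
  qed
  ultimately show ?thesis unfolding graph_iso_def graph_iso_map_def by blast
qed

end

lemma coxeter_imp_tope:
  assumes "coxeter_matrix m k" "finite (cox_elems m k)"
  shows "\<exists>n \<H>. reflection_arrangement n \<H> \<and>
           graph_iso (cox_elems m k) (cox_cayley_edges m k) (chambers n \<H>) (tope_edges n \<H>)"
proof -
  interpret coxeter_system m k by unfold_locales (rule assms)
  have "finite (sg ` W)" by (rule finite_sg[OF assms(2)])
  then have "finite (sg ` W \<times> {..<m})" by simp
  then obtain h where h: "bij_betw h {..<card (sg ` W \<times> {..<m})} (sg ` W \<times> {..<m})"
    using ex_bij_betw_nat_finite by (metis atLeast0LessThan)
  interpret finite_coxeter_system m k h "card (sg ` W \<times> {..<m})"
    by unfold_locales (use assms h in auto)
  show ?thesis using reflection_arrangement_Hs cayley_tope_iso by blast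
qed

lemma graph_iso_map_comp:
  assumes "graph_iso_map f V E V' E'" "graph_iso_map g V' E' V'' E''"
  shows "graph_iso_map (g \<circ> f) V E V'' E''"
proof -
  have "f v \<in> V'" if "v \<in> V" for v using assms(1) that by (auto simp: graph_iso_map_def bij_betw_def)
  then show ?thesis
    using assms bij_betw_trans[of f V V' g V''] by (simp add: graph_iso_map_def)
qed

theorem theorem8:
  fixes V :: "'a set" and E :: "'a set set"
  assumes "finite V" and "simple_graph V E"
  shows "(mirror_graph V E \<longleftrightarrow>
            (\<exists>m k. coxeter_matrix m k \<and> finite (cox_elems m k) \<and>
                   graph_iso V E (cox_elems m k) (cox_cayley_edges m k)))
       \<and> ((\<exists>m k. coxeter_matrix m k \<and> finite (cox_elems m k) \<and>
                   graph_iso V E (cox_elems m k) (cox_cayley_edges m k)) \<longleftrightarrow>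
            (\<exists>n \<H>. reflection_arrangement n \<H> \<and>
                   graph_iso V E (chambers n \<H>) (tope_edges n \<H>)))"
proof -
  let ?cox = "\<exists>m k. coxeter_matrix m k \<and> finite (cox_elems m k) \<and>
                   graph_iso V E (cox_elems m k) (cox_cayley_edges m k)"
  let ?tope = "\<exists>n \<H>. reflection_arrangement n \<H> \<and>
                   graph_iso V E (chambers n \<H>) (tope_edges n \<H>)"
  have 1: ?cox if M: "mirror_graph V E"
  proof -
    from mirror_graph_imp_system[OF M] obtain P :: "'a set set set" and side r
      where sys: "mirror_system V P side r"
        and E: "\<forall>u\<in>V. \<forall>v\<in>V. {u, v} \<in> E \<longleftrightarrow> card (sep P side u v) = 1"
      by blast
    show ?thesis by (rule mirror_system.coxeter[OF sys E[rule_format]])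
  qed
  have 2: ?tope if cox: ?cox
  proof -
    obtain m k f where c: "coxeter_matrix m k" "finite (cox_elems m k)"
      and f: "graph_iso_map f V E (cox_elems m k) (cox_cayley_edges m k)"
      using cox unfolding graph_iso_def by blast
    obtain n \<H> g where "reflection_arrangement n \<H>"
      and "graph_iso_map g (cox_elems m k) (cox_cayley_edges m k) (chambers n \<H>) (tope_edges n \<H>)"
      using coxeter_imp_tope[OF c] unfolding graph_iso_def by blast
    then show ?thesis using graph_iso_map_comp[OF f] unfolding graph_iso_def by blast
  qed
  have 3: "mirror_graph V E" if tope: ?tope
  proof -
    obtain n \<H> f where R: "reflection_arrangement n \<H>"
      and f: "graph_iso_map f V E (chambers n \<H>) (tope_edges n \<H>)"
      using tope unfolding graph_iso_def by blast
    obtain \<nu> where \<nu>: "reflections n \<H> \<nu>" using reflection_arrangement_imp_reflections[OF R] by blast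
    obtain sd r where sys: "mirror_system V \<H> sd r"
      and E: "\<forall>u\<in>V. \<forall>v\<in>V. {u, v} \<in> E \<longleftrightarrow> card (sep \<H> sd u v) = 1"
      using reflections.tope_mirror_system[OF \<nu> assms(1) f] by blast
    show ?thesis by (rule mirror_system.mirror_graph[OF sys assms(2) E[rule_format]])
  qed
  show ?thesis using 1 2 3 by argo
qed

end
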